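(* Let $u_0\in L^2([0,1])$. Let $b,\sigma:\mathbb{R}\to\mathbb{R}$ be functions such that there exist constants $c_3,c_4,c_5,d_3\ge0$ with, for all $u,v\in\mathbb{R}$, $$|b(u)-b(v)|\le c_3|u-v|\log_+\Big(\frac1{|u-v|}\Big)+c_4\log_+(|u|\vee|v|)\,|u-v|+c_5|u-v|,$$ $$|\sigma(u)-\sigma(v)|\le d_3|u-v|.$$ Then for any $T>0$, pathwise uniqueness holds for solutions in $C([0,T],L^2([0,1]))$ of $$\partial_t u(t,x)=\tfrac12\partial_{xx}u(t,x)+b(u(t,x))+\sigma(u(t,x))W(dt,dx),\quad u(t,0)=u(t,1)=0,\quad u(0,x)=u_0(x),\quad x\in[0,1].$$
   Context: Notation: $\log_+(u):=\log(1\vee u)$ for $u\ge 0$; the term $|u-v|\log_+(1/|u-v|)$ is read as $0$ when $u=v$. $W$ is a space-time white noise on $\mathbb{R}_+\times[0,1]$ defined on a filtered probability space $(\Omega,\mathcal{F},\{\mathcal{F}_t\}_{t\ge0},\mathbb{P})$ whose filtration satisfies the usual conditions. The Dirichlet heat kernel on $[0,1]$ is $p_t(x,y):=\sum_{n=1}^\infty e^{-\frac12 n^2\pi^2 t}e_n(x)e_n(y)$ with $e_n(x)=\sqrt2\sin(n\pi x)$, and $P_tf(x):=\int_0^1p_t(x,y)f(y)\,dy$. Solution: an $L^2([0,1])$-valued random field solution of the equation is a jointly measurable and adapted process $u=\{u(t,x)\}$ such that $u(t)\in L^2([0,1])$ $\mathbb{P}$-a.s. for every $t$ and $$u(t,x)=P_tu_0(x)+\int_0^t\int_0^1p_{t-s}(x,y)b(u(s,y))\,dy\,ds+\int_0^t\int_0^1p_{t-s}(x,y)\sigma(u(s,y))\,W(ds,dy)$$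 for almost every $x\in[0,1]$, almost surely. Pathwise uniqueness in $C([0,T],L^2([0,1]))$ means: if $u,v$ are two solutions on the same filtered probability space, driven by the same $W$, with the same initial value $u_0$, and with sample paths a.s. in $C([0,T],L^2([0,1]))$, then $\sup_{t\le T}\|u(t)-v(t)\|_{L^2([0,1])}=0$ $\mathbb{P}$-a.s. *)

theory Defs
  imports "HOL-Probability.Probability"
begin

definition log_plus :: "real \<Rightarrow> real" where
  "log_plus r = ln (max 1 r)"

text \<open>Square-integrable functions on the unit interval are represented by functions on the real
  line of which only the values on \<open>[0,1]\<close> matter.\<close>

definition L2 :: "(real \<Rightarrow> real) \<Rightarrow> bool" where
  "L2 f \<longleftrightarrow> f \<in> borel_measurable (lebesgue_on {0..1}) \<and>
     integrable (lebesgue_on {0..1}) (\<lambda>x. (f x)\<^sup>2)"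

definition L2_norm :: "(real \<Rightarrow> real) \<Rightarrow> real" where
  "L2_norm f = sqrt (LINT x|lebesgue_on {0..1}. (f x)\<^sup>2)"

definition path_in_C_L2 :: "real \<Rightarrow> (real \<Rightarrow> real \<Rightarrow> real) \<Rightarrow> bool" where
  "path_in_C_L2 T f \<longleftrightarrow> (\<forall>t\<in>{0..T}. L2 (f t)) \<and>
     (\<forall>s\<in>{0..T}. ((\<lambda>t. L2_norm (\<lambda>x. f t x - f s x)) \<longlongrightarrow> 0) (at s within {0..T}))"

definition dirichlet_eigenfunction :: "nat \<Rightarrow> real \<Rightarrow> real" where
  "dirichlet_eigenfunction n x = sqrt 2 * sin (real n * pi * x)"

text \<open>The series converges for \<open>t > 0\<close> only; the values at \<open>t \<le> 0\<close> are irrelevant.\<close>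

definition heat_kernel :: "real \<Rightarrow> real \<Rightarrow> real \<Rightarrow> real" where
  "heat_kernel t x y = (\<Sum>k. exp (- (1/2) * (real (Suc k))\<^sup>2 * pi\<^sup>2 * t) *
     dirichlet_eigenfunction (Suc k) x * dirichlet_eigenfunction (Suc k) y)"

text \<open>The semigroup is the identity at time 0, where the kernel degenerates to the Dirac measure.
  The mild equation below therefore contains the initial condition as its instance at time 0.\<close>

definition heat_semigroup :: "real \<Rightarrow> (real \<Rightarrow> real) \<Rightarrow> real \<Rightarrow> real" where
  "heat_semigroup t f x =
     (if t = 0 then f x else (LINT y|lebesgue_on {0..1}. heat_kernel t x y * f y))"

text \<open>Time runs through \<open>[0,\<infinity>)\<close>; a filtration is unconstrained at negative times. Taking \<open>A\<close> to be
  an arbitrary subset of a null set makes \<open>M\<close> itself complete.\<close>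

locale usual_filtered_prob_space = prob_space M for M :: "'w measure" +
  fixes F :: "real \<Rightarrow> 'w measure"
  assumes subalg: "\<And>t. 0 \<le> t \<Longrightarrow> subalgebra M (F t)"
    and mono: "\<And>s t. 0 \<le> s \<Longrightarrow> s \<le> t \<Longrightarrow> sets (F s) \<subseteq> sets (F t)"
    and right_continuous: "\<And>t. 0 \<le> t \<Longrightarrow> sets (F t) = (\<Inter>s\<in>{t<..}. sets (F s))"
    and complete: "\<And>N A. N \<in> null_sets M \<Longrightarrow> A \<subseteq> N \<Longrightarrow> A \<in> sets (F 0)"

definition centred_gaussian :: "'w measure \<Rightarrow> ('w \<Rightarrow> real) \<Rightarrow> real \<Rightarrow> bool" where
  "centred_gaussian M X v \<longleftrightarrow> X \<in> borel_measurable M \<and>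
     (if v = 0 then AE \<omega> in M. X \<omega> = 0
      else distributed M lborel X (\<lambda>x. ennreal (normal_density 0 (sqrt v) x)))"

text \<open>In points of the plane the first coordinate is time and the second one is space.\<close>

definition noise_sets :: "(real \<times> real) set set" where
  "noise_sets = {A \<in> sets borel. A \<subseteq> {0..} \<times> {0..1} \<and> emeasure lborel A < \<infinity>}"

text \<open>White noise is the centred Gaussian family with covariance \<open>E[W(A) W(B)] = |A \<inter> B|\<close>; joint
  Gaussianity is expressed by the laws of all finite linear combinations.\<close>

locale space_time_white_noise = usual_filtered_prob_space M F
  for M :: "'w measure" and F :: "real \<Rightarrow> 'w measure" +
  fixes W :: "(real \<times> real) set \<Rightarrow> 'w \<Rightarrow> real"
  assumes gaussian: "\<And>\<A> c. finite \<A> \<Longrightarrow> \<A> \<subseteq> noise_sets \<Longrightarrow>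
      centred_gaussian M (\<lambda>\<omega>. \<Sum>A\<in>\<A>. c A * W A \<omega>)
        (\<Sum>A\<in>\<A>. \<Sum>B\<in>\<A>. c A * c B * measure lborel (A \<inter> B))"
    and adapted: "\<And>t A. 0 \<le> t \<Longrightarrow> A \<in> noise_sets \<Longrightarrow> A \<subseteq> {0..t} \<times> {0..1} \<Longrightarrow>
      W A \<in> borel_measurable (F t)"
    and independent_future: "\<And>t. 0 \<le> t \<Longrightarrow>
      indep_set (sets (F t))
        (sigma_sets (space M)
          {W A -` S \<inter> space M | A S. A \<in> noise_sets \<and> A \<subseteq> {t<..} \<times> {0..1} \<and> S \<in> sets borel})"

text \<open>Simple predictable processes: a list entry \<open>(a, b, A, X)\<close> stands for the elementary process
  \<open>X 1\<^bsub>(a,b]\<^esub>(s) 1\<^bsub>A\<^esub>(y)\<close>.\<close>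

type_synonym 'w simple_process = "(real \<times> real \<times> real set \<times> ('w \<Rightarrow> real)) list"

definition is_simple :: "'w measure \<Rightarrow> (real \<Rightarrow> 'w measure) \<Rightarrow> 'w simple_process \<Rightarrow> bool" where
  "is_simple M F \<Psi> \<longleftrightarrow> (\<forall>(a, b, A, X)\<in>set \<Psi>. 0 \<le> a \<and> a \<le> b \<and> A \<in> sets borel \<and> A \<subseteq> {0..1} \<and>
     X \<in> borel_measurable (F a) \<and> (\<exists>C. \<forall>\<omega>\<in>space M. \<bar>X \<omega>\<bar> \<le> C))"

definition simple_value :: "'w simple_process \<Rightarrow> real \<Rightarrow> real \<Rightarrow> 'w \<Rightarrow> real" where
  "simple_value \<Psi> s y \<omega> =
     (\<Sum>(a, b, A, X)\<leftarrow>\<Psi>. X \<omega> * indicator {a<..b} s * indicator A y)"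

definition simple_integral ::
    "((real \<times> real) set \<Rightarrow> 'w \<Rightarrow> real) \<Rightarrow> real \<Rightarrow> 'w simple_process \<Rightarrow> 'w \<Rightarrow> real" where
  "simple_integral W t \<Psi> \<omega> = (\<Sum>(a, b, A, X)\<leftarrow>\<Psi>. X \<omega> * W (({a<..b} \<inter> {..t}) \<times> A) \<omega>)"

definition tendsto_zero_in_prob :: "'w measure \<Rightarrow> (nat \<Rightarrow> 'w \<Rightarrow> ennreal) \<Rightarrow> bool" where
  "tendsto_zero_in_prob M Z \<longleftrightarrow>
     (\<forall>\<epsilon>>0. (\<lambda>n. measure M {\<omega> \<in> space M. ennreal \<epsilon> < Z n \<omega>}) \<longlonglongrightarrow> 0)"

text \<open>\<open>has_walsh_integral M F W t \<Phi> J\<close>: the random variable \<open>J\<close> is a version of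
  \<open>\<integral>\<^sub>0\<^sup>t \<integral>\<^sub>0\<^sup>1 \<Phi>(s,y) W(ds,dy)\<close>. This is the Walsh integral extended by localisation to integrands
  whose square is only almost surely integrable over \<open>[0,t] \<times> [0,1]\<close>: solutions with paths in
  \<open>C([0,T], L\<^sup>2)\<close> are not assumed to have moments.\<close>

definition has_walsh_integral ::
    "'w measure \<Rightarrow> (real \<Rightarrow> 'w measure) \<Rightarrow> ((real \<times> real) set \<Rightarrow> 'w \<Rightarrow> real) \<Rightarrow>
     real \<Rightarrow> (real \<Rightarrow> real \<Rightarrow> 'w \<Rightarrow> real) \<Rightarrow> ('w \<Rightarrow> real) \<Rightarrow> bool" where
  "has_walsh_integral M F W t \<Phi> J \<longleftrightarrow>
     (\<lambda>(s, y, \<omega>). \<Phi> s y \<omega>) \<in> borel_measurable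
        (restrict_space borel {0..t} \<Otimes>\<^sub>M (restrict_space borel {0..1} \<Otimes>\<^sub>M M)) \<and>
     J \<in> borel_measurable M \<and>
     (\<exists>\<Psi>. (\<forall>n. is_simple M F (\<Psi> n)) \<and>
        tendsto_zero_in_prob M (\<lambda>n \<omega>. \<integral>\<^sup>+ s\<in>{0..t}. (\<integral>\<^sup>+ y\<in>{0..1}.
          ennreal ((simple_value (\<Psi> n) s y \<omega> - \<Phi> s y \<omega>)\<^sup>2) \<partial>lborel) \<partial>lborel) \<and>
        tendsto_zero_in_prob M (\<lambda>n \<omega>. ennreal \<bar>simple_integral W t (\<Psi> n) \<omega> - J \<omega>\<bar>))"

text \<open>\<open>mild_solution M F W b \<sigma> u0 T u\<close>: \<open>u\<close> is a random field solution on \<open>[0,T]\<close> of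
  \<open>\<partial>\<^sub>t u = \<onehalf> \<partial>\<^sub>x\<^sub>x u + b(u) + \<sigma>(u) W(dt,dx)\<close> with Dirichlet boundary conditions and initial
  value \<open>u0\<close>. The deterministic double integral is taken over \<open>[0,t] \<times> [0,1]\<close>; its absolute
  convergence is demanded because the Bochner integral of a non-integrable function is 0.\<close>

definition mild_solution ::
    "'w measure \<Rightarrow> (real \<Rightarrow> 'w measure) \<Rightarrow> ((real \<times> real) set \<Rightarrow> 'w \<Rightarrow> real) \<Rightarrow>
     (real \<Rightarrow> real) \<Rightarrow> (real \<Rightarrow> real) \<Rightarrow> (real \<Rightarrow> real) \<Rightarrow> real \<Rightarrow>
     (real \<Rightarrow> real \<Rightarrow> 'w \<Rightarrow> real) \<Rightarrow> bool" where
  "mild_solution M F W b \<sigma> u0 T u \<longleftrightarrow>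
     (\<lambda>(t, x, \<omega>). u t x \<omega>) \<in> borel_measurable
        (restrict_space borel {0..T} \<Otimes>\<^sub>M (restrict_space borel {0..1} \<Otimes>\<^sub>M M)) \<and>
     (\<forall>t\<in>{0..T}. \<forall>x\<in>{0..1}. u t x \<in> borel_measurable (F t)) \<and>
     (\<forall>t\<in>{0..T}. AE \<omega> in M. L2 (\<lambda>x. u t x \<omega>)) \<and>
     (\<forall>t\<in>{0..T}. AE x in lebesgue_on {0..1}. \<exists>J.
        has_walsh_integral M F W t (\<lambda>s y \<omega>. heat_kernel (t - s) x y * \<sigma> (u s y \<omega>)) J \<and>
        (AE \<omega> in M.
           set_integrable lborel ({0..t} \<times> {0..1})
             (\<lambda>(s, y). heat_kernel (t - s) x y * b (u s y \<omega>)) \<and>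
           u t x \<omega> = heat_semigroup t u0 x
             + set_lebesgue_integral lborel ({0..t} \<times> {0..1})
                 (\<lambda>(s, y). heat_kernel (t - s) x y * b (u s y \<omega>))
             + J \<omega>))"

definition pathwise_uniqueness_C_L2 ::
    "'w measure \<Rightarrow> (real \<Rightarrow> 'w measure) \<Rightarrow> ((real \<times> real) set \<Rightarrow> 'w \<Rightarrow> real) \<Rightarrow>
     (real \<Rightarrow> real) \<Rightarrow> (real \<Rightarrow> real) \<Rightarrow> (real \<Rightarrow> real) \<Rightarrow> real \<Rightarrow> bool" where
  "pathwise_uniqueness_C_L2 M F W b \<sigma> u0 T \<longleftrightarrow>
     (\<forall>u v. mild_solution M F W b \<sigma> u0 T u \<longrightarrow> mild_solution M F W b \<sigma> u0 T v \<longrightarrow>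
        (AE \<omega> in M. path_in_C_L2 T (\<lambda>t x. u t x \<omega>)) \<longrightarrow>
        (AE \<omega> in M. path_in_C_L2 T (\<lambda>t x. v t x \<omega>)) \<longrightarrow>
        (AE \<omega> in M. (SUP t\<in>{0..T}. ennreal (L2_norm (\<lambda>x. u t x \<omega> - v t x \<omega>))) = 0))"

end

theory Submission
  imports Defs
begin

text \<open>Let \<open>w\<close> be the difference of two solutions, stopped when one of the \<open>L\<^sup>2\<close> norms exceeds a level
  \<open>R\<close>, and let \<open>H t\<close> be the second moment of its norm. The stochastic convolution contributes at most
  \<open>\<integral> \<kappa>(t-s) H s ds\<close> to \<open>H t\<close>, where \<open>\<kappa>\<close> is an integrable kernel. In the drift, \<open>r log\<^sub>+ (1/r) \<le> N r + exp (-N)\<close> holds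
  for every \<open>N\<close>, and \<open>log\<^sub>+ |u| |w| \<le> |u| |w|\<close> is in \<open>L\<^sup>1\<close> with norm at most \<open>R\<close> times that of \<open>w\<close>, which
  the heat semigroup smooths back to \<open>L\<^sup>2\<close>. A weight \<open>exp (\<lambda> t)\<close> with \<open>\<lambda>\<close> proportional to \<open>N\<close> absorbs all
  terms but \<open>exp (-N)\<close>; letting \<open>N\<close> tend to infinity gives \<open>H = 0\<close> on a short interval whose length
  does not depend on the data at its left endpoint, and the argument is iterated.\<close>

section \<open>A Gronwall lemma of Osgood type\<close>

text \<open>The delicate point is that the rate of the exponential weight may grow only linearly in
  \<open>N\<close>. The surviving constant has size \<open>exp (- 2 * N)\<close>; a rate of order
  \<open>N\<^sup>2\<close>, which a plain Gronwall argument would produce, could not be beaten on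
  any interval. The linear rate comes from a Cauchy-Schwarz inequality in time with weight
  \<open>exp (l * (t - s))\<close>: it gains one factor \<open>1 / l\<close>, the weight of the
  Gronwall argument gains a second, and \<open>N\<^sup>2 / l\<^sup>2\<close> stays bounded. The
  drift term with factor \<open>c4\<close> escapes this treatment because its coefficient is
  unbounded, but after smoothing its kernel is integrable in time, and a large rate makes it small.
  Solutions carry no moments, and their Walsh integrals are limits in probability only. Expectations
  are therefore cut off by an adapted event that shrinks in time, and the isometry becomes an
  inequality on that event. For the event to be adapted, the spatial norms must be adapted, which
  joint measurability with respect to \<open>M\<close> does not provide by itself.\<close>

lemma nn_integral_exp_kernel_le:
  fixes l t a :: real
  assumes "l > 0" "a \<le> t"
  shows "(\<integral>\<^sup>+s. ennreal (exp (- (l * (t - s)))) * indicator {a..t} s \<partial>lborel) \<le> ennreal (1 / l)"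
proof -
  have "(\<integral>\<^sup>+s. ennreal (exp (- (l * (t - s)))) * indicator {a..t} s \<partial>lborel)
      = exp (- (l * (t - t))) / l - exp (- (l * (t - a))) / l"
    using assms
    by (intro nn_integral_FTC_Icc) (auto intro!: derivative_eq_intros)
  also have "\<dots> \<le> ennreal (1 / l)"
    using assms by (intro ennreal_leI) (auto simp: field_simps)
  finally show ?thesis .
qed

lemma nn_integral_reflect:
  fixes f :: "real \<Rightarrow> ennreal"
  assumes [measurable]: "f \<in> borel_measurable borel"
  shows "(\<integral>\<^sup>+s. f (t - s) * indicator {0..t} s \<partial>lborel) = (\<integral>\<^sup>+r. f r * indicator {0..t} r \<partial>lborel)"
proof -
  have "(\<integral>\<^sup>+r. f r * indicator {0..t} r \<partial>lborel)
      = ennreal \<bar>-1\<bar> * (\<integral>\<^sup>+s. f (t + (-1) * s) * indicator {0..t} (t + (-1) * s) \<partial>lborel)"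
    by (rule nn_integral_real_affine) auto
  also have "\<dots> = (\<integral>\<^sup>+s. f (t - s) * indicator {0..t} s \<partial>lborel)"
    by (auto intro!: nn_integral_cong simp: indicator_def)
  finally show ?thesis ..
qed

text \<open>Dominated convergence along the integers, with \<open>\<kappa>\<close> itself as
  majorant and the null set \<open>{0}\<close> removed; monotonicity in \<open>l\<close> then covers
  all real rates. Under a large exponential weight every convolution with an integrable kernel thus
  becomes a small perturbation.\<close>

lemma laplace_transform_small:
  fixes \<kappa> :: "real \<Rightarrow> ennreal" and T \<epsilon> :: real
  assumes [measurable]: "\<kappa> \<in> borel_measurable borel"
    and fin: "(\<integral>\<^sup>+r. \<kappa> r * indicator {0..T} r \<partial>lborel) < \<infinity>" and "\<epsilon> > 0"
  obtains l0 where "\<And>l. l \<ge> l0 \<Longrightarrow>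
      (\<integral>\<^sup>+r. \<kappa> r * ennreal (exp (- (l * r))) * indicator {0..T} r \<partial>lborel) \<le> ennreal \<epsilon>"
proof -
  let ?f = "\<lambda>l r. \<kappa> r * ennreal (exp (- (l * r))) * indicator {0..T} r"
  have "(\<lambda>n. \<integral>\<^sup>+r. ?f (real n) r \<partial>lborel) \<longlonglongrightarrow> (\<integral>\<^sup>+r. 0 \<partial>(lborel::real measure))"
  proof (rule nn_integral_dominated_convergence[where w = "\<lambda>r. \<kappa> r * indicator {0..T} r"])
    show "AE r in lborel. ?f (real n) r \<le> \<kappa> r * indicator {0..T} r" for n
    proof (intro AE_I2)
      fix r :: real
      have "\<kappa> r * ennreal (exp (- (n * r))) \<le> \<kappa> r * 1" if "r \<ge> 0"
        using that by (intro mult_left_mono) auto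
      then show "?f (real n) r \<le> \<kappa> r * indicator {0..T} r"
        by (auto simp: indicator_def)
    qed
    have "AE r in lborel. \<kappa> r * indicator {0..T} r \<noteq> \<infinity>"
      by (rule nn_integral_PInf_AE) (use fin in auto)
    moreover have "AE r in lborel. r \<noteq> (0::real)"
      by (rule AE_lborel_singleton)
    ultimately show "AE r in lborel. (\<lambda>n. ?f (real n) r) \<longlonglongrightarrow> 0"
    proof eventually_elim
      case (elim r)
      show ?case
      proof (cases "r \<in> {0..T}")
        case True
        then have "r > 0" "\<kappa> r \<noteq> \<infinity>" using elim by auto
        have "(\<lambda>n. exp (- (real n * r))) \<longlonglongrightarrow> 0"
        proof -
          have "filterlim (\<lambda>n. real n * r) at_top sequentially"
            using \<open>r > 0\<close> by (intro filterlim_at_top_mult_tendsto_pos[OF tendsto_const]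
                filterlim_real_sequentially filterlim_compose) 
               (auto intro: filterlim_real_sequentially)
          then show ?thesis
            by (intro filterlim_compose[OF exp_at_bot] filterlim_compose[OF filterlim_uminus_at_bot_at_top])
        qed
        then have "(\<lambda>n. ennreal (exp (- (real n * r)))) \<longlonglongrightarrow> ennreal 0"
          by (rule tendsto_ennrealI)
        then have "(\<lambda>n. \<kappa> r * ennreal (exp (- (real n * r)))) \<longlonglongrightarrow> \<kappa> r * 0"
          using \<open>\<kappa> r \<noteq> \<infinity>\<close> by (intro ennreal_tendsto_cmult) (auto simp: top.not_eq_extremum)
        then show ?thesis using True by simp
      qed simp
    qed
  qed (use fin in auto)
  then have "(\<lambda>n. \<integral>\<^sup>+r. ?f (real n) r \<partial>lborel) \<longlonglongrightarrow> 0" by simp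
  then have "eventually (\<lambda>n. (\<integral>\<^sup>+r. ?f (real n) r \<partial>lborel) < ennreal \<epsilon>) sequentially"
    using \<open>\<epsilon> > 0\<close> by (intro order_tendstoD(2)[where y=0]) auto
  then obtain n where n: "(\<integral>\<^sup>+r. ?f (real n) r \<partial>lborel) < ennreal \<epsilon>"
    by (auto simp: eventually_sequentially)
  show ?thesis
  proof (rule that[of "real n"])
    fix l assume l: "l \<ge> real n"
    have "(\<integral>\<^sup>+r. ?f l r \<partial>lborel) \<le> (\<integral>\<^sup>+r. ?f (real n) r \<partial>lborel)"
      using l by (intro nn_integral_mono)
        (auto simp: indicator_def intro!: mult_left_mono ennreal_leI mult_right_mono)
    with n show "(\<integral>\<^sup>+r. ?f l r \<partial>lborel) \<le> ennreal \<epsilon>" by simp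
  qed
qed

text \<open>The modulus \<open>r log (1/r)\<close> enters through its linear majorants \<open>N r + exp (-N)\<close>, with \<open>N\<close> free. The
  constant term is switched off where \<open>H\<close> vanishes: otherwise the exponential weight would amplify
  its contributions from times before \<open>t1\<close>, and the argument could not be restarted at \<open>t1\<close>.\<close>

lemma gronwall_osgood_step:
  fixes H \<kappa> :: "real \<Rightarrow> ennreal" and B C K T t1 :: real
  assumes [measurable]: "H \<in> borel_measurable borel" "\<kappa> \<in> borel_measurable borel"
    and fin: "(\<integral>\<^sup>+r. \<kappa> r * indicator {0..T} r \<partial>lborel) < \<infinity>"
    and bounded: "\<And>t. t \<in> {0..T} \<Longrightarrow> H t \<le> ennreal B"
    and pos: "0 \<le> B" "0 \<le> C" "0 \<le> K"
    and ineq: "\<And>N l t. N \<ge> 1 \<Longrightarrow> l > 0 \<Longrightarrow> t \<in> {0..T} \<Longrightarrow>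
      H t \<le> ennreal (K / l) * (\<integral>\<^sup>+s. ennreal (exp (l * (t - s))) *
          (if H s = 0 then 0 else ennreal (N\<^sup>2) * H s + ennreal (exp (- 2 * N))) * indicator {0..t} s \<partial>lborel)
        + ennreal C * (\<integral>\<^sup>+s. \<kappa> (t - s) * H s * indicator {0..t} s \<partial>lborel)"
    and t1: "0 \<le> t1" and zero: "\<And>s. 0 \<le> s \<Longrightarrow> s < t1 \<Longrightarrow> s \<le> T \<Longrightarrow> H s = 0"
    and t: "t1 \<le> t" "t \<le> t1 + 1 / (2 * (2 * K + 1))" "t \<le> T"
  shows "H t = 0"
proof -
  \<comment> \<open>With \<open>l = k0 * N\<close> the drift contributes
    \<open>K * N\<^sup>2 / l\<^sup>2 = K / k0\<^sup>2\<close>, which should be at most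
    \<open>1/4\<close>. The choice \<open>2 * K + 1\<close> achieves this without a square root and
    stays positive for \<open>K = 0\<close>.\<close>
  define k0 where "k0 = 2 * K + 1"
  have k0: "k0 \<ge> 1" "K \<le> k0\<^sup>2 / 4" using pos by (auto simp: k0_def power2_eq_square algebra_simps)
  \<comment> \<open>After multiplication by \<open>C\<close> at most a quarter remains;
    \<open>C + 1\<close> avoids a division by zero.\<close>
  obtain l0 where l0: "\<And>l. l \<ge> l0 \<Longrightarrow>
      (\<integral>\<^sup>+r. \<kappa> r * ennreal (exp (- (l * r))) * indicator {0..T} r \<partial>lborel) \<le> ennreal (1 / (4 * (C + 1)))"
    using laplace_transform_small[OF assms(2) fin, of "1 / (4 * (C + 1))"] pos by auto
  \<comment> \<open>One pass through the inequality: a quarter of \<open>A\<close> comes from the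
    drift and a quarter from the convolution. The weight has rate \<open>2 * l\<close>, twice that
    of the factor \<open>exp (l * (t - s))\<close>, so that relative to its value at
    \<open>t\<close> the product still decays like \<open>exp (- (l * (t - s)))\<close>.\<close>
  have improve: "H t \<le> ennreal ((A / 2 + exp (- 2 * N) / 4) * exp (2 * (k0 * N) * (t - t1)))"
    if A: "0 \<le> A" and N: "N \<ge> 1" "N \<ge> l0"
      and le: "\<And>s. t1 \<le> s \<Longrightarrow> s \<le> T \<Longrightarrow> H s \<le> ennreal (A * exp (2 * (k0 * N) * (s - t1)))"
      and t: "t1 \<le> t" "t \<le> T" for A N t
  proof -
    define l where "l = k0 * N"
    define E where "E = exp (2 * l * (t - t1))"
    have "1 * N \<le> l" unfolding l_def using k0 N by (intro mult_right_mono) auto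
    then have l: "l > 0" "2 * l \<ge> l0" using N by auto
    have "(\<integral>\<^sup>+s. ennreal (exp (l * (t - s))) *
          (if H s = 0 then 0 else ennreal (N\<^sup>2) * H s + ennreal (exp (- 2 * N))) * indicator {0..t} s \<partial>lborel)
       \<le> (\<integral>\<^sup>+s. ennreal ((N\<^sup>2 * A + exp (- 2 * N)) * E) *
            (ennreal (exp (- (l * (t - s)))) * indicator {t1..t} s) \<partial>lborel)"
    proof (rule nn_integral_mono)
      fix s :: real
      show "ennreal (exp (l * (t - s))) *
          (if H s = 0 then 0 else ennreal (N\<^sup>2) * H s + ennreal (exp (- 2 * N))) * indicator {0..t} s
         \<le> ennreal ((N\<^sup>2 * A + exp (- 2 * N)) * E) * (ennreal (exp (- (l * (t - s)))) * indicator {t1..t} s)"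
      proof (cases "s \<in> {t1..t} \<and> H s \<noteq> 0")
        case True
        have "ennreal (N\<^sup>2) * H s + ennreal (exp (- 2 * N))
            \<le> ennreal (N\<^sup>2) * ennreal (A * exp (2 * l * (s - t1))) + ennreal (exp (- 2 * N))"
          using le[of s] True t by (intro add_right_mono mult_left_mono) (auto simp: l_def)
        also have "\<dots> = ennreal (N\<^sup>2 * (A * exp (2 * l * (s - t1))) + exp (- 2 * N))"
          using A by (simp add: ennreal_mult')
        also have "\<dots> \<le> ennreal ((N\<^sup>2 * A + exp (- 2 * N)) * exp (2 * l * (s - t1)))"
        proof (rule ennreal_leI)
          have "1 \<le> exp (2 * l * (s - t1))" using l True by auto
          then have "exp (- 2 * N) * 1 \<le> exp (- 2 * N) * exp (2 * l * (s - t1))"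
            by (intro mult_left_mono) auto
          then show "N\<^sup>2 * (A * exp (2 * l * (s - t1))) + exp (- 2 * N)
              \<le> (N\<^sup>2 * A + exp (- 2 * N)) * exp (2 * l * (s - t1))"
            by (simp add: algebra_simps)
        qed
        finally have "ennreal (exp (l * (t - s))) * (ennreal (N\<^sup>2) * H s + ennreal (exp (- 2 * N)))
            \<le> ennreal (exp (l * (t - s))) * ennreal ((N\<^sup>2 * A + exp (- 2 * N)) * exp (2 * l * (s - t1)))"
          by (intro mult_left_mono) auto
        also have "\<dots> = ennreal ((N\<^sup>2 * A + exp (- 2 * N)) * E) * ennreal (exp (- (l * (t - s))))"
        proof -
          have "exp (l * (t - s)) * exp (2 * l * (s - t1)) = E * exp (- (l * (t - s)))"
            unfolding E_def exp_add[symmetric] by (simp add: algebra_simps)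
          then have "exp (l * (t - s)) * ((N\<^sup>2 * A + exp (- 2 * N)) * exp (2 * l * (s - t1)))
              = (N\<^sup>2 * A + exp (- 2 * N)) * E * exp (- (l * (t - s)))"
            by (metis mult.assoc mult.left_commute)
          then show ?thesis
            by (simp only: ennreal_mult'[symmetric, OF exp_ge_zero] ennreal_mult''[symmetric, OF exp_ge_zero])
        qed
        finally show ?thesis using True t1 by (simp add: mult_ac)
      next
        case False
        then have "s \<notin> {0..t} \<or> H s = 0"
          using zero[of s] t by force
        then show ?thesis by (auto simp: indicator_def)
      qed
    qed
    also have "\<dots> = ennreal ((N\<^sup>2 * A + exp (- 2 * N)) * E) *
            (\<integral>\<^sup>+s. ennreal (exp (- (l * (t - s)))) * indicator {t1..t} s \<partial>lborel)"
      by (rule nn_integral_cmult) auto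
    also have "\<dots> \<le> ennreal ((N\<^sup>2 * A + exp (- 2 * N)) * E) * ennreal (1 / l)"
      using l t by (intro mult_left_mono nn_integral_exp_kernel_le) auto
    finally have "ennreal (K / l) * (\<integral>\<^sup>+s. ennreal (exp (l * (t - s))) *
          (if H s = 0 then 0 else ennreal (N\<^sup>2) * H s + ennreal (exp (- 2 * N))) * indicator {0..t} s \<partial>lborel)
        \<le> ennreal (K / l) * (ennreal ((N\<^sup>2 * A + exp (- 2 * N)) * E) * ennreal (1 / l))"
      by (rule mult_left_mono) auto
    also have "\<dots> = ennreal (K / l * ((N\<^sup>2 * A + exp (- 2 * N)) * E * (1 / l)))"
      using pos l by (simp flip: ennreal_mult' ennreal_mult'')
    also have "\<dots> \<le> ennreal ((A / 4 + exp (- 2 * N) / 4) * E)"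
    proof (rule ennreal_leI)
      have "K / l\<^sup>2 \<le> (k0\<^sup>2 / 4) / l\<^sup>2" using k0 by (intro divide_right_mono) auto
      also have "\<dots> = 1 / (4 * N\<^sup>2)" using k0 N by (simp add: l_def power_mult_distrib)
      finally have "K / l\<^sup>2 * (N\<^sup>2 * A + exp (- 2 * N)) \<le> 1 / (4 * N\<^sup>2) * (N\<^sup>2 * A + exp (- 2 * N))"
        using A by (intro mult_right_mono) auto
      also have "\<dots> = A / 4 + exp (- 2 * N) / (4 * N\<^sup>2)" using N by (simp add: field_simps)
      also have "\<dots> \<le> A / 4 + exp (- 2 * N) / 4"
        using N by (intro add_left_mono divide_left_mono) auto
      finally have "K / l\<^sup>2 * (N\<^sup>2 * A + exp (- 2 * N)) * E \<le> (A / 4 + exp (- 2 * N) / 4) * E"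
        by (rule mult_right_mono) (auto simp: E_def)
      then show "K / l * ((N\<^sup>2 * A + exp (- 2 * N)) * E * (1 / l)) \<le> (A / 4 + exp (- 2 * N) / 4) * E"
        by (simp add: power2_eq_square)
    qed
    finally have *: "ennreal (K / l) * (\<integral>\<^sup>+s. ennreal (exp (l * (t - s))) *
          (if H s = 0 then 0 else ennreal (N\<^sup>2) * H s + ennreal (exp (- 2 * N))) * indicator {0..t} s \<partial>lborel)
        \<le> ennreal ((A / 4 + exp (- 2 * N) / 4) * E)" .

    have "(\<integral>\<^sup>+s. \<kappa> (t - s) * H s * indicator {0..t} s \<partial>lborel)
        \<le> (\<integral>\<^sup>+s. ennreal (A * E) * (\<kappa> (t - s) * ennreal (exp (- (2 * l * (t - s)))) * indicator {0..t} s) \<partial>lborel)"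
    proof (rule nn_integral_mono)
      fix s :: real
      show "\<kappa> (t - s) * H s * indicator {0..t} s
          \<le> ennreal (A * E) * (\<kappa> (t - s) * ennreal (exp (- (2 * l * (t - s)))) * indicator {0..t} s)"
      proof (cases "s \<in> {t1..t}")
        case True
        have "\<kappa> (t - s) * H s \<le> \<kappa> (t - s) * ennreal (A * exp (2 * l * (s - t1)))"
          using le[of s] True t by (intro mult_left_mono) (auto simp: l_def)
        also have "A * exp (2 * l * (s - t1)) = (A * E) * exp (- (2 * l * (t - s)))"
        proof -
          have "exp (2 * l * (s - t1)) = E * exp (- (2 * l * (t - s)))"
            unfolding E_def exp_add[symmetric] by (simp add: algebra_simps)
          then show ?thesis by simp
        qed
        finally have "\<kappa> (t - s) * H s \<le> \<kappa> (t - s) * (ennreal (A * E) * ennreal (exp (- (2 * l * (t - s)))))"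
          using A by (simp add: ennreal_mult'')
        then show ?thesis using True t1 by (simp add: mult_ac)
      next
        case False
        then have "s \<notin> {0..t} \<or> H s = 0"
          using zero[of s] t by force
        then show ?thesis by (auto simp: indicator_def)
      qed
    qed
    also have "\<dots> = ennreal (A * E) * (\<integral>\<^sup>+s. \<kappa> (t - s) * ennreal (exp (- (2 * l * (t - s)))) * indicator {0..t} s \<partial>lborel)"
      by (rule nn_integral_cmult) auto
    also have "(\<integral>\<^sup>+s. \<kappa> (t - s) * ennreal (exp (- (2 * l * (t - s)))) * indicator {0..t} s \<partial>lborel)
        = (\<integral>\<^sup>+r. \<kappa> r * ennreal (exp (- (2 * l * r))) * indicator {0..t} r \<partial>lborel)"
      by (rule nn_integral_reflect) auto
    also have "\<dots> \<le> (\<integral>\<^sup>+r. \<kappa> r * ennreal (exp (- (2 * l * r))) * indicator {0..T} r \<partial>lborel)"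
      using t by (intro nn_integral_mono) (auto simp: indicator_def)
    also have "\<dots> \<le> ennreal (1 / (4 * (C + 1)))" by (rule l0[OF l(2)])
    finally have "(\<integral>\<^sup>+s. \<kappa> (t - s) * H s * indicator {0..t} s \<partial>lborel)
        \<le> ennreal (A * E) * ennreal (1 / (4 * (C + 1)))"
      by (simp add: mult_left_mono)
    then have "ennreal C * (\<integral>\<^sup>+s. \<kappa> (t - s) * H s * indicator {0..t} s \<partial>lborel)
        \<le> ennreal C * (ennreal (A * E) * ennreal (1 / (4 * (C + 1))))"
      by (rule mult_left_mono) auto
    also have "\<dots> = ennreal (C * (A * E * (1 / (4 * (C + 1)))))"
      using pos A by (simp flip: ennreal_mult' ennreal_mult'' add: E_def)
    also have "\<dots> \<le> ennreal (A / 4 * E)"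
    proof (rule ennreal_leI)
      have "C / (C + 1) * (A * E / 4) \<le> 1 * (A * E / 4)"
        using pos A by (intro mult_right_mono) (auto simp: E_def)
      moreover have "C * (A * E * (1 / (4 * (C + 1)))) = C / (C + 1) * (A * E / 4)"
        by (simp only: times_divide_eq_right times_divide_eq_left divide_divide_eq_left mult_1_right mult_ac)
      moreover have "A / 4 * E = 1 * (A * E / 4)" by simp
      ultimately show "C * (A * E * (1 / (4 * (C + 1)))) \<le> A / 4 * E" by (simp only:)
    qed
    finally have **: "ennreal C * (\<integral>\<^sup>+s. \<kappa> (t - s) * H s * indicator {0..t} s \<partial>lborel)
        \<le> ennreal (A / 4 * E)" .
    have "H t \<le> ennreal ((A / 4 + exp (- 2 * N) / 4) * E) + ennreal (A / 4 * E)"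
      using ineq[of N l t] N l t t1 add_mono[OF * **] by force
    also have "\<dots> = ennreal ((A / 2 + exp (- 2 * N) / 4) * E)"
      using A by (simp flip: ennreal_plus add: E_def algebra_simps)
    finally show ?thesis by (simp add: E_def l_def)
  qed
  \<comment> \<open>The term \<open>exp (- 2 * N) / 2\<close> is the fixed point of
    \<open>A \<mapsto> A / 2 + exp (- 2 * N) / 4\<close>, the map behind \<open>improve\<close>, so
    repeated passes halve only the part that stems from \<open>B\<close>.\<close>
  have iter: "\<forall>t. t1 \<le> t \<longrightarrow> t \<le> T \<longrightarrow>
      H t \<le> ennreal ((B / 2 ^ n + exp (- 2 * N) / 2) * exp (2 * (k0 * N) * (t - t1)))"
    if N: "N \<ge> 1" "N \<ge> l0" for N n
  proof (induction n)
    case 0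
    show ?case
    proof (intro allI impI)
      fix t assume t: "t1 \<le> t" "t \<le> T"
      have "H t \<le> ennreal B" using bounded t t1 by auto
      also have "\<dots> \<le> ennreal ((B / 2 ^ 0 + exp (- 2 * N) / 2) * exp (2 * (k0 * N) * (t - t1)))"
      proof (rule ennreal_leI)
        have "B \<le> B + exp (- 2 * N) / 2" by simp
        then have "B * 1 \<le> (B + exp (- 2 * N) / 2) * exp (2 * (k0 * N) * (t - t1))"
          using N k0 t pos by (intro mult_mono) (auto simp: add_nonneg_pos)
        then show "B \<le> (B / 2 ^ 0 + exp (- 2 * N) / 2) * exp (2 * (k0 * N) * (t - t1))" by simp
      qed
      finally show "H t \<le> ennreal ((B / 2 ^ 0 + exp (- 2 * N) / 2) * exp (2 * (k0 * N) * (t - t1)))" .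
    qed
  next
    case (Suc n)
    have eq: "(B / 2 ^ n + exp (- 2 * N) / 2) / 2 + exp (- 2 * N) / 4 = B / 2 ^ Suc n + exp (- 2 * N) / 2"
      by (simp add: add_divide_distrib)
    show ?case
      using improve[of "B / 2 ^ n + exp (- 2 * N) / 2" N] Suc N pos unfolding eq by auto
  qed
  \<comment> \<open>Order of limits: \<open>n\<close> tends to infinity with \<open>N\<close> fixed.
    Over a length of \<open>1 / (2 * k0)\<close> the weight grows at most to \<open>exp N\<close>,
    and \<open>exp (- 2 * N)\<close> outweighs it by \<open>exp (- N)\<close>.\<close>
  have small: "H t \<le> ennreal (exp (- N))" if N: "N \<ge> 1" "N \<ge> l0" for N
  proof -
    have "(\<lambda>n. B / 2 ^ n) \<longlonglongrightarrow> 0"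
      by (rule LIMSEQ_divide_realpow_zero) auto
    then have "(\<lambda>n. ennreal ((B / 2 ^ n + exp (- 2 * N) / 2) * exp (2 * (k0 * N) * (t - t1))))
        \<longlonglongrightarrow> ennreal ((0 + exp (- 2 * N) / 2) * exp (2 * (k0 * N) * (t - t1)))"
      by (intro tendsto_intros)
    then have "H t \<le> ennreal ((0 + exp (- 2 * N) / 2) * exp (2 * (k0 * N) * (t - t1)))"
      using iter[OF N] t by (intro LIMSEQ_le_const) auto
    also have "\<dots> \<le> ennreal (exp (- N))"
    proof (rule ennreal_leI)
      have "2 * k0 * (t - t1) \<le> 1" using t k0 by (simp add: k0_def field_simps)
      then have "N * (2 * k0 * (t - t1)) \<le> N * 1" using N by (intro mult_left_mono) auto
      then have "exp (- 2 * N) * exp (2 * (k0 * N) * (t - t1)) \<le> exp (- N)"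
        unfolding exp_add[symmetric] by (simp add: algebra_simps)
      moreover have "0 \<le> exp (- 2 * N) * exp (2 * (k0 * N) * (t - t1))" by simp
      moreover have "(0 + exp (- 2 * N) / 2) * exp (2 * (k0 * N) * (t - t1))
          = exp (- 2 * N) * exp (2 * (k0 * N) * (t - t1)) / 2" by simp
      ultimately show "(0 + exp (- 2 * N) / 2) * exp (2 * (k0 * N) * (t - t1)) \<le> exp (- N)"
        using exp_ge_zero[of "- N"] by linarith
    qed
    finally show ?thesis .
  qed
  have "((\<lambda>N::real. ennreal (exp (- N))) \<longlongrightarrow> ennreal 0) at_top"
    by (intro tendsto_ennrealI filterlim_compose[OF exp_at_bot] filterlim_uminus_at_bot_at_top)
  then have "H t \<le> ennreal 0"
    by (rule tendsto_lowerbound)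
       (use small in \<open>auto simp: eventually_at_top_linorder intro!: exI[of _ "max 1 l0"]\<close>)
  then show ?thesis by simp
qed

lemma gronwall_osgood:
  fixes H \<kappa> :: "real \<Rightarrow> ennreal" and B C K T :: real
  assumes meas: "H \<in> borel_measurable borel" "\<kappa> \<in> borel_measurable borel"
    and fin: "(\<integral>\<^sup>+r. \<kappa> r * indicator {0..T} r \<partial>lborel) < \<infinity>"
    and bounded: "\<And>t. t \<in> {0..T} \<Longrightarrow> H t \<le> ennreal B"
    and pos: "0 \<le> B" "0 \<le> C" "0 \<le> K"
    and ineq: "\<And>N l t. N \<ge> 1 \<Longrightarrow> l > 0 \<Longrightarrow> t \<in> {0..T} \<Longrightarrow>
      H t \<le> ennreal (K / l) * (\<integral>\<^sup>+s. ennreal (exp (l * (t - s))) *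
          (if H s = 0 then 0 else ennreal (N\<^sup>2) * H s + ennreal (exp (- 2 * N))) * indicator {0..t} s \<partial>lborel)
        + ennreal C * (\<integral>\<^sup>+s. \<kappa> (t - s) * H s * indicator {0..t} s \<partial>lborel)"
    and t: "t \<in> {0..T}"
  shows "H t = 0"
proof -
  define d where "d = 1 / (2 * (2 * K + 1))"
  have d: "d > 0" using pos by (simp add: d_def)
  \<comment> \<open>The intervals are half-open on the right because a restart at \<open>t1\<close>
    presupposes that \<open>H\<close> vanishes at times strictly before \<open>t1\<close>.\<close>
  have "\<forall>t. 0 \<le> t \<longrightarrow> t < real n * d \<longrightarrow> t \<le> T \<longrightarrow> H t = 0" for n
  proof (induction n)
    case (Suc n)
    show ?case
    proof (intro allI impI)
      fix t assume t: "0 \<le> t" "t < real (Suc n) * d" "t \<le> T"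
      show "H t = 0"
      proof (cases "t < real n * d")
        case False
        have le: "t \<le> real n * d + 1 / (2 * (2 * K + 1))"
          unfolding d_def[symmetric] using t by (simp add: algebra_simps)
        show ?thesis
          by (rule gronwall_osgood_step[OF meas fin bounded pos ineq _ _ _ le])
             (use False t d Suc in auto)
      qed (use t Suc in auto)
    qed
  qed simp
  moreover obtain n where "t / d < real n" using reals_Archimedean2 by blast
  then have "t < real n * d" using d by (simp add: field_simps)
  ultimately show ?thesis using t by auto
qed

section \<open>The Dirichlet heat kernel\<close>

text \<open>The uncompleted counterpart of \<open>lebesgue_on {0..1}\<close>. The estimates live on
  Borel product spaces, where sections and Fubini are at hand; the completion matters only at the
  interface with the definitions.\<close>

abbreviation unit_lborel :: "real measure" where
  "unit_lborel \<equiv> restrict_space lborel {0..1}"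

lemma finite_measure_unit_lborel: "finite_measure unit_lborel"
  by (rule finite_measureI) (simp add: emeasure_restrict_space)

lemma measurable_ident_restrict_borel[measurable (raw)]:
  "(\<lambda>x. x) \<in> borel_measurable (restrict_space borel A)"
  "(\<lambda>x. x) \<in> borel_measurable (restrict_space lborel A)"
  by (auto intro: measurable_restrict_space1)

lemma measurable_heat_kernel[measurable (raw)]:
  assumes [measurable]: "f \<in> borel_measurable M" "g \<in> borel_measurable M" "h \<in> borel_measurable M"
  shows "(\<lambda>z. heat_kernel (f z) (g z) (h z)) \<in> borel_measurable M"
  unfolding heat_kernel_def dirichlet_eigenfunction_def by measurable

lemma measurable_dirichlet_eigenfunction[measurable (raw)]:
  assumes [measurable]: "f \<in> borel_measurable M"
  shows "(\<lambda>z. dirichlet_eigenfunction n (f z)) \<in> borel_measurable M"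
  unfolding dirichlet_eigenfunction_def by measurable

lemma dirichlet_eigenfunction_bound: "\<bar>dirichlet_eigenfunction n x\<bar> \<le> sqrt 2"
  unfolding dirichlet_eigenfunction_def abs_mult by (simp add: mult_left_le)

lemma integrable_bounded_unit_lborel:
  fixes f :: "real \<Rightarrow> real"
  assumes "f \<in> borel_measurable unit_lborel" "\<And>x. \<bar>f x\<bar> \<le> C"
  shows "integrable unit_lborel f"
  using assms finite_measure_unit_lborel
  by (intro finite_measure.integrable_const_bound[where B = C]) auto

section \<open>The sine system and Bessel's inequality\<close>

lemma integral_cos_unit:
  "(LINT x|unit_lborel. cos (of_int n * pi * x)) = (if n = 0 then 1 else 0)"
proof (cases "n = 0")
  case True
  then show ?thesis by (simp add: measure_restrict_space)
next
  case False
  have "(LINT x|unit_lborel. cos (of_int n * pi * x)) = (LINT x|lborel. cos (of_int n * pi * x) * indicator {0..1} x)"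
    by (subst integral_restrict_space) (auto simp: mult.commute)
  also have "\<dots> = sin (of_int n * pi * 1) / (of_int n * pi) - sin (of_int n * pi * 0) / (of_int n * pi)"
    using False
    by (intro integral_FTC_Icc_real) (auto intro!: derivative_eq_intros continuous_intros)
  also have "\<dots> = 0"
    using sin_npi_int[of n] by (simp add: mult.commute)
  finally show ?thesis using False by simp
qed

lemma dirichlet_eigenfunction_orthonormal:
  "(LINT x|unit_lborel. dirichlet_eigenfunction (Suc j) x * dirichlet_eigenfunction (Suc k) x) = of_bool (j = k)"
proof -
  have "dirichlet_eigenfunction (Suc j) x * dirichlet_eigenfunction (Suc k) x
      = cos (of_int (int j - int k) * pi * x) - cos (of_int (int j + int k + 2) * pi * x)" for x
  proof -
    have "dirichlet_eigenfunction (Suc j) x * dirichlet_eigenfunction (Suc k) x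
        = 2 * (sin (real (Suc j) * pi * x) * sin (real (Suc k) * pi * x))"
    proof -
      have "r * a * (r * b) = 2 * (a * b)" if "r * r = 2" for r a b :: real
      proof -
        have "r * a * (r * b) = (r * r) * (a * b)" by (simp only: mult_ac)
        with that show ?thesis by simp
      qed
      then show ?thesis unfolding dirichlet_eigenfunction_def by simp
    qed
    also have "\<dots> = cos (real (Suc j) * pi * x - real (Suc k) * pi * x) - cos (real (Suc j) * pi * x + real (Suc k) * pi * x)"
      by (subst sin_times_sin) simp
    also have "real (Suc j) * pi * x - real (Suc k) * pi * x = of_int (int j - int k) * pi * x"
      by (simp add: algebra_simps)
    also have "real (Suc j) * pi * x + real (Suc k) * pi * x = of_int (int j + int k + 2) * pi * x"
      by (simp add: algebra_simps)
    finally show ?thesis .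
  qed
  moreover have "integrable unit_lborel (\<lambda>x. cos (of_int n * pi * x))" for n
    by (rule integrable_bounded_unit_lborel[where C = 1]) auto
  ultimately show ?thesis
    by (simp add: integral_cos_unit del: of_int_add of_int_diff)
qed

lemma integrable_eigenfunction_mult:
  assumes "integrable unit_lborel f"
  shows "integrable unit_lborel (\<lambda>x. dirichlet_eigenfunction n x * f x)"
proof (rule Bochner_Integration.integrable_bound)
  show "integrable unit_lborel (\<lambda>x. sqrt 2 * f x)" using assms by simp
  show "AE x in unit_lborel. norm (dirichlet_eigenfunction n x * f x) \<le> norm (sqrt 2 * f x)"
    by (auto simp: abs_mult intro!: mult_right_mono dirichlet_eigenfunction_bound)
qed (use assms in auto)

lemma integrable_eigenfunction: "integrable unit_lborel (dirichlet_eigenfunction n)"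
  by (rule integrable_bounded_unit_lborel[OF _ dirichlet_eigenfunction_bound]) measurable

lemma eigenfunction_sum_square:
  fixes b :: "nat \<Rightarrow> real"
  shows "has_bochner_integral unit_lborel (\<lambda>x. (\<Sum>k<n. b k * dirichlet_eigenfunction (Suc k) x)\<^sup>2) (\<Sum>k<n. (b k)\<^sup>2)"
proof -
  let ?e = "\<lambda>k. dirichlet_eigenfunction (Suc k)"
  have "has_bochner_integral unit_lborel (\<lambda>x. \<Sum>j<n. \<Sum>k<n. b j * b k * (?e j x * ?e k x))
     (\<Sum>j<n. \<Sum>k<n. b j * b k * of_bool (j = k))"
    by (intro has_bochner_integral_sum has_bochner_integral_mult_right)
       (auto simp: has_bochner_integral_iff dirichlet_eigenfunction_orthonormal
         intro!: integrable_eigenfunction_mult integrable_eigenfunction)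
  moreover have "(\<Sum>k<n. b k * ?e k x)\<^sup>2 = (\<Sum>j<n. \<Sum>k<n. b j * b k * (?e j x * ?e k x))" for x
    by (simp add: power2_eq_square sum_product mult_ac)
  moreover have "(\<Sum>j<n. \<Sum>k<n. b j * b k * of_bool (j = k)) = (\<Sum>k<n. (b k)\<^sup>2)"
    by (intro sum.cong) (auto simp: power2_eq_square of_bool_def if_distrib cong: if_cong)
  ultimately show ?thesis by simp
qed

lemma bessel_inequality:
  assumes f: "integrable unit_lborel f" "integrable unit_lborel (\<lambda>x. (f x)\<^sup>2)"
  shows "(\<Sum>k<n. (LINT x|unit_lborel. dirichlet_eigenfunction (Suc k) x * f x)\<^sup>2) \<le> (LINT x|unit_lborel. (f x)\<^sup>2)"
proof -
  let ?e = "\<lambda>k. dirichlet_eigenfunction (Suc k)"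
  define c where "c k = (LINT x|unit_lborel. ?e k x * f x)" for k
  have 1: "has_bochner_integral unit_lborel (\<lambda>x. \<Sum>k<n. 2 * c k * (?e k x * f x)) (\<Sum>k<n. 2 * c k * c k)"
    by (intro has_bochner_integral_sum has_bochner_integral_mult_right)
       (auto simp: has_bochner_integral_iff c_def intro!: integrable_eigenfunction_mult f)
  have 2: "has_bochner_integral unit_lborel
     (\<lambda>x. (f x)\<^sup>2 - (\<Sum>k<n. 2 * c k * (?e k x * f x)) + (\<Sum>k<n. c k * ?e k x)\<^sup>2)
     ((LINT x|unit_lborel. (f x)\<^sup>2) - (\<Sum>k<n. 2 * c k * c k) + (\<Sum>k<n. (c k)\<^sup>2))"
    by (intro has_bochner_integral_add has_bochner_integral_diff 1 eigenfunction_sum_square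
        has_bochner_integral_integrable f)
  have "(f x)\<^sup>2 - (\<Sum>k<n. 2 * c k * (?e k x * f x)) + (\<Sum>k<n. c k * ?e k x)\<^sup>2
      = (f x - (\<Sum>k<n. c k * ?e k x))\<^sup>2" for x
    by (simp add: power2_diff sum_distrib_left mult_ac)
  then have "(LINT x|unit_lborel. (f x - (\<Sum>k<n. c k * ?e k x))\<^sup>2)
      = (LINT x|unit_lborel. (f x)\<^sup>2) - (\<Sum>k<n. 2 * c k * c k) + (\<Sum>k<n. (c k)\<^sup>2)"
    using has_bochner_integral_integral_eq[OF 2] by simp
  moreover have "0 \<le> (LINT x|unit_lborel. (f x - (\<Sum>k<n. c k * ?e k x))\<^sup>2)"
    by (rule Bochner_Integration.integral_nonneg) simp
  moreover have "(\<Sum>k<n. 2 * c k * c k) = 2 * (\<Sum>k<n. (c k)\<^sup>2)"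
    by (simp add: power2_eq_square sum_distrib_left mult_ac)
  ultimately show ?thesis by (simp add: c_def)
qed

text \<open>Half of this is the squared Hilbert-Schmidt norm of the heat semigroup. Integrability in time of
  this dominating function is all that is used; neither pointwise bounds on the kernel nor its
  positivity are needed.\<close>

definition heat_trace :: "real \<Rightarrow> ennreal" where
  "heat_trace r = (\<Sum>k. ennreal (2 * exp (- ((real (Suc k))\<^sup>2 * pi\<^sup>2 * r))))"

lemma measurable_heat_trace[measurable]: "heat_trace \<in> borel_measurable borel"
  unfolding heat_trace_def by measurable

text \<open>In \<open>ennreal\<close> zero times infinity is zero, so the smoothing estimate for a
  function that is not integrable requires a factor known to be nonzero.\<close>

lemma heat_trace_pos: "heat_trace r > 0"
proof -
  have "(\<Sum>k<Suc 0. ennreal (2 * exp (- ((real (Suc k))\<^sup>2 * pi\<^sup>2 * r)))) \<le> heat_trace r"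
    unfolding heat_trace_def by (rule sum_le_suminf) auto
  moreover have "0 < (\<Sum>k<Suc 0. ennreal (2 * exp (- ((real (Suc k))\<^sup>2 * pi\<^sup>2 * r))))"
    by simp
  ultimately show ?thesis by (rule less_le_trans[rotated])
qed

text \<open>Each exponential integrates over time to at most the inverse of its rate, and the rates
  grow quadratically in the index. This sum of inverse squares converges because space is
  one-dimensional.\<close>

lemma nn_integral_heat_trace_finite: "(\<integral>\<^sup>+r. heat_trace r * indicator {0..T} r \<partial>lborel) < \<infinity>"
proof (cases "T \<ge> 0")
  case T: True
  have "(\<integral>\<^sup>+r. heat_trace r * indicator {0..T} r \<partial>lborel)
      = (\<integral>\<^sup>+r. (\<Sum>k. ennreal (2 * exp (- ((real (Suc k))\<^sup>2 * pi\<^sup>2 * r))) * indicator {0..T} r) \<partial>lborel)"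
    by (simp add: heat_trace_def)
  also have "\<dots> = (\<Sum>k. \<integral>\<^sup>+r. ennreal (2 * exp (- ((real (Suc k))\<^sup>2 * pi\<^sup>2 * r))) * indicator {0..T} r \<partial>lborel)"
    by (rule nn_integral_suminf) auto
  also have "\<dots> \<le> (\<Sum>k. ennreal (2 / pi\<^sup>2 * (1 / (real (Suc k))\<^sup>2)))"
  proof (intro suminf_le)
    fix k
    let ?l = "(real (Suc k))\<^sup>2 * pi\<^sup>2"
    have "(\<integral>\<^sup>+r. ennreal (2 * exp (- (?l * r))) * indicator {0..T} r \<partial>lborel)
        = 2 * (\<integral>\<^sup>+r. ennreal (exp (- (?l * r))) * indicator {0..T} r \<partial>lborel)"
      by (subst nn_integral_cmult[symmetric]) (auto simp: ennreal_mult' mult_ac)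
    also have "(\<integral>\<^sup>+r. ennreal (exp (- (?l * r))) * indicator {0..T} r \<partial>lborel)
        = (\<integral>\<^sup>+r. ennreal (exp (- (?l * (T - r)))) * indicator {0..T} r \<partial>lborel)"
      by (rule nn_integral_reflect[symmetric, where f = "\<lambda>r. ennreal (exp (- (?l * r)))"]) auto
    also have "\<dots> \<le> ennreal (1 / ?l)"
      using T by (intro nn_integral_exp_kernel_le) auto
    finally have "(\<integral>\<^sup>+r. ennreal (2 * exp (- (?l * r))) * indicator {0..T} r \<partial>lborel) \<le> 2 * ennreal (1 / ?l)"
      by (simp add: mult_left_mono)
    also have "\<dots> = ennreal (2 * (1 / ?l))"
      by (simp only: ennreal_mult'[of 2, OF zero_le_numeral] ennreal_numeral)
    also have "2 * (1 / ?l) = 2 / pi\<^sup>2 * (1 / (real (Suc k))\<^sup>2)" by simp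
    finally show "(\<integral>\<^sup>+r. ennreal (2 * exp (- (?l * r))) * indicator {0..T} r \<partial>lborel)
        \<le> ennreal (2 / pi\<^sup>2 * (1 / (real (Suc k))\<^sup>2))" .
  qed auto
  also have "\<dots> < \<infinity>"
  proof -
    have "summable (\<lambda>k. 1 / (real (Suc k))\<^sup>2)"
      using inverse_power_summable[of 2, where 'a = real]
      by (subst summable_Suc_iff) (simp add: field_simps)
    then have "summable (\<lambda>k. 2 / pi\<^sup>2 * (1 / (real (Suc k))\<^sup>2))" by (rule summable_mult)
    then show ?thesis by (subst suminf_ennreal2) auto
  qed
  finally show ?thesis .
qed simp

section \<open>Mapping properties of the heat semigroup\<close>

lemma summable_heat_exp:
  assumes "r > 0"
  shows "summable (\<lambda>k. exp (- (1/2) * (real (Suc k))\<^sup>2 * pi\<^sup>2 * r))"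
proof (rule summable_comparison_test')
  let ?c = "exp (- (1/2) * pi\<^sup>2 * r)"
  show "summable (\<lambda>k. ?c ^ k)" using assms by (intro summable_geometric) auto
  fix k :: nat
  have "real k * 1 \<le> (real (Suc k))\<^sup>2" unfolding power2_eq_square by (intro mult_mono) auto
  then have "real k * (1/2 * pi\<^sup>2 * r) \<le> (real (Suc k))\<^sup>2 * (1/2 * pi\<^sup>2 * r)"
    using assms by (intro mult_right_mono) auto
  then show "norm (exp (- (1/2) * (real (Suc k))\<^sup>2 * pi\<^sup>2 * r)) \<le> ?c ^ k"
    by (simp flip: exp_of_nat_mult add: mult_ac)
qed

lemma summable_heat_kernel:
  assumes "r > 0"
  shows "summable (\<lambda>k. exp (- (1/2) * (real (Suc k))\<^sup>2 * pi\<^sup>2 * r) *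
     dirichlet_eigenfunction (Suc k) x * dirichlet_eigenfunction (Suc k) y)"
proof (rule summable_comparison_test')
  show "summable (\<lambda>k. exp (- (1/2) * (real (Suc k))\<^sup>2 * pi\<^sup>2 * r) * sqrt 2 * sqrt 2)"
    using summable_heat_exp[OF assms] by (intro summable_mult2)
  show "norm (exp (- (1/2) * (real (Suc k))\<^sup>2 * pi\<^sup>2 * r) *
     dirichlet_eigenfunction (Suc k) x * dirichlet_eigenfunction (Suc k) y)
     \<le> exp (- (1/2) * (real (Suc k))\<^sup>2 * pi\<^sup>2 * r) * sqrt 2 * sqrt 2" for k
    unfolding norm_mult by (intro mult_mono) (auto simp: dirichlet_eigenfunction_bound)
qed

text \<open>Fatou's lemma and the Pythagorean identity for finite sine sums: for an upper bound,
  pointwise convergence of the partial sums is enough. The three kernel estimates below are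
  instances that differ in the bound on the coefficients.\<close>

lemma liminf_sum_nn_integral_bound:
  fixes q :: "real \<Rightarrow> real" and b :: "nat \<Rightarrow> real"
  assumes lim: "\<And>x. (\<lambda>n. \<Sum>k<n. b k * dirichlet_eigenfunction (Suc k) x) \<longlonglongrightarrow> q x"
    and bound: "\<And>n. ennreal (\<Sum>k<n. (b k)\<^sup>2) \<le> C"
  shows "(\<integral>\<^sup>+x. ennreal ((q x)\<^sup>2) \<partial>unit_lborel) \<le> C"
proof -
  let ?q = "\<lambda>n x. \<Sum>k<n. b k * dirichlet_eigenfunction (Suc k) x"
  have "ennreal ((q x)\<^sup>2) = liminf (\<lambda>n. ennreal ((?q n x)\<^sup>2))" for x
    by (rule lim_imp_Liminf[symmetric]) (auto intro!: tendsto_intros lim)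
  then have "(\<integral>\<^sup>+x. ennreal ((q x)\<^sup>2) \<partial>unit_lborel) = (\<integral>\<^sup>+x. liminf (\<lambda>n. ennreal ((?q n x)\<^sup>2)) \<partial>unit_lborel)"
    by simp
  also have "\<dots> \<le> liminf (\<lambda>n. \<integral>\<^sup>+x. ennreal ((?q n x)\<^sup>2) \<partial>unit_lborel)"
    by (rule nn_integral_liminf) measurable
  also have "\<dots> \<le> C"
  proof (rule Liminf_le)
    show "\<forall>\<^sub>F n in sequentially. (\<integral>\<^sup>+x. ennreal ((?q n x)\<^sup>2) \<partial>unit_lborel) \<le> C"
    proof (rule always_eventually, rule allI)
      fix n
      have "(\<integral>\<^sup>+x. ennreal ((?q n x)\<^sup>2) \<partial>unit_lborel) = ennreal (\<Sum>k<n. (b k)\<^sup>2)"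
        using eigenfunction_sum_square[where b = b and n = n]
        by (subst nn_integral_eq_integral) (auto simp: has_bochner_integral_iff)
      with bound show "(\<integral>\<^sup>+x. ennreal ((?q n x)\<^sup>2) \<partial>unit_lborel) \<le> C" by simp
    qed
  qed simp
  finally show ?thesis .
qed

text \<open>At a fixed positive time the partial sums of the kernel are bounded uniformly in both
  space variables, so a multiple of \<open>\<bar>f\<bar>\<close> is a majorant for exchanging sum
  and integral.\<close>

lemma heat_kernel_integral_limit:
  assumes r: "r > 0" and f: "integrable unit_lborel f"
  shows "(\<lambda>n. \<Sum>k<n. (exp (- (1/2) * (real (Suc k))\<^sup>2 * pi\<^sup>2 * r) *
      (LINT y|unit_lborel. dirichlet_eigenfunction (Suc k) y * f y)) * dirichlet_eigenfunction (Suc k) x)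
      \<longlonglongrightarrow> (LINT y|unit_lborel. heat_kernel r x y * f y)"
proof -
  let ?e = "\<lambda>k. dirichlet_eigenfunction (Suc k)"
  let ?a = "\<lambda>k. exp (- (1/2) * (real (Suc k))\<^sup>2 * pi\<^sup>2 * r)"
  have [measurable]: "f \<in> borel_measurable unit_lborel" using f by auto
  have "(\<lambda>n. LINT y|unit_lborel. (\<Sum>k<n. ?a k * ?e k x * ?e k y) * f y)
      \<longlonglongrightarrow> (LINT y|unit_lborel. heat_kernel r x y * f y)"
  proof (rule integral_dominated_convergence[where w = "\<lambda>y. (\<Sum>k. ?a k * sqrt 2 * sqrt 2) * \<bar>f y\<bar>"])
    show "AE y in unit_lborel. (\<lambda>n. (\<Sum>k<n. ?a k * ?e k x * ?e k y) * f y) \<longlonglongrightarrow> heat_kernel r x y * f y"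
      unfolding heat_kernel_def
      by (intro AE_I2 tendsto_intros summable_LIMSEQ summable_heat_kernel r)
    show "AE y in unit_lborel. norm ((\<Sum>k<n. ?a k * ?e k x * ?e k y) * f y)
        \<le> (\<Sum>k. ?a k * sqrt 2 * sqrt 2) * \<bar>f y\<bar>" for n
    proof (intro AE_I2)
      fix y
      have "\<bar>\<Sum>k<n. ?a k * ?e k x * ?e k y\<bar> \<le> (\<Sum>k<n. ?a k * sqrt 2 * sqrt 2)"
        by (rule order_trans[OF sum_abs], rule sum_mono, unfold abs_mult, intro mult_mono)
           (auto simp: dirichlet_eigenfunction_bound)
      also have "\<dots> \<le> (\<Sum>k. ?a k * sqrt 2 * sqrt 2)"
        using summable_heat_exp[OF r] by (intro sum_le_suminf summable_mult2) auto
      finally show "norm ((\<Sum>k<n. ?a k * ?e k x * ?e k y) * f y) \<le> (\<Sum>k. ?a k * sqrt 2 * sqrt 2) * \<bar>f y\<bar>"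
        by (simp add: abs_mult mult_right_mono)
    qed
  qed (use f in auto)
  moreover have "(LINT y|unit_lborel. (\<Sum>k<n. ?a k * ?e k x * ?e k y) * f y)
      = (\<Sum>k<n. (?a k * (LINT y|unit_lborel. ?e k y * f y)) * ?e k x)" for n
  proof -
    have "(LINT y|unit_lborel. (\<Sum>k<n. ?a k * ?e k x * ?e k y) * f y)
        = (LINT y|unit_lborel. (\<Sum>k<n. (?a k * ?e k x) * (?e k y * f y)))"
      by (intro Bochner_Integration.integral_cong refl) (subst sum_distrib_right, simp only: mult_ac)
    also have "\<dots> = (\<Sum>k<n. (?a k * ?e k x) * (LINT y|unit_lborel. ?e k y * f y))"
      using integrable_eigenfunction_mult[OF f] by (subst Bochner_Integration.integral_sum) auto
    finally show ?thesis by (simp add: mult_ac)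
  qed
  ultimately show ?thesis by simp
qed

lemma integrable_unit_lborel_of_square:
  assumes [measurable]: "f \<in> borel_measurable unit_lborel" and "integrable unit_lborel (\<lambda>x. (f x)\<^sup>2)"
  shows "integrable unit_lborel (f :: real \<Rightarrow> real)"
proof (rule Bochner_Integration.integrable_bound)
  show "integrable unit_lborel (\<lambda>x. 1 + (f x)\<^sup>2)"
    using assms integrable_bounded_unit_lborel[of "\<lambda>_. 1" 1] by simp
  show "AE x in unit_lborel. norm (f x) \<le> norm (1 + (f x)\<^sup>2)"
  proof (intro AE_I2)
    fix x
    have "0 \<le> (\<bar>f x\<bar> - 1)\<^sup>2" by simp
    then show "norm (f x) \<le> norm (1 + (f x)\<^sup>2)" by (simp add: power2_diff)
  qed
qed auto

text \<open>The coefficients are damped by factors at most one, and Bessel's inequality bounds the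
  sum of their squares. With extended integrals the estimate holds for every measurable
  \<open>f\<close>, so it can be applied path by path without an exceptional set.\<close>

lemma heat_semigroup_L2_contraction:
  assumes r: "r > 0" and [measurable]: "f \<in> borel_measurable unit_lborel"
  shows "(\<integral>\<^sup>+x. ennreal ((LINT y|unit_lborel. heat_kernel r x y * f y)\<^sup>2) \<partial>unit_lborel)
      \<le> (\<integral>\<^sup>+y. ennreal ((f y)\<^sup>2) \<partial>unit_lborel)"
proof (cases "integrable unit_lborel (\<lambda>x. (f x)\<^sup>2)")
  case False
  then have "(\<integral>\<^sup>+y. ennreal ((f y)\<^sup>2) \<partial>unit_lborel) = \<infinity>"
    by (simp add: integrable_iff_bounded not_less top_unique)
  then show ?thesis by simp
next
  case True
  note f = integrable_unit_lborel_of_square[OF assms(2) True]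
  let ?e = "\<lambda>k. dirichlet_eigenfunction (Suc k)"
  let ?a = "\<lambda>k. exp (- (1/2) * (real (Suc k))\<^sup>2 * pi\<^sup>2 * r)"
  show ?thesis
  proof (rule liminf_sum_nn_integral_bound[OF heat_kernel_integral_limit[OF r f]])
    fix n
    have "(\<Sum>k<n. (?a k * (LINT y|unit_lborel. ?e k y * f y))\<^sup>2) \<le> (\<Sum>k<n. (LINT y|unit_lborel. ?e k y * f y)\<^sup>2)"
      using r unfolding power_mult_distrib
      by (intro sum_mono mult_left_le_one_le) (auto intro!: power_le_one)
    also have "\<dots> \<le> (LINT x|unit_lborel. (f x)\<^sup>2)" by (rule bessel_inequality[OF f True])
    finally have "ennreal (\<Sum>k<n. (?a k * (LINT y|unit_lborel. ?e k y * f y))\<^sup>2) \<le> ennreal (LINT x|unit_lborel. (f x)\<^sup>2)"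
      by (rule ennreal_leI)
    also have "\<dots> = (\<integral>\<^sup>+y. ennreal ((f y)\<^sup>2) \<partial>unit_lborel)"
      by (rule nn_integral_eq_integral[symmetric]) (use True in auto)
    finally show "ennreal (\<Sum>k<n. (?a k * (LINT y|unit_lborel. ?e k y * f y))\<^sup>2) \<le> (\<integral>\<^sup>+y. ennreal ((f y)\<^sup>2) \<partial>unit_lborel)" .
  qed
qed

text \<open>The squared damping factor of the half Laplacian is the exponential in
  \<open>heat_trace\<close>, and the factor \<open>2\<close> there absorbs the bound
  \<open>sqrt 2\<close> on the eigenfunctions.\<close>

lemma heat_exp_square_sum_le:
  assumes "\<And>k. (b k)\<^sup>2 \<le> 2 * c" "c \<ge> 0"
  shows "ennreal (\<Sum>k<n. (exp (- (1/2) * (real (Suc k))\<^sup>2 * pi\<^sup>2 * r) * b k)\<^sup>2) \<le> heat_trace r * ennreal c"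
proof -
  let ?s = "\<lambda>k. 2 * exp (- ((real (Suc k))\<^sup>2 * pi\<^sup>2 * r))"
  have "(exp (- (1/2) * (real (Suc k))\<^sup>2 * pi\<^sup>2 * r) * b k)\<^sup>2 \<le> ?s k * c" for k
  proof -
    have "(exp (- (1/2) * (real (Suc k))\<^sup>2 * pi\<^sup>2 * r))\<^sup>2 = exp (- ((real (Suc k))\<^sup>2 * pi\<^sup>2 * r))"
      by (simp flip: exp_of_nat_mult)
    then show ?thesis
      using mult_left_mono[OF assms(1)[of k], of "exp (- ((real (Suc k))\<^sup>2 * pi\<^sup>2 * r))"]
      by (simp add: power_mult_distrib mult_ac)
  qed
  then have "ennreal (\<Sum>k<n. (exp (- (1/2) * (real (Suc k))\<^sup>2 * pi\<^sup>2 * r) * b k)\<^sup>2) \<le> ennreal (\<Sum>k<n. ?s k * c)"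
    by (intro ennreal_leI sum_mono)
  also have "\<dots> = (\<Sum>k<n. ennreal (?s k)) * ennreal c"
    by (subst sum_ennreal, simp, simp only: sum_distrib_right[symmetric] ennreal_mult''[OF assms(2)])
  also have "\<dots> \<le> heat_trace r * ennreal c"
    unfolding heat_trace_def by (intro mult_right_mono sum_le_suminf) auto
  finally show ?thesis .
qed

text \<open>The sine coefficients of an integrable function are at most \<open>sqrt 2\<close> times
  its norm, uniformly in the index, which leaves the sum of the squared damping factors. This is the
  estimate that tolerates a product of two square-integrable functions.\<close>

lemma heat_semigroup_L1_L2:
  assumes r: "r > 0" and [measurable]: "f \<in> borel_measurable unit_lborel"
  shows "(\<integral>\<^sup>+x. ennreal ((LINT y|unit_lborel. heat_kernel r x y * f y)\<^sup>2) \<partial>unit_lborel)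
      \<le> heat_trace r * (\<integral>\<^sup>+y. ennreal \<bar>f y\<bar> \<partial>unit_lborel)\<^sup>2"
proof (cases "integrable unit_lborel f")
  case False
  then have "(\<integral>\<^sup>+y. ennreal \<bar>f y\<bar> \<partial>unit_lborel) = \<infinity>"
    by (simp add: integrable_iff_bounded not_less top_unique)
  then show ?thesis using heat_trace_pos[of r]
    by (simp add: power2_eq_square ennreal_mult_top zero_less_iff_neq_zero)
next
  case f: True
  let ?e = "\<lambda>k. dirichlet_eigenfunction (Suc k)"
  let ?I = "LINT y|unit_lborel. \<bar>f y\<bar>"
  have "(\<integral>\<^sup>+x. ennreal ((LINT y|unit_lborel. heat_kernel r x y * f y)\<^sup>2) \<partial>unit_lborel)
      \<le> heat_trace r * ennreal (?I\<^sup>2)"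
  proof (rule liminf_sum_nn_integral_bound[OF heat_kernel_integral_limit[OF r f]], rule heat_exp_square_sum_le)
    fix k
    have "\<bar>LINT y|unit_lborel. ?e k y * f y\<bar> \<le> (LINT y|unit_lborel. sqrt 2 * \<bar>f y\<bar>)"
      by (rule order_trans[OF integral_abs_bound], rule integral_mono)
         (auto simp: abs_mult intro!: mult_right_mono dirichlet_eigenfunction_bound f
           integrable_abs[OF integrable_eigenfunction_mult[OF f], unfolded abs_mult])
    then have "\<bar>LINT y|unit_lborel. ?e k y * f y\<bar> \<le> sqrt 2 * ?I" by simp
    then have "\<bar>LINT y|unit_lborel. ?e k y * f y\<bar>\<^sup>2 \<le> (sqrt 2 * ?I)\<^sup>2" by (rule power_mono) simp
    then show "(LINT y|unit_lborel. ?e k y * f y)\<^sup>2 \<le> 2 * ?I\<^sup>2" by (simp add: power_mult_distrib)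
  qed simp
  also have "ennreal (?I\<^sup>2) = (\<integral>\<^sup>+y. ennreal \<bar>f y\<bar> \<partial>unit_lborel)\<^sup>2"
    using f by (subst nn_integral_eq_integral) (auto simp: ennreal_power)
  finally show ?thesis .
qed

text \<open>For fixed \<open>y\<close> the kernel is itself a sine series in \<open>x\<close>, with
  undamped coefficients bounded by \<open>sqrt 2\<close>. The noise term relies on the uniformity in
  \<open>y\<close>, since there \<open>x\<close> is integrated first.\<close>

lemma heat_kernel_square_integral:
  assumes r: "r > 0"
  shows "(\<integral>\<^sup>+x. ennreal ((heat_kernel r x y)\<^sup>2) \<partial>unit_lborel) \<le> heat_trace r"
proof -
  have "(\<integral>\<^sup>+x. ennreal ((heat_kernel r x y)\<^sup>2) \<partial>unit_lborel) \<le> heat_trace r * ennreal 1"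
  proof (rule liminf_sum_nn_integral_bound[OF _ heat_exp_square_sum_le])
    fix x
    show "(\<lambda>n. \<Sum>k<n. exp (- (1/2) * (real (Suc k))\<^sup>2 * pi\<^sup>2 * r) * dirichlet_eigenfunction (Suc k) y *
        dirichlet_eigenfunction (Suc k) x) \<longlonglongrightarrow> heat_kernel r x y"
      using summable_LIMSEQ[OF summable_heat_kernel[OF r, of x y]]
      by (simp add: heat_kernel_def mult_ac)
    show "(dirichlet_eigenfunction (Suc k) y)\<^sup>2 \<le> 2 * 1" for k
      using power_mono[OF dirichlet_eigenfunction_bound[of "Suc k" y], of 2] by simp
  qed simp
  then show ?thesis by simp
qed

section \<open>White noise\<close>

lemma integrable_mult_of_squares:
  fixes X Y :: "'a \<Rightarrow> real"
  assumes [measurable]: "X \<in> borel_measurable M" "Y \<in> borel_measurable M"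
    and "integrable M (\<lambda>w. (X w)\<^sup>2)" "integrable M (\<lambda>w. (Y w)\<^sup>2)"
  shows "integrable M (\<lambda>w. X w * Y w)"
proof (rule Bochner_Integration.integrable_bound)
  show "integrable M (\<lambda>w. (X w)\<^sup>2 + (Y w)\<^sup>2)" using assms by simp
  show "AE w in M. norm (X w * Y w) \<le> norm ((X w)\<^sup>2 + (Y w)\<^sup>2)"
  proof (intro AE_I2)
    fix w
    have "0 \<le> (\<bar>X w\<bar> - \<bar>Y w\<bar>)\<^sup>2" "0 \<le> \<bar>X w\<bar> * \<bar>Y w\<bar>" by auto
    then have "\<bar>X w * Y w\<bar> \<le> (X w)\<^sup>2 + (Y w)\<^sup>2"
      unfolding power2_diff power2_abs abs_mult by linarith
    then show "norm (X w * Y w) \<le> norm ((X w)\<^sup>2 + (Y w)\<^sup>2)"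
      by simp
  qed
qed auto

lemma integrable_bounded_mult:
  fixes X Y :: "'a \<Rightarrow> real"
  assumes "X \<in> borel_measurable M" "\<And>w. w \<in> space M \<Longrightarrow> \<bar>X w\<bar> \<le> C" "integrable M Y"
  shows "integrable M (\<lambda>w. X w * Y w)"
proof (rule Bochner_Integration.integrable_bound)
  show "integrable M (\<lambda>w. C * Y w)" using assms by simp
  show "AE w in M. norm (X w * Y w) \<le> norm (C * Y w)"
    using assms(2) by (auto simp: abs_mult intro!: AE_I2 mult_right_mono) (smt (verit))
qed (use assms in auto)

lemma (in prob_space) centred_gaussian_moments:
  assumes "centred_gaussian M X v" "v \<ge> 0"
  shows "X \<in> borel_measurable M" "integrable M X" "integrable M (\<lambda>w. (X w)\<^sup>2)"
    "expectation X = 0" "expectation (\<lambda>w. (X w)\<^sup>2) = v"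
proof -
  show X[measurable]: "X \<in> borel_measurable M" using assms by (simp add: centred_gaussian_def)
  have "integrable M X \<and> integrable M (\<lambda>w. (X w)\<^sup>2) \<and> expectation X = 0 \<and> expectation (\<lambda>w. (X w)\<^sup>2) = v"
  proof (cases "v = 0")
    case True
    then have 0: "AE w in M. X w = 0" using assms by (simp add: centred_gaussian_def)
    have "integrable M X \<longleftrightarrow> integrable M (\<lambda>w. 0::real)" using 0 by (intro integrable_cong_AE) auto
    moreover have "integrable M (\<lambda>w. (X w)\<^sup>2) \<longleftrightarrow> integrable M (\<lambda>w. 0::real)"
      using 0 by (intro integrable_cong_AE) auto
    moreover have "expectation X = expectation (\<lambda>w. 0)" using 0 by (intro integral_cong_AE) auto
    moreover have "expectation (\<lambda>w. (X w)\<^sup>2) = expectation (\<lambda>w. 0)" using 0 by (intro integral_cong_AE) auto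
    ultimately show ?thesis using True by simp
  next
    case False
    then have D: "distributed M lborel X (\<lambda>x. ennreal (normal_density 0 (sqrt v) x))" and v: "sqrt v > 0"
      using assms by (auto simp: centred_gaussian_def)
    have odd: "has_bochner_integral lborel (\<lambda>x. normal_density 0 (sqrt v) x * x) 0"
      using normal_moment_odd[OF v, of 0 0] by simp
    have even: "has_bochner_integral lborel (\<lambda>x. normal_density 0 (sqrt v) x * x\<^sup>2) v"
      using normal_moment_even[OF v, of 0 1] assms(2) by (simp add: numeral_2_eq_2)
    have "integrable M (\<lambda>w. X w)" "integrable M (\<lambda>w. (X w)\<^sup>2)"
      using odd even distributed_integrable[OF D, of "\<lambda>x. x"] distributed_integrable[OF D, of "\<lambda>x. x\<^sup>2"]
      by (auto simp: has_bochner_integral_iff)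
    moreover have "expectation X = 0" "expectation (\<lambda>w. (X w)\<^sup>2) = v"
      using odd even distributed_integral[OF D, of "\<lambda>x. x"] distributed_integral[OF D, of "\<lambda>x. x\<^sup>2"]
      by (auto simp: has_bochner_integral_iff)
    ultimately show ?thesis by simp
  qed
  then show "integrable M X" "integrable M (\<lambda>w. (X w)\<^sup>2)" "expectation X = 0" "expectation (\<lambda>w. (X w)\<^sup>2) = v"
    by auto
qed

section \<open>Covariance, additivity and independence of the noise\<close>

context space_time_white_noise
begin

lemma noise_single:
  assumes "A \<in> noise_sets"
  shows "W A \<in> borel_measurable M" "integrable M (W A)" "integrable M (\<lambda>w. (W A w)\<^sup>2)"
    "expectation (W A) = 0" "expectation (\<lambda>w. (W A w)\<^sup>2) = measure lborel A"
proof -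
  have "centred_gaussian M (W A) (measure lborel A)"
    using gaussian[of "{A}" "\<lambda>_. 1"] assms by simp
  from centred_gaussian_moments[OF this]
  show "W A \<in> borel_measurable M" "integrable M (W A)" "integrable M (\<lambda>w. (W A w)\<^sup>2)"
    "expectation (W A) = 0" "expectation (\<lambda>w. (W A w)\<^sup>2) = measure lborel A" by auto
qed

lemma noise_mult_integrable:
  assumes "A \<in> noise_sets" "B \<in> noise_sets"
  shows "integrable M (\<lambda>w. W A w * W B w)"
  using noise_single[OF assms(1)] noise_single[OF assms(2)] by (intro integrable_mult_of_squares)

text \<open>Polarisation of the variance of \<open>W A + W B\<close>. The case \<open>A = B\<close>
  is separate because the family \<open>{A, B}\<close> then collapses to one set and the sum over it
  has a single term.\<close>

lemma noise_covariance:
  assumes A: "A \<in> noise_sets" and B: "B \<in> noise_sets"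
  shows "expectation (\<lambda>w. W A w * W B w) = measure lborel (A \<inter> B)"
proof (cases "A = B")
  case True
  then show ?thesis using noise_single(5)[OF A] by (simp add: power2_eq_square)
next
  case False
  let ?v = "measure lborel A + measure lborel B + 2 * measure lborel (A \<inter> B)"
  have "centred_gaussian M (\<lambda>w. W A w + W B w) ?v"
    using gaussian[of "{A, B}" "\<lambda>_. 1"] A B False by (simp add: Int_commute algebra_simps)
  then have "expectation (\<lambda>w. (W A w + W B w)\<^sup>2) = ?v"
    by (rule centred_gaussian_moments) simp
  also have "expectation (\<lambda>w. (W A w + W B w)\<^sup>2)
      = expectation (\<lambda>w. (W A w)\<^sup>2 + (W B w)\<^sup>2 + 2 * (W A w * W B w))"
    by (simp add: power2_sum mult.assoc)
  also have "\<dots> = measure lborel A + measure lborel B + 2 * expectation (\<lambda>w. W A w * W B w)"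
    using noise_single[OF A] noise_single[OF B] noise_mult_integrable[OF A B] by simp
  finally show ?thesis by simp
qed

text \<open>By the covariance formula the second moment of
  \<open>W (A \<union> B) - W A - W B\<close> is zero. The exceptional set depends on the two sets,
  so additivity may be invoked only finitely or countably often at a time.\<close>

lemma noise_additive:
  assumes A: "A \<in> noise_sets" and B: "B \<in> noise_sets" and "A \<inter> B = {}"
  shows "AE w in M. W (A \<union> B) w = W A w + W B w"
proof -
  have fin: "emeasure lborel A < \<infinity>" "emeasure lborel B < \<infinity>" and
    [measurable]: "A \<in> sets borel" "B \<in> sets borel"
    using A B by (auto simp: noise_sets_def)
  have "emeasure lborel (A \<union> B) \<le> emeasure lborel A + emeasure lborel B"
    by (rule emeasure_subadditive) auto
  also have "\<dots> < \<infinity>" using fin by simp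
  finally have AB: "A \<union> B \<in> noise_sets"
    using A B by (auto simp: noise_sets_def)
  have m: "measure lborel (A \<union> B) = measure lborel A + measure lborel B"
    using fin assms(3) by (intro measure_Union) auto
  let ?D = "\<lambda>w. W (A \<union> B) w - W A w - W B w"
  note [measurable] = noise_single(1)[OF A] noise_single(1)[OF B] noise_single(1)[OF AB]
  note sq = noise_single(3,5)[OF A] noise_single(3,5)[OF B] noise_single(3,5)[OF AB]
  note cr = noise_mult_integrable[OF A B] noise_mult_integrable[OF AB A] noise_mult_integrable[OF AB B]
    noise_covariance[OF A B] noise_covariance[OF AB A] noise_covariance[OF AB B]
  have eq: "(?D w)\<^sup>2 = (W (A \<union> B) w)\<^sup>2 + (W A w)\<^sup>2 + (W B w)\<^sup>2
      + 2 * (W A w * W B w) - 2 * (W (A \<union> B) w * W A w) - 2 * (W (A \<union> B) w * W B w)" for w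
    by (simp add: power2_eq_square algebra_simps)
  have "integrable M (\<lambda>w. (?D w)\<^sup>2)" unfolding eq using sq cr by simp
  moreover have "expectation (\<lambda>w. (?D w)\<^sup>2) = 0"
    unfolding eq using sq cr m assms(3) by (simp add: Int_Un_distrib2 Int_commute)
  ultimately have "AE w in M. (?D w)\<^sup>2 = 0"
    by (subst integral_nonneg_eq_0_iff_AE[symmetric]) auto
  then show ?thesis by eventually_elim simp
qed

lemma space_F: "0 \<le> t \<Longrightarrow> space (F t) = space M"
  using subalg by (auto simp: subalgebra_def)

lemma measurable_F_mono:
  assumes "X \<in> borel_measurable (F s)" "0 \<le> s" "s \<le> t"
  shows "X \<in> borel_measurable (F t)"
  using assms(1) by (rule measurable_mono[THEN subsetD, rotated -1])
    (use assms mono[of s t] space_F[of s] space_F[of t] in auto)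

lemma measurable_F_M: "X \<in> measurable (F s) N \<Longrightarrow> 0 \<le> s \<Longrightarrow> X \<in> measurable M N"
  using measurable_from_subalg[OF subalg] by auto

text \<open>Packages the sigma-algebra of \<open>independent_future\<close> as a measure, so that
  products of future increments can be recognised as measurable with respect to it.\<close>

definition future :: "real \<Rightarrow> 'w measure" where
  "future t = sigma (space M)
     {W A -` S \<inter> space M | A S. A \<in> noise_sets \<and> A \<subseteq> {t<..} \<times> {0..1} \<and> S \<in> sets borel}"

lemma measurable_future:
  assumes "A \<in> noise_sets" "A \<subseteq> {t<..} \<times> {0..1}"
  shows "W A \<in> borel_measurable (future t)"
proof (rule measurableI)
  fix S :: "real set" assume "S \<in> sets borel"
  then have "W A -` S \<inter> space M \<in> sigma_sets (space M)
     {W A -` S \<inter> space M | A S. A \<in> noise_sets \<and> A \<subseteq> {t<..} \<times> {0..1} \<and> S \<in> sets borel}"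
    using assms by (intro sigma_sets.Basic) auto
  moreover have "{W A -` S \<inter> space M | A S. A \<in> noise_sets \<and> A \<subseteq> {t<..} \<times> {0..1} \<and> S \<in> sets borel} \<subseteq> Pow (space M)"
    by auto
  ultimately show "W A -` S \<inter> space (future t) \<in> sets (future t)"
    by (simp add: future_def space_measure_of_conv)
qed simp

lemma independent_future_product:
  fixes X Y :: "'w \<Rightarrow> real"
  assumes t: "0 \<le> t" and X: "X \<in> borel_measurable (F t)" "integrable M X"
    and Y: "Y \<in> borel_measurable (future t)" "integrable M Y"
  shows "integrable M (\<lambda>w. X w * Y w)"
    "expectation (\<lambda>w. X w * Y w) = expectation X * expectation Y"
proof -
  let ?G = "{W A -` S \<inter> space M | A S. A \<in> noise_sets \<and> A \<subseteq> {t<..} \<times> {0..1} \<and> S \<in> sets borel}"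
  have G: "?G \<subseteq> Pow (space M)" by auto
  have "sigma_sets (space M) {X -` A \<inter> space M |A. A \<in> sets borel} \<subseteq> sets (F t)"
    using measurable_sets[OF X(1)] space_F[OF t]
    by (subst space_F[OF t, symmetric], intro sets.sigma_sets_subset) auto
  moreover have "sigma_sets (space M) {Y -` A \<inter> space M |A. A \<in> sets borel} \<subseteq> sigma_sets (space M) ?G"
  proof -
    have "{Y -` A \<inter> space M |A. A \<in> sets borel} \<subseteq> sets (future t)"
      using measurable_sets[OF Y(1)] by (auto simp: future_def space_measure_of_conv)
    then have "sigma_sets (space (future t)) {Y -` A \<inter> space M |A. A \<in> sets borel} \<subseteq> sets (future t)"
      by (rule sets.sigma_sets_subset)
    then show ?thesis using G by (simp add: future_def space_measure_of_conv)
  qed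
  moreover note independent_future[OF t, unfolded indep_set_def]
  ultimately have "indep_set (sigma_sets (space M) {X -` A \<inter> space M |A. A \<in> sets borel})
     (sigma_sets (space M) {Y -` A \<inter> space M |A. A \<in> sets borel})"
    unfolding indep_set_def
    by (elim indep_sets_mono_sets) (auto split: bool.splits)
  then have ind: "indep_var borel X borel Y"
    unfolding indep_var_eq using X(2) Y(2) by auto
  show "integrable M (\<lambda>w. X w * Y w)" by (rule indep_var_integrable[OF ind X(2) Y(2)])
  show "expectation (\<lambda>w. X w * Y w) = expectation X * expectation Y"
    by (rule indep_var_lebesgue_integral[OF ind X(2) Y(2)])
qed

lemma rectangle_noise_set:
  assumes "0 \<le> a" "A \<in> sets borel" "A \<subseteq> {0..1}"
  shows "{a<..b} \<times> A \<in> noise_sets"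
proof -
  have "emeasure lborel ({a<..b} \<times> A) = emeasure lborel {a<..b} * emeasure lborel A"
    using assms by (subst lborel_prod[symmetric], subst lborel.emeasure_pair_measure_Times) auto
  also have "emeasure lborel A \<le> emeasure lborel {0..1::real}"
    using assms by (intro emeasure_mono) auto
  finally have "emeasure lborel ({a<..b} \<times> A) \<le> emeasure lborel {a<..b} * 1"
    by (simp add: mult_left_mono)
  also have "\<dots> < \<infinity>" by (cases "a \<le> b") auto
  finally show ?thesis
    using assms by (auto simp: noise_sets_def intro!: borel_Times)
qed

lemma measure_rectangle:
  fixes A B :: "real set"
  assumes "A \<in> sets borel" "B \<in> sets borel"
  shows "measure lborel (A \<times> B) = measure lborel A * measure lborel B"
  using assms unfolding measure_def
  by (subst lborel_prod[symmetric], subst lborel.emeasure_pair_measure_Times) (auto simp: enn2real_mult)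

text \<open>The minimum makes the formula hold for \<open>b < c\<close> too, where the second
  rectangle is empty.\<close>

lemma noise_rectangle_split:
  assumes "0 \<le> a" "a \<le> c" "A \<in> sets borel" "A \<subseteq> {0..1}"
  shows "AE w in M. W ({a<..b} \<times> A) w = W ({a<..min b c} \<times> A) w + W ({c<..b} \<times> A) w"
proof -
  have "{a<..b} \<times> A = {a<..min b c} \<times> A \<union> {c<..b} \<times> A" using assms by auto
  moreover have "{a<..min b c} \<times> A \<inter> {c<..b} \<times> A = {}" by auto
  ultimately show ?thesis
    using noise_additive[OF rectangle_noise_set rectangle_noise_set] assms by auto
qed

text \<open>The first increment is cut at \<open>c\<close>, the later of the two starting times. Its
  part up to \<open>c\<close> belongs to the past and multiplies a centred future increment, so it
  drops out. Its part after \<open>c\<close> forms with the second increment a product independent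
  of \<open>X * Y\<close>, and the covariance of the two gives the measure of the
  intersection.\<close>

lemma elementary_isometry_ordered:
  assumes ac: "0 \<le> a" "a \<le> c"
    and A: "A \<in> sets borel" "A \<subseteq> {0..1}" and B: "B \<in> sets borel" "B \<subseteq> {0..1}"
    and X: "X \<in> borel_measurable (F a)" "\<And>w. w \<in> space M \<Longrightarrow> \<bar>X w\<bar> \<le> C"
    and Y: "Y \<in> borel_measurable (F c)" "\<And>w. w \<in> space M \<Longrightarrow> \<bar>Y w\<bar> \<le> D"
  shows "integrable M (\<lambda>w. (X w * W ({a<..b} \<times> A) w) * (Y w * W ({c<..d} \<times> B) w))"
    "expectation (\<lambda>w. (X w * W ({a<..b} \<times> A) w) * (Y w * W ({c<..d} \<times> B) w))
      = expectation (\<lambda>w. X w * Y w) * (measure lborel ({a<..b} \<inter> {c<..d}) * measure lborel (A \<inter> B))"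
proof -
  let ?W1 = "W ({a<..min b c} \<times> A)" and ?W2 = "W ({c<..b} \<times> A)" and ?V = "W ({c<..d} \<times> B)"
  have c: "0 \<le> c" using ac by simp
  have n1: "{a<..min b c} \<times> A \<in> noise_sets" and n2: "{c<..b} \<times> A \<in> noise_sets"
    and n3: "{c<..d} \<times> B \<in> noise_sets" and n: "{a<..b} \<times> A \<in> noise_sets"
    using ac A B by (auto intro!: rectangle_noise_set)
  note [measurable] = noise_single(1)[OF n1] noise_single(1)[OF n2] noise_single(1)[OF n3] noise_single(1)[OF n]
  have XY[measurable]: "(\<lambda>w. X w * Y w) \<in> borel_measurable (F c)"
    using measurable_F_mono[OF X(1) ac] Y(1) by measurable
  have XYM: "(\<lambda>w. X w * Y w) \<in> borel_measurable M" by (rule measurable_F_M[OF XY c])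
  have [measurable]: "X \<in> borel_measurable M" "Y \<in> borel_measurable M"
    using X Y ac c by (auto intro: measurable_F_M)
  have bd: "\<bar>X w * Y w\<bar> \<le> C * D" if "w \<in> space M" for w
    using X(2)[OF that] Y(2)[OF that] by (auto simp: abs_mult intro!: mult_mono) 
  have iXY: "integrable M (\<lambda>w. X w * Y w)"
    using integrable_bounded_mult[OF XYM bd, of "\<lambda>_. 1"] by simp
  have W1: "?W1 \<in> borel_measurable (F c)"
    using ac A by (intro adapted n1) auto
  have I1: "integrable M (\<lambda>w. (X w * Y w) * ?W1 w)"
    by (rule integrable_bounded_mult[OF XYM bd noise_single(2)[OF n1]])
  have V: "?V \<in> borel_measurable (future c)"
    using B by (intro measurable_future n3) auto
  \<comment> \<open>The product with the past increment is integrable but unbounded; the product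
    rule for independent variables asks for integrability only.\<close>
  have first: "integrable M (\<lambda>w. ((X w * Y w) * ?W1 w) * ?V w)"
    "expectation (\<lambda>w. ((X w * Y w) * ?W1 w) * ?V w) = 0"
    using independent_future_product[OF c _ I1 V noise_single(2)[OF n3]] noise_single(4)[OF n3] XY W1
    by auto
  have W2: "?W2 \<in> borel_measurable (future c)"
    using A by (intro measurable_future n2) auto
  \<comment> \<open>The two increments are correlated, but both lie after \<open>c\<close>, so their
    product as a whole is a future variable.\<close>
  have second: "integrable M (\<lambda>w. (X w * Y w) * (?W2 w * ?V w))"
    "expectation (\<lambda>w. (X w * Y w) * (?W2 w * ?V w)) = expectation (\<lambda>w. X w * Y w) *
       measure lborel ({c<..b} \<times> A \<inter> {c<..d} \<times> B)"
    using independent_future_product[OF c XY iXY _ noise_mult_integrable[OF n2 n3]]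
      noise_covariance[OF n2 n3] W2 V by auto
  have eq: "AE w in M. (X w * W ({a<..b} \<times> A) w) * (Y w * ?V w)
     = ((X w * Y w) * ?W1 w) * ?V w + (X w * Y w) * (?W2 w * ?V w)"
    using noise_rectangle_split[OF ac A, of b] by eventually_elim (simp add: algebra_simps)
  have "integrable M (\<lambda>w. (X w * W ({a<..b} \<times> A) w) * (Y w * ?V w))
      = integrable M (\<lambda>w. ((X w * Y w) * ?W1 w) * ?V w + (X w * Y w) * (?W2 w * ?V w))"
    using eq by (intro integrable_cong_AE) auto
  then show "integrable M (\<lambda>w. (X w * W ({a<..b} \<times> A) w) * (Y w * ?V w))"
    using first second by simp
  have "expectation (\<lambda>w. (X w * W ({a<..b} \<times> A) w) * (Y w * ?V w))
      = expectation (\<lambda>w. ((X w * Y w) * ?W1 w) * ?V w + (X w * Y w) * (?W2 w * ?V w))"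
    using eq by (intro integral_cong_AE) auto
  also have "\<dots> = expectation (\<lambda>w. X w * Y w) * measure lborel ({c<..b} \<times> A \<inter> {c<..d} \<times> B)"
    using first second by simp
  also have "{c<..b} \<times> A \<inter> {c<..d} \<times> B = ({a<..b} \<inter> {c<..d}) \<times> (A \<inter> B)" using ac by auto
  also have "measure lborel \<dots> = measure lborel ({a<..b} \<inter> {c<..d}) * measure lborel (A \<inter> B)"
    using A B by (intro measure_rectangle) auto
  finally show "expectation (\<lambda>w. (X w * W ({a<..b} \<times> A) w) * (Y w * ?V w))
      = expectation (\<lambda>w. X w * Y w) * (measure lborel ({a<..b} \<inter> {c<..d}) * measure lborel (A \<inter> B))" .
qed

lemma elementary_isometry:
  assumes ac: "0 \<le> a" "0 \<le> c"
    and A: "A \<in> sets borel" "A \<subseteq> {0..1}" and B: "B \<in> sets borel" "B \<subseteq> {0..1}"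
    and X: "X \<in> borel_measurable (F a)" "\<And>w. w \<in> space M \<Longrightarrow> \<bar>X w\<bar> \<le> C"
    and Y: "Y \<in> borel_measurable (F c)" "\<And>w. w \<in> space M \<Longrightarrow> \<bar>Y w\<bar> \<le> D"
  shows "integrable M (\<lambda>w. (X w * W ({a<..b} \<times> A) w) * (Y w * W ({c<..d} \<times> B) w))"
    "expectation (\<lambda>w. (X w * W ({a<..b} \<times> A) w) * (Y w * W ({c<..d} \<times> B) w))
      = expectation (\<lambda>w. X w * Y w) * (measure lborel ({a<..b} \<inter> {c<..d}) * measure lborel (A \<inter> B))"
proof -
  have "integrable M (\<lambda>w. (X w * W ({a<..b} \<times> A) w) * (Y w * W ({c<..d} \<times> B) w)) \<and>
    expectation (\<lambda>w. (X w * W ({a<..b} \<times> A) w) * (Y w * W ({c<..d} \<times> B) w))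
      = expectation (\<lambda>w. X w * Y w) * (measure lborel ({a<..b} \<inter> {c<..d}) * measure lborel (A \<inter> B))"
  proof (cases "a \<le> c")
    case True
    then show ?thesis using elementary_isometry_ordered[OF ac(1) True A B X Y] by simp
  next
    case False
    then have "c \<le> a" by simp
    from elementary_isometry_ordered[OF ac(2) this B A Y X, of d b]
    show ?thesis by (simp add: mult.commute Int_commute)
  qed
  then show "integrable M (\<lambda>w. (X w * W ({a<..b} \<times> A) w) * (Y w * W ({c<..d} \<times> B) w))"
    "expectation (\<lambda>w. (X w * W ({a<..b} \<times> A) w) * (Y w * W ({c<..d} \<times> B) w))
      = expectation (\<lambda>w. X w * Y w) * (measure lborel ({a<..b} \<inter> {c<..d}) * measure lborel (A \<inter> B))"
    by auto
qed

end

section \<open>Simple processes\<close>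

lemma integral_double_sum:
  fixes f :: "nat \<Rightarrow> nat \<Rightarrow> 'a \<Rightarrow> real"
  assumes "\<And>i j. i < n \<Longrightarrow> j < n \<Longrightarrow> integrable N (f i j)"
  shows "(LINT w|N. (\<Sum>i<n. \<Sum>j<n. f i j w)) = (\<Sum>i<n. \<Sum>j<n. LINT w|N. f i j w)"
proof -
  have "(LINT w|N. (\<Sum>i<n. \<Sum>j<n. f i j w)) = (\<Sum>i<n. LINT w|N. (\<Sum>j<n. f i j w))"
    using assms by (intro Bochner_Integration.integral_sum Bochner_Integration.integrable_sum) auto
  also have "\<dots> = (\<Sum>i<n. \<Sum>j<n. LINT w|N. f i j w)"
    using assms by (intro sum.cong refl Bochner_Integration.integral_sum) auto
  finally show ?thesis .
qed

definition energy :: "real \<Rightarrow> (real \<Rightarrow> real \<Rightarrow> real) \<Rightarrow> ennreal" where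
  "energy t \<phi> = (\<integral>\<^sup>+s. (\<integral>\<^sup>+y. ennreal ((\<phi> s y)\<^sup>2) \<partial>unit_lborel) * indicator {0..t} s \<partial>lborel)"

lemma simple_value_Nil[simp]: "simple_value [] s y w = 0"
  and simple_value_Cons: "simple_value ((a, b, A, X) # \<Psi>) s y w =
    X w * indicator {a<..b} s * indicator A y + simple_value \<Psi> s y w"
  and simple_value_append: "simple_value (\<Psi> @ \<Psi>') s y w = simple_value \<Psi> s y w + simple_value \<Psi>' s y w"
  by (auto simp: simple_value_def)

lemma simple_integral_Nil[simp]: "simple_integral W t [] w = 0"
  and simple_integral_Cons: "simple_integral W t ((a, b, A, X) # \<Psi>) w =
    X w * W (({a<..b} \<inter> {..t}) \<times> A) w + simple_integral W t \<Psi> w"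
  and simple_integral_append:
    "simple_integral W t (\<Psi> @ \<Psi>') w = simple_integral W t \<Psi> w + simple_integral W t \<Psi>' w"
  by (auto simp: simple_integral_def)

lemma is_simple_Nil[simp]: "is_simple M F []"
  and is_simple_Cons: "is_simple M F ((a, b, A, X) # \<Psi>) \<longleftrightarrow> 0 \<le> a \<and> a \<le> b \<and> A \<in> sets borel \<and>
     A \<subseteq> {0..1} \<and> X \<in> borel_measurable (F a) \<and> (\<exists>C. \<forall>\<omega>\<in>space M. \<bar>X \<omega>\<bar> \<le> C) \<and> is_simple M F \<Psi>"
  and is_simple_append: "is_simple M F (\<Psi> @ \<Psi>') \<longleftrightarrow> is_simple M F \<Psi> \<and> is_simple M F \<Psi>'"
  unfolding is_simple_def by (simp_all add: ball_Un)

text \<open>The sigma-algebra \<open>G\<close> is left open: it is \<open>M\<close> for joint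
  measurability and \<open>F s\<close> where the running energy up to time \<open>s\<close> has to
  be adapted.\<close>

lemma measurable_simple_value_general:
  assumes "\<And>a b A X. (a, b, A, X) \<in> set \<Psi> \<Longrightarrow> A \<in> sets borel \<and> X \<in> borel_measurable G"
    and [measurable]: "f \<in> borel_measurable N" "g \<in> borel_measurable N" "h \<in> measurable N G"
  shows "(\<lambda>z. simple_value \<Psi> (f z) (g z) (h z)) \<in> borel_measurable N"
  using assms(1)
proof (induction \<Psi>)
  case (Cons p \<Psi>)
  obtain a b A X where p: "p = (a, b, A, X)" by (cases p) auto
  have [measurable]: "A \<in> sets borel" "X \<in> borel_measurable G" using Cons.prems p by auto
  have [measurable]: "(\<lambda>z. simple_value \<Psi> (f z) (g z) (h z)) \<in> borel_measurable N"
    using Cons by auto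
  show ?case unfolding p simple_value_Cons by measurable
qed simp

lemma simple_value_bounded:
  assumes "is_simple M F \<Psi>"
  shows "\<exists>C\<ge>0. \<forall>w\<in>space M. \<forall>s y. \<bar>simple_value \<Psi> s y w\<bar> \<le> C"
  using assms
proof (induction \<Psi>)
  case (Cons p \<Psi>)
  obtain a b A X where p: "p = (a, b, A, X)" by (cases p) auto
  obtain D where D: "\<forall>w\<in>space M. \<bar>X w\<bar> \<le> D" using Cons.prems by (auto simp: p is_simple_Cons)
  obtain C where C: "C \<ge> 0" "\<forall>w\<in>space M. \<forall>s y. \<bar>simple_value \<Psi> s y w\<bar> \<le> C"
    using Cons by (auto simp: p is_simple_Cons)
  have "\<bar>simple_value (p # \<Psi>) s y w\<bar> \<le> \<bar>D\<bar> + C" if "w \<in> space M" for s y w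
  proof -
    have "\<bar>X w * indicator {a<..b} s * indicator A y\<bar> \<le> \<bar>D\<bar>"
      using D that by (auto simp: indicator_def)
    moreover have "\<bar>simple_value \<Psi> s y w\<bar> \<le> C" using C that by blast
    ultimately show ?thesis unfolding p simple_value_Cons by linarith
  qed
  then show ?case using C(1) by (intro exI[of _ "\<bar>D\<bar> + C"]) auto
qed auto

lemma measure_unit_lborel:
  assumes "A \<in> sets borel" "A \<subseteq> {0..1}"
  shows "measure unit_lborel A = measure lborel A"
  using assms by (intro measure_restrict_space) auto

lemma has_bochner_integral_unit_indicator:
  assumes "A \<in> sets borel" "A \<subseteq> {0..1}"
  shows "has_bochner_integral unit_lborel (indicator A :: real \<Rightarrow> real) (measure lborel A)"
proof -
  interpret finite_measure unit_lborel by (rule finite_measure_unit_lborel)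
  have "A \<in> sets unit_lborel" using assms by (auto simp: sets_restrict_space_iff)
  then show ?thesis
    unfolding measure_unit_lborel[OF assms, symmetric]
    by (intro has_bochner_integral_real_indicator) (auto simp: less_top[symmetric])
qed

text \<open>The energy is written as the same double sum that the second moment of the integral
  produces. Nonnegativity of \<open>Q\<close> accompanies it because \<open>ennreal\<close> sends
  negative numbers to zero.\<close>

lemma simple_energy:
  fixes a b c :: "nat \<Rightarrow> real" and A :: "nat \<Rightarrow> real set" and t :: real
  assumes "\<And>i. i < n \<Longrightarrow> 0 \<le> a i" "\<And>i. i < n \<Longrightarrow> A i \<in> sets borel" "\<And>i. i < n \<Longrightarrow> A i \<subseteq> {0..1}"
  defines "Q \<equiv> (\<Sum>i<n. \<Sum>j<n. (c i * c j) *
     (measure lborel ({a i<..min (b i) t} \<inter> {a j<..min (b j) t}) * measure lborel (A i \<inter> A j)))"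
  shows "energy t (\<lambda>s y. \<Sum>i<n. c i * indicator {a i<..b i} s * indicator (A i) y) = ennreal Q" "Q \<ge> 0"
proof -
  let ?v = "\<lambda>s y. \<Sum>i<n. c i * indicator {a i<..b i} s * indicator (A i) y"
  define g where "g s = (\<Sum>i<n. \<Sum>j<n. (c i * c j * indicator {a i<..b i} s * indicator {a j<..b j} s) *
     measure lborel (A i \<inter> A j))" for s
  have sq: "(?v s y)\<^sup>2 = (\<Sum>i<n. \<Sum>j<n. (c i * c j * indicator {a i<..b i} s * indicator {a j<..b j} s) *
     indicator (A i \<inter> A j) y)" for s y
    unfolding power2_eq_square sum_product
    by (intro sum.cong refl) (simp add: indicator_inter_arith mult_ac)
  have inner: "has_bochner_integral unit_lborel (\<lambda>y. (?v s y)\<^sup>2) (g s)" for s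
    unfolding sq g_def using assms(2,3)
    by (intro has_bochner_integral_sum has_bochner_integral_mult_right has_bochner_integral_unit_indicator) auto
  have g0: "g s \<ge> 0" for s
    using has_bochner_integral_integral_eq[OF inner]
      Bochner_Integration.integral_nonneg[of unit_lborel "\<lambda>y. (?v s y)\<^sup>2"] by simp
  have nn: "(\<integral>\<^sup>+y. ennreal ((?v s y)\<^sup>2) \<partial>unit_lborel) = ennreal (g s)" for s
    using inner[of s] by (subst nn_integral_eq_integral) (auto simp: has_bochner_integral_iff)
  have gs: "g s * indicator {0..t} s = (\<Sum>i<n. \<Sum>j<n. (c i * c j * measure lborel (A i \<inter> A j)) *
      indicator ({a i<..min (b i) t} \<inter> {a j<..min (b j) t}) s)" for s
    unfolding g_def sum_distrib_right
    by (intro sum.cong refl) (use assms(1) in \<open>force simp: indicator_def\<close>)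
  have fin: "emeasure lborel ({a i<..min (b i) t} \<inter> {a j<..min (b j) t}) < \<infinity>" for i j
  proof -
    have "emeasure lborel ({a i<..min (b i) t} \<inter> {a j<..min (b j) t}) \<le> emeasure lborel {a i..b i}"
      by (intro emeasure_mono) auto
    also have "\<dots> < \<infinity>" by (cases "a i \<le> b i") auto
    finally show ?thesis .
  qed
  have outer: "has_bochner_integral lborel (\<lambda>s. g s * indicator {0..t} s)
      (\<Sum>i<n. \<Sum>j<n. (c i * c j * measure lborel (A i \<inter> A j)) *
      measure lborel ({a i<..min (b i) t} \<inter> {a j<..min (b j) t}))"
    unfolding gs using fin
    by (intro has_bochner_integral_sum has_bochner_integral_mult_right has_bochner_integral_real_indicator) auto
  moreover have "(\<Sum>i<n. \<Sum>j<n. (c i * c j * measure lborel (A i \<inter> A j)) *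
      measure lborel ({a i<..min (b i) t} \<inter> {a j<..min (b j) t})) = Q"
    unfolding Q_def by (simp add: mult_ac)
  ultimately have outer: "has_bochner_integral lborel (\<lambda>s. g s * indicator {0..t} s) Q" by simp
  show "Q \<ge> 0" using has_bochner_integral_integral_eq[OF outer] g0
      Bochner_Integration.integral_nonneg[of lborel "\<lambda>s. g s * indicator {0..t} s"] by simp
  have "energy t ?v = (\<integral>\<^sup>+s. ennreal (g s * indicator {0..t} s) \<partial>lborel)"
    unfolding energy_def nn by (intro nn_integral_cong) (auto simp: indicator_def)
  also have "\<dots> = ennreal Q"
    using outer g0 by (subst nn_integral_eq_integral) (auto simp: has_bochner_integral_iff)
  finally show "energy t ?v = ennreal Q" .
qed

context space_time_white_noise
begin

lemma simple_integral_measurable: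
  assumes "is_simple M F \<Psi>"
  shows "simple_integral W t \<Psi> \<in> borel_measurable M"
  using assms
proof (induction \<Psi>)
  case (Cons p \<Psi>)
  obtain a b A X where p: "p = (a, b, A, X)" by (cases p) auto
  have 1: "0 \<le> a" "A \<in> sets borel" "A \<subseteq> {0..1}" "X \<in> borel_measurable (F a)"
    using Cons.prems by (auto simp: p is_simple_Cons)
  have "{a<..b} \<inter> {..t} = {a<..min b t}" by auto
  then have [measurable]: "W (({a<..b} \<inter> {..t}) \<times> A) \<in> borel_measurable M"
    using noise_single(1)[OF rectangle_noise_set[OF 1(1-3)]] by simp
  have [measurable]: "X \<in> borel_measurable M" by (rule measurable_F_M[OF 1(4,1)])
  have [measurable]: "simple_integral W t \<Psi> \<in> borel_measurable M"
    using Cons by (auto simp: p is_simple_Cons)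
  have "simple_integral W t (p # \<Psi>) = (\<lambda>w. X w * W (({a<..b} \<inter> {..t}) \<times> A) w + simple_integral W t \<Psi> w)"
    by (auto simp: p simple_integral_Cons)
  then show ?case by simp
next
  case Nil
  have "simple_integral W t [] = (\<lambda>w. 0)" by (simp add: fun_eq_iff)
  then show ?case by simp
qed

lemma measurable_simple_value:
  assumes "is_simple M F \<Psi>"
    and "f \<in> borel_measurable N" "g \<in> borel_measurable N" "h \<in> measurable N M"
  shows "(\<lambda>z. simple_value \<Psi> (f z) (g z) (h z)) \<in> borel_measurable N"
  by (rule measurable_simple_value_general[OF _ assms(2-4)])
     (use assms(1) in \<open>auto simp: is_simple_def intro!: measurable_F_M\<close>)

text \<open>Entries of the list may overlap in time and space, so all cross terms are kept: both
  sides are expanded into double sums over pairs of entries and compared through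
  \<open>elementary_isometry\<close>.\<close>

lemma simple_isometry:
  assumes \<Psi>: "is_simple M F \<Psi>"
  shows "(\<integral>\<^sup>+w. ennreal ((simple_integral W t \<Psi> w)\<^sup>2) \<partial>M) = (\<integral>\<^sup>+w. energy t (\<lambda>s y. simple_value \<Psi> s y w) \<partial>M)"
proof -
  define n where "n = length \<Psi>"
  define a where "a i = fst (\<Psi> ! i)" for i
  define b where "b i = fst (snd (\<Psi> ! i))" for i
  define A where "A i = fst (snd (snd (\<Psi> ! i)))" for i
  define X where "X i = snd (snd (snd (\<Psi> ! i)))" for i
  have nth: "\<Psi> ! i = (a i, b i, A i, X i)" for i by (simp add: a_def b_def A_def X_def)
  have props: "0 \<le> a i" "A i \<in> sets borel" "A i \<subseteq> {0..1}" "X i \<in> borel_measurable (F (a i))"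
      "\<exists>C. \<forall>w\<in>space M. \<bar>X i w\<bar> \<le> C" if "i < n" for i
    using \<Psi> that nth_mem[of i \<Psi>] by (auto simp: is_simple_def nth n_def)
  define C where "C i = (SOME C. \<forall>w\<in>space M. \<bar>X i w\<bar> \<le> C)" for i
  have C: "\<bar>X i w\<bar> \<le> C i" if "i < n" "w \<in> space M" for i w
    unfolding C_def using someI_ex[OF props(5)[OF that(1)]] that by blast
  let ?R = "\<lambda>i. {a i<..min (b i) t}"
  let ?m = "\<lambda>i j. measure lborel (?R i \<inter> ?R j) * measure lborel (A i \<inter> A j)"
  have val: "simple_value \<Psi> s y w = (\<Sum>i<n. X i w * indicator {a i<..b i} s * indicator (A i) y)" for s y w
    unfolding simple_value_def sum_list_sum_nth by (simp add: nth n_def lessThan_atLeast0)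
  have int: "simple_integral W t \<Psi> w = (\<Sum>i<n. X i w * W (?R i \<times> A i) w)" for w
  proof -
    have "{a i<..b i} \<inter> {..t} = ?R i" for i by auto
    then show ?thesis
      unfolding simple_integral_def sum_list_sum_nth by (simp add: nth n_def lessThan_atLeast0)
  qed
  have XM: "X i \<in> borel_measurable M" if "i < n" for i
    using props[OF that] by (intro measurable_F_M)
  have XX: "integrable M (\<lambda>w. X i w * X j w)" if "i < n" "j < n" for i j
    using integrable_bounded_mult[OF XM C, of i "X j"] integrable_bounded_mult[OF XM C, of j "\<lambda>_. 1"] that by auto
  have iso: "integrable M (\<lambda>w. (X i w * W (?R i \<times> A i) w) * (X j w * W (?R j \<times> A j) w))"
    "expectation (\<lambda>w. (X i w * W (?R i \<times> A i) w) * (X j w * W (?R j \<times> A j) w))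
      = expectation (\<lambda>w. X i w * X j w) * ?m i j" if "i < n" "j < n" for i j
    by (rule elementary_isometry[OF props(1) props(1) props(2,3) props(2,3) props(4) C props(4) C]; (rule that | assumption))+
  have sq: "(simple_integral W t \<Psi> w)\<^sup>2
      = (\<Sum>i<n. \<Sum>j<n. (X i w * W (?R i \<times> A i) w) * (X j w * W (?R j \<times> A j) w))" for w
    unfolding int power2_eq_square sum_product ..
  have "integrable M (\<lambda>w. (simple_integral W t \<Psi> w)\<^sup>2)"
    unfolding sq using iso(1) by (intro Bochner_Integration.integrable_sum) auto
  then have "(\<integral>\<^sup>+w. ennreal ((simple_integral W t \<Psi> w)\<^sup>2) \<partial>M)
      = ennreal (expectation (\<lambda>w. (simple_integral W t \<Psi> w)\<^sup>2))"
    by (intro nn_integral_eq_integral) auto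
  also have "expectation (\<lambda>w. (simple_integral W t \<Psi> w)\<^sup>2) = (\<Sum>i<n. \<Sum>j<n. expectation (\<lambda>w. X i w * X j w) * ?m i j)"
    unfolding sq using iso by (subst integral_double_sum) (auto simp del: Int_greaterThanAtMost)
  also have "\<dots> = expectation (\<lambda>w. \<Sum>i<n. \<Sum>j<n. (X i w * X j w) * ?m i j)"
    using XX by (subst integral_double_sum) (auto simp del: Int_greaterThanAtMost)
  also have "ennreal \<dots> = (\<integral>\<^sup>+w. ennreal (\<Sum>i<n. \<Sum>j<n. (X i w * X j w) * ?m i j) \<partial>M)"
    using XX simple_energy(2)[of n a A, OF props(1-3)]
    by (intro nn_integral_eq_integral[symmetric] Bochner_Integration.integrable_sum integrable_mult_left AE_I2) auto
  also have "\<dots> = (\<integral>\<^sup>+w. energy t (\<lambda>s y. simple_value \<Psi> s y w) \<partial>M)"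
    unfolding val using simple_energy(1)[of n a A, OF props(1-3)] by simp
  finally show ?thesis .
qed

text \<open>The nested maximum keeps the endpoints ordered when the two intervals do not meet, as
  \<open>is_simple\<close> demands. Raising the left endpoint to at least \<open>s\<close> makes the
  new coefficient, which contains \<open>\<zeta>\<close>, measurable at the start of its
  interval.\<close>

definition restrict_simple :: "real \<Rightarrow> real \<Rightarrow> ('w \<Rightarrow> real) \<Rightarrow> 'w simple_process \<Rightarrow> 'w simple_process" where
  "restrict_simple s r \<zeta> \<Psi> =
     map (\<lambda>(a, b, A, X). (max a s, max (max a s) (min b r), A, \<lambda>w. \<zeta> w * X w)) \<Psi>"

lemma is_simple_restrict:
  assumes \<zeta>: "\<zeta> \<in> borel_measurable (F s)" "\<And>w. \<bar>\<zeta> w\<bar> \<le> 1" and "0 \<le> s" and "is_simple M F \<Psi>"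
  shows "is_simple M F (restrict_simple s r \<zeta> \<Psi>)"
  using assms(4)
proof (induction \<Psi>)
  case (Cons p \<Psi>)
  obtain a b A X where p: "p = (a, b, A, X)" by (cases p) auto
  have 1: "0 \<le> a" "A \<in> sets borel" "A \<subseteq> {0..1}" "X \<in> borel_measurable (F a)"
    using Cons.prems by (auto simp: p is_simple_Cons)
  obtain D where D: "\<forall>w\<in>space M. \<bar>X w\<bar> \<le> D" using Cons.prems by (auto simp: p is_simple_Cons)
  have [measurable]: "\<zeta> \<in> borel_measurable (F (max a s))" "X \<in> borel_measurable (F (max a s))"
    using measurable_F_mono[OF \<zeta>(1), of "max a s"] measurable_F_mono[OF 1(4), of "max a s"] 1 assms(3) by auto
  have "\<bar>\<zeta> w * X w\<bar> \<le> D" if "w \<in> space M" for w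
    using mult_mono[OF \<zeta>(2)[of w] bspec[OF D that]] by (auto simp: abs_mult)
  then show ?case
    using Cons 1 by (auto simp: p is_simple_Cons restrict_simple_def)
qed (simp add: restrict_simple_def)

lemma simple_value_restrict:
  "simple_value (restrict_simple s r \<zeta> \<Psi>) x y w = \<zeta> w * indicator {s<..r} x * simple_value \<Psi> x y w"
proof (induction \<Psi>)
  case (Cons p \<Psi>)
  obtain a b A X where p: "p = (a, b, A, X)" by (cases p) auto
  have "indicator {max a s<..max (max a s) (min b r)} x = (indicator {s<..r} x * indicator {a<..b} x :: real)"
    by (auto simp: indicator_def)
  then show ?case using Cons by (simp add: p restrict_simple_def simple_value_Cons algebra_simps)
qed (simp add: restrict_simple_def)

text \<open>On each cell of a time grid the process is kept or discarded according to the value of \<open>Z\<close> at the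
  left endpoint, so that the result is again simple.\<close>

fun stop_grid :: "real \<Rightarrow> (real \<Rightarrow> 'w \<Rightarrow> bool) \<Rightarrow> 'w simple_process \<Rightarrow> nat \<Rightarrow> 'w simple_process" where
  "stop_grid h Z \<Psi> 0 = []"
| "stop_grid h Z \<Psi> (Suc n) = stop_grid h Z \<Psi> n @
     restrict_simple (real n * h) (real (Suc n) * h) (\<lambda>w. if Z (real n * h) w then 1 else 0) \<Psi>"

lemma is_simple_stop_grid:
  assumes "is_simple M F \<Psi>" "0 \<le> h" "\<And>k. k < n \<Longrightarrow> Measurable.pred (F (real k * h)) (Z (real k * h))"
  shows "is_simple M F (stop_grid h Z \<Psi> n)"
  using assms(3)
proof (induction n)
  case (Suc n)
  have [measurable]: "Measurable.pred (F (real n * h)) (Z (real n * h))" using Suc.prems by simp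
  have "(\<lambda>w. if Z (real n * h) w then 1 else 0 :: real) \<in> borel_measurable (F (real n * h))" by measurable
  then show ?case
    using Suc assms(1,2) by (auto simp: is_simple_append intro!: is_simple_restrict)
qed simp

lemma simple_value_stop_grid:
  "simple_value (stop_grid h Z \<Psi> n) s y w = simple_value \<Psi> s y w *
     (\<Sum>k<n. if real k * h < s \<and> s \<le> real (Suc k) * h \<and> Z (real k * h) w then 1 else 0)"
  by (induction n)
     (auto simp: simple_value_append simple_value_restrict indicator_def algebra_simps)

lemma noise_empty: "AE w in M. W {} w = 0"
  using noise_additive[of "{}" "{}"] by (simp add: noise_sets_def)

lemma simple_integral_restrict:
  "simple_integral W t (restrict_simple s r \<zeta> \<Psi>) w =
     (\<Sum>(a, b, A, X)\<leftarrow>\<Psi>. \<zeta> w * X w * W (({a<..b} \<inter> {..t} \<inter> {s<..r}) \<times> A) w)"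
proof (induction \<Psi>)
  case (Cons p \<Psi>)
  obtain a b A X where p: "p = (a, b, A, X)" by (cases p) auto
  have "{max a s<..max (max a s) (min b r)} \<inter> {..t} = {a<..b} \<inter> {..t} \<inter> {s<..r}" by auto
  then show ?case using Cons by (simp add: p restrict_simple_def simple_integral_Cons)
qed (simp add: restrict_simple_def)

lemma sum_list_AE_cong:
  fixes f g :: "'b \<Rightarrow> 'w \<Rightarrow> real"
  assumes "\<And>p. p \<in> set ps \<Longrightarrow> AE w in M. f p w = g p w"
  shows "AE w in M. (\<Sum>p\<leftarrow>ps. f p w) = (\<Sum>p\<leftarrow>ps. g p w)"
  using assms
proof (induction ps)
  case (Cons p ps)
  have "AE w in M. f p w = g p w" "AE w in M. (\<Sum>p\<leftarrow>ps. f p w) = (\<Sum>p\<leftarrow>ps. g p w)"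
    using Cons by auto
  then show ?case by eventually_elim simp
qed simp

text \<open>When all grid tests succeed, the pieces on consecutive cells recombine by additivity of
  the noise, one cell per induction step; the equality is almost sure because additivity is.\<close>

lemma simple_integral_stop_grid:
  assumes \<Psi>: "is_simple M F \<Psi>" and h: "0 \<le> h"
  shows "AE w in M. (\<forall>k<n. Z (real k * h) w) \<longrightarrow>
     simple_integral W t (stop_grid h Z \<Psi> n) w =
       (\<Sum>(a, b, A, X)\<leftarrow>\<Psi>. X w * W (({a<..b} \<inter> {..t} \<inter> {..real n * h}) \<times> A) w)"
proof (induction n)
  \<comment> \<open>All intervals start at nonnegative times, so nothing remains up to time 0. The
    noise of the empty set is zero only almost surely.\<close>
  case 0
  have "AE w in M. (\<Sum>p\<leftarrow>\<Psi>. (\<lambda>(a, b, A, X) w. X w * W (({a<..b} \<inter> {..t} \<inter> {..0}) \<times> A) w) p w) = (\<Sum>p\<leftarrow>\<Psi>. 0)"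
  proof (rule sum_list_AE_cong)
    fix p assume "p \<in> set \<Psi>"
    then obtain a b A X where p: "p = (a, b, A, X)" "0 \<le> a" using \<Psi> by (auto simp: is_simple_def)
    then have "{a<..b} \<inter> {..t} \<inter> {..0} = {}" by auto
    then show "AE w in M. (\<lambda>(a, b, A, X) w. X w * W (({a<..b} \<inter> {..t} \<inter> {..0}) \<times> A) w) p w = 0"
      using noise_empty by (auto simp: p elim!: eventually_mono)
  qed
  then show ?case by eventually_elim (simp add: case_prod_unfold)
next
  case (Suc n)
  let ?f = "\<lambda>S (a, b, A, X) w. X w * W (({a<..b} \<inter> {..t} \<inter> S) \<times> A) w"
  have "AE w in M. (\<Sum>p\<leftarrow>\<Psi>. ?f {..real (Suc n) * h} p w)
      = (\<Sum>p\<leftarrow>\<Psi>. ?f {..real n * h} p w + ?f {real n * h<..real (Suc n) * h} p w)"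
  proof (rule sum_list_AE_cong)
    fix p assume "p \<in> set \<Psi>"
    then obtain a b A X where p: "p = (a, b, A, X)" "0 \<le> a" "A \<in> sets borel" "A \<subseteq> {0..1}"
      using \<Psi> by (auto simp: is_simple_def)
    have le: "real n * h \<le> real (Suc n) * h" using h by (intro mult_right_mono) auto
    let ?l = "({a<..b} \<inter> {..t} \<inter> {..real n * h}) \<times> A"
    let ?r = "({a<..b} \<inter> {..t} \<inter> {real n * h<..real (Suc n) * h}) \<times> A"
    have "?l = {a<..min (min b t) (real n * h)} \<times> A" by auto
    moreover have "?r = {max a (real n * h)<..min (min b t) (real (Suc n) * h)} \<times> A" by auto
    ultimately have "?l \<in> noise_sets" "?r \<in> noise_sets"
      using p by (auto intro!: rectangle_noise_set)
    moreover have "?l \<inter> ?r = {}" by auto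
    moreover have "?l \<union> ?r = ({a<..b} \<inter> {..t} \<inter> {..real (Suc n) * h}) \<times> A" using le by auto
    ultimately have "AE w in M. W (({a<..b} \<inter> {..t} \<inter> {..real (Suc n) * h}) \<times> A) w = W ?l w + W ?r w"
      using noise_additive[of ?l ?r] by simp
    then show "AE w in M. ?f {..real (Suc n) * h} p w = ?f {..real n * h} p w + ?f {real n * h<..real (Suc n) * h} p w"
      by eventually_elim (simp add: p algebra_simps)
  qed
  with Suc show ?case
  proof eventually_elim
    case (elim w)
    show ?case
    proof
      assume Z: "\<forall>k<Suc n. Z (real k * h) w"
      have "simple_integral W t (stop_grid h Z \<Psi> (Suc n)) w
          = (\<Sum>p\<leftarrow>\<Psi>. ?f {..real n * h} p w) + (\<Sum>p\<leftarrow>\<Psi>. ?f {real n * h<..real (Suc n) * h} p w)"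
        using elim(1) Z by (simp add: simple_integral_append simple_integral_restrict case_prod_unfold)
      also have "\<dots> = (\<Sum>p\<leftarrow>\<Psi>. ?f {..real n * h} p w + ?f {real n * h<..real (Suc n) * h} p w)"
        by (rule sum_list_addf[symmetric])
      also have "\<dots> = (\<Sum>p\<leftarrow>\<Psi>. ?f {..real (Suc n) * h} p w)" using elim(2) by simp
      finally show "simple_integral W t (stop_grid h Z \<Psi> (Suc n)) w =
         (\<Sum>(a, b, A, X)\<leftarrow>\<Psi>. X w * W (({a<..b} \<inter> {..t} \<inter> {..real (Suc n) * h}) \<times> A) w)"
        by (simp add: case_prod_unfold)
    qed
  qed
qed

end

section \<open>The second moment bound for stopped simple processes\<close>

lemma grid_sum:
  fixes h s :: real
  assumes "0 < h" "0 < s" "s \<le> real m * h"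
  obtains k where "k < m" "real k * h < s" "s \<le> real (Suc k) * h"
    "\<And>P. (\<Sum>j<m. if real j * h < s \<and> s \<le> real (Suc j) * h \<and> P j then 1 else 0 :: real) = (if P k then 1 else 0)"
proof -
  have "m > 0" using assms by (cases m) auto
  then have "Suc (m - 1) = m" by simp
  then have last: "s \<le> real (Suc (m - 1)) * h" using assms(3) by (simp only:)
  \<comment> \<open>The cells are open on the left and closed on the right, so the first right
    endpoint that is not before \<open>s\<close> marks the only cell containing
    \<open>s\<close>.\<close>
  define k where "k = (LEAST j. s \<le> real (Suc j) * h)"
  have k: "s \<le> real (Suc k) * h" unfolding k_def by (rule LeastI[of "\<lambda>j. s \<le> real (Suc j) * h", OF last])
  have "k \<le> m - 1" unfolding k_def by (rule Least_le) (rule last)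
  then have km: "k < m" using \<open>m > 0\<close> by simp
  have kh: "real k * h < s"
  proof (cases k)
    case (Suc j)
    then have "\<not> s \<le> real (Suc j) * h"
      using not_less_Least[of j "\<lambda>j. s \<le> real (Suc j) * h"] by (simp add: k_def)
    then show ?thesis using Suc by simp
  qed (use assms in simp)
  have uniq: "j = k" if "real j * h < s" "s \<le> real (Suc j) * h" for j
  proof -
    have "real j * h < real (Suc k) * h" by (rule less_le_trans[OF that(1) k])
    then have "real j < real (Suc k)" by (rule mult_right_less_imp_less) (use assms in simp)
    then have 1: "j < Suc k" by (rule of_nat_less_imp_less)
    have "real k * h < real (Suc j) * h" by (rule less_le_trans[OF kh that(2)])
    then have "real k < real (Suc j)" by (rule mult_right_less_imp_less) (use assms in simp)
    then have "k < Suc j" by (rule of_nat_less_imp_less)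
    with 1 show ?thesis by linarith
  qed
  have "(\<Sum>j<m. if real j * h < s \<and> s \<le> real (Suc j) * h \<and> P j then 1 else 0 :: real) = (if P k then 1 else 0)" for P
  proof -
    have "(\<Sum>j<m. if real j * h < s \<and> s \<le> real (Suc j) * h \<and> P j then 1 else 0 :: real)
        = (\<Sum>j<m. if j = k then (if P k then 1 else 0) else 0)"
    proof (intro sum.cong refl)
      fix j
      have "(real j * h < s \<and> s \<le> real (Suc j) * h) = (j = k)"
        using k kh uniq by blast
      then show "(if real j * h < s \<and> s \<le> real (Suc j) * h \<and> P j then 1 else 0 :: real)
          = (if j = k then (if P k then 1 else 0) else 0)"
        by (cases "j = k") (simp_all only: conj_assoc[symmetric] simp_thms if_True if_False)
    qed
    then show ?thesis using km by (simp only: sum.delta finite_lessThan lessThan_iff if_True)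
  qed
  then show ?thesis using that km kh k by blast
qed

lemma sigma_finite_unit_lborel: "sigma_finite_measure unit_lborel"
  using finite_measure_unit_lborel by (simp add: finite_measure_def)

text \<open>Time and space range over the whole line. A process given on a rectangle is extended by
  zero, which keeps restricted sigma-algebras out of the arguments with products.\<close>

abbreviation jointly_measurable :: "'w measure \<Rightarrow> (real \<Rightarrow> real \<Rightarrow> 'w \<Rightarrow> real) \<Rightarrow> bool" where
  "jointly_measurable M f \<equiv> (\<lambda>(s, y, w). f s y w) \<in> borel_measurable (borel \<Otimes>\<^sub>M (borel \<Otimes>\<^sub>M M))"

lemma measurable_triple_compose:
  assumes "jointly_measurable M G"
    and "f \<in> borel_measurable N" "g \<in> borel_measurable N" "h \<in> measurable N M"
  shows "(\<lambda>z. G (f z) (g z) (h z)) \<in> borel_measurable N"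
  using measurable_compose[OF measurable_Pair[OF assms(2) measurable_Pair[OF assms(3,4)]] assms(1)] by simp

lemma measurable_square_integral_unit:
  assumes G: "jointly_measurable M G"
    and "f \<in> borel_measurable N" "h \<in> measurable N M"
  shows "(\<lambda>z. \<integral>\<^sup>+y. ennreal ((G (f z) y (h z))\<^sup>2) \<partial>unit_lborel) \<in> borel_measurable N"
proof -
  interpret U: sigma_finite_measure unit_lborel by (rule sigma_finite_unit_lborel)
  have [measurable]: "(\<lambda>x. G (f (fst x)) (snd x) (h (fst x))) \<in> borel_measurable (N \<Otimes>\<^sub>M unit_lborel)"
    by (rule measurable_triple_compose[OF G measurable_compose[OF measurable_fst assms(2)]
        measurable_compose[OF measurable_snd measurable_ident_restrict_borel(2)]
        measurable_compose[OF measurable_fst assms(3)]])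
  show ?thesis
    by (rule U.borel_measurable_nn_integral) (simp add: case_prod_unfold)
qed

text \<open>\<open>Z s\<close> stands for the event \<open>s \<le> \<tau>\<close> of a stopping time \<open>\<tau>\<close>.\<close>

definition stop_time :: "'w measure \<Rightarrow> (real \<Rightarrow> 'w measure) \<Rightarrow> real \<Rightarrow> (real \<Rightarrow> 'w \<Rightarrow> bool) \<Rightarrow> bool" where
  "stop_time M F t Z \<longleftrightarrow>
     (\<forall>s\<in>{0..t}. Measurable.pred (F s) (Z s)) \<and>
     Measurable.pred (borel \<Otimes>\<^sub>M M) (\<lambda>(s, w). Z s w) \<and>
     (\<forall>r s w. 0 \<le> r \<longrightarrow> r \<le> s \<longrightarrow> s \<le> t \<longrightarrow> Z s w \<longrightarrow> Z r w) \<and>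
     (\<forall>s w. 0 < s \<longrightarrow> s \<le> t \<longrightarrow> (\<forall>r. 0 \<le> r \<longrightarrow> r < s \<longrightarrow> Z r w) \<longrightarrow> Z s w)"

context space_time_white_noise
begin

lemma measurable_simple_value_triple:
  assumes "is_simple M F \<Psi>"
  shows "jointly_measurable M (\<lambda>s y w. simple_value \<Psi> s y w)"
  unfolding case_prod_unfold by (rule measurable_simple_value[OF assms]) measurable

text \<open>The isometry for the grid-stopped process, followed by refinement of the grid. On the
  event \<open>Z t\<close> the stopped and the full integral agree, so no integral up to a random
  time has to be formed.\<close>

lemma stopped_simple_bound:
  assumes \<Psi>: "is_simple M F \<Psi>" and t: "0 \<le> t" and Z: "stop_time M F t Z"
  shows "(\<integral>\<^sup>+w. (if Z t w then ennreal ((simple_integral W t \<Psi> w)\<^sup>2) else 0) \<partial>M)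
     \<le> (\<integral>\<^sup>+w. (\<integral>\<^sup>+s. (if Z s w then \<integral>\<^sup>+y. ennreal ((simple_value \<Psi> s y w)\<^sup>2) \<partial>unit_lborel else 0) *
          indicator {0..t} s \<partial>lborel) \<partial>M)"
proof -
  have Zad: "\<And>s. s \<in> {0..t} \<Longrightarrow> Measurable.pred (F s) (Z s)"
    and Zj: "Measurable.pred (borel \<Otimes>\<^sub>M M) (\<lambda>(s, w). Z s w)"
    and Zdec: "\<And>r s w. 0 \<le> r \<Longrightarrow> r \<le> s \<Longrightarrow> s \<le> t \<Longrightarrow> Z s w \<Longrightarrow> Z r w"
    and Zleft: "\<And>s w. 0 < s \<Longrightarrow> s \<le> t \<Longrightarrow> (\<And>r. 0 \<le> r \<Longrightarrow> r < s \<Longrightarrow> Z r w) \<Longrightarrow> Z s w"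
    using Z unfolding stop_time_def by blast+
  define e where "e s w = (\<integral>\<^sup>+y. ennreal ((simple_value \<Psi> s y w)\<^sup>2) \<partial>unit_lborel)" for s w
  have e_meas: "(\<lambda>(s, w). e s w) \<in> borel_measurable (borel \<Otimes>\<^sub>M M)"
    unfolding e_def case_prod_unfold by (rule measurable_square_integral_unit[OF measurable_simple_value_triple[OF \<Psi>]]) measurable
  define h where "h m = t / real (Suc m)" for m
  have h: "h m \<ge> 0" "real (Suc m) * h m = t" for m using t by (auto simp: h_def)
  have kh: "real k * h m \<in> {0..t}" if "k < Suc m" for k m
  proof -
    have "real k * h m \<le> real (Suc m) * h m" using that h by (intro mult_right_mono) auto
    then show ?thesis using h[of m] by simp
  qed
  \<comment> \<open>The grid version of the indicator of \<open>Z\<close>: its value at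
    \<open>s\<close> is decided at the left endpoint of the cell of \<open>s\<close>, hence by
    information available when the cell begins.\<close>
  define c where "c m s w = (\<Sum>k<Suc m. if real k * h m < s \<and> s \<le> real (Suc k) * h m \<and> Z (real k * h m) w then 1 else 0 :: real)"
    for m s w
  have c_meas: "(\<lambda>(s, w). c m s w) \<in> borel_measurable (borel \<Otimes>\<^sub>M M)" for m
  proof -
    have gen: "(\<lambda>x. if a < fst x \<and> fst x \<le> b \<and> P (snd x) then 1 else 0 :: real) \<in> borel_measurable (borel \<Otimes>\<^sub>M M)"
      if [measurable]: "Measurable.pred M P" for a b :: real and P
      by measurable
    show ?thesis
      unfolding c_def case_prod_unfold
    proof (rule borel_measurable_sum)
      fix k assume "k \<in> {..<Suc m}"
      then have k: "k < Suc m" by simp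
      have "0 \<le> real k * h m" using kh[OF k] by simp
      then show "(\<lambda>x. if real k * h m < fst x \<and> fst x \<le> real (Suc k) * h m \<and> Z (real k * h m) (snd x) then 1 else 0 :: real)
          \<in> borel_measurable (borel \<Otimes>\<^sub>M M)"
        by (intro gen measurable_F_M[OF Zad[OF kh[OF k]]])
    qed
  qed
  have c_val: "\<exists>k. real k * h m < s \<and> s \<le> real (Suc k) * h m \<and> c m s w = (if Z (real k * h m) w then 1 else 0)"
    if s: "0 < s" "s \<le> t" for m s w
  proof -
    have hpos: "0 < h m" using s by (simp add: h_def)
    have sm: "s \<le> real (Suc m) * h m" using s(2) h(2)[of m] by simp
    obtain k where k: "real k * h m < s" "s \<le> real (Suc k) * h m"
      "\<And>P. (\<Sum>j<Suc m. if real j * h m < s \<and> s \<le> real (Suc j) * h m \<and> P j then 1 else 0 :: real) = (if P k then 1 else 0)"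
      by (rule grid_sum[OF hpos s(1) sm]) blast
    have "c m s w = (if Z (real k * h m) w then 1 else 0)" unfolding c_def by (rule k(3))
    with k(1,2) show ?thesis by blast
  qed
  have c_eq: "c m s w = 0 \<or> c m s w = 1" if "s \<in> {0..t}" for m s w
  proof (cases "s = 0")
    case True
    have "c m 0 w = 0" unfolding c_def
      using h(1)[of m] by (intro sum.neutral) (auto simp: not_less)
    then show ?thesis using True by simp
  next
    case False
    then have "0 < s" "s \<le> t" using that by auto
    then obtain k where "c m s w = (if Z (real k * h m) w then 1 else 0)"
      using c_val by blast
    then show ?thesis by simp
  qed
  \<comment> \<open>The deciding grid point approaches \<open>s\<close> from below. If
    \<open>Z s\<close> holds, monotonicity gives \<open>Z\<close> at every earlier grid point. If it
    fails, the left-closure clause of \<open>stop_time\<close> yields a failure at some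
    \<open>r < s\<close>, and once the mesh is below \<open>s - r\<close> the grid point lies beyond
    \<open>r\<close>.\<close>
  have c_lim: "(\<lambda>m. c m s w) \<longlonglongrightarrow> (if Z s w then 1 else 0)" if s: "0 < s" "s \<le> t" for s w
  proof (rule tendsto_eventually)
    show "\<forall>\<^sub>F m in sequentially. c m s w = (if Z s w then 1 else 0)"
    proof (cases "Z s w")
      case True
      have "c m s w = 1" for m
      proof -
        obtain k where "c m s w = (if Z (real k * h m) w then 1 else 0)" "real k * h m < s"
          using c_val[OF s] by blast
        moreover have "real k * h m \<ge> 0" using h by auto
        ultimately show ?thesis using Zdec[OF _ _ s(2) True, of "real k * h m"] by auto
      qed
      then show ?thesis using True by simp
    next
      case False
      then obtain r where r: "0 \<le> r" "r < s" "\<not> Z r w" using Zleft[OF s] by blast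
      have "h \<longlonglongrightarrow> 0" unfolding h_def
        by (rule LIMSEQ_Suc) (rule lim_const_over_n)
      then have "\<forall>\<^sub>F m in sequentially. h m < s - r" using r by (intro order_tendstoD) auto
      then show ?thesis
      proof eventually_elim
        case (elim m)
        obtain k where k: "c m s w = (if Z (real k * h m) w then 1 else 0)" "real k * h m < s"
            "s \<le> real (Suc k) * h m"
          using c_val[OF s] by blast
        have "r \<le> real k * h m" using elim k(3) by (simp add: algebra_simps)
        then have "\<not> Z (real k * h m) w"
          using Zdec[of r "real k * h m" w] r k s by auto
        then show ?case using k False by simp
      qed
    qed
  qed
  \<comment> \<open>Boundedness of the simple process supplies a constant majorant for both limits,
    first in time along each path and then in expectation.\<close>
  obtain C where C: "C \<ge> 0" "\<forall>w\<in>space M. \<forall>s y. \<bar>simple_value \<Psi> s y w\<bar> \<le> C"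
    using simple_value_bounded[OF \<Psi>] by auto
  have e_le: "e s w \<le> ennreal (C\<^sup>2)" if "w \<in> space M" for s w
  proof -
    have "e s w \<le> (\<integral>\<^sup>+y. ennreal (C\<^sup>2) \<partial>unit_lborel)"
      unfolding e_def using C that
      by (intro nn_integral_mono ennreal_leI) (metis abs_ge_zero power2_abs power_mono)
    then show ?thesis by (simp add: emeasure_restrict_space)
  qed
  have fin_t: "(\<integral>\<^sup>+s. ennreal (C\<^sup>2) * indicator {0..t} s \<partial>(lborel::real measure)) < \<infinity>"
    using t by (simp add: nn_integral_cmult ennreal_mult_less_top)
  let ?L = "\<lambda>m w. \<integral>\<^sup>+s. (e s w * ennreal ((c m s w)\<^sup>2)) * indicator {0..t} s \<partial>lborel"
  let ?B = "\<lambda>w. \<integral>\<^sup>+s. (if Z s w then e s w else 0) * indicator {0..t} s \<partial>lborel"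
  have dom: "(e s w * ennreal ((c m s w)\<^sup>2)) * indicator {0..t} s \<le> ennreal (C\<^sup>2) * indicator {0..t} s"
    if "w \<in> space M" for s w m
    using e_le[OF that, of s] c_eq[of s m w] by (cases "s \<in> {0..t}") auto
  have inner: "(\<lambda>m. ?L m w) \<longlonglongrightarrow> ?B w" if w: "w \<in> space M" for w
  proof (rule nn_integral_dominated_convergence[where w = "\<lambda>s. ennreal (C\<^sup>2) * indicator {0..t} s"])
    have [measurable]: "(\<lambda>s. e s w) \<in> borel_measurable borel" "(\<lambda>s. c m s w) \<in> borel_measurable borel"
        "Measurable.pred borel (\<lambda>s. Z s w)" for m
      using measurable_Pair1[OF e_meas w] measurable_Pair1[OF c_meas w] measurable_Pair1[OF Zj w] by simp_all
    show "(\<lambda>s. (e s w * ennreal ((c m s w)\<^sup>2)) * indicator {0..t} s) \<in> borel_measurable lborel" for m by measurable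
    show "(\<lambda>s. (if Z s w then e s w else 0) * indicator {0..t} s) \<in> borel_measurable lborel" by measurable
    show "(\<lambda>s. ennreal (C\<^sup>2) * indicator {0..t} s) \<in> borel_measurable lborel" by measurable
    show "(\<integral>\<^sup>+s. ennreal (C\<^sup>2) * indicator {0..t} s \<partial>lborel) < \<infinity>" by (rule fin_t)
    show "AE s in lborel. (e s w * ennreal ((c m s w)\<^sup>2)) * indicator {0..t} s \<le> ennreal (C\<^sup>2) * indicator {0..t} s" for m
      using dom[OF w] by simp
    show "AE s in lborel. (\<lambda>m. (e s w * ennreal ((c m s w)\<^sup>2)) * indicator {0..t} s)
        \<longlonglongrightarrow> (if Z s w then e s w else 0) * indicator {0..t} s"
      using AE_lborel_singleton[of 0]
    proof eventually_elim
      case (elim s)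
      show ?case
      proof (cases "s \<in> {0..t}")
        case True
        then have "(\<lambda>m. ennreal ((c m s w)\<^sup>2)) \<longlonglongrightarrow> ennreal ((if Z s w then 1 else 0)\<^sup>2)"
          using c_lim[of s w] elim by (intro tendsto_ennrealI tendsto_power) auto
        moreover have "e s w < top" using e_le[OF w, of s] by (simp add: order_le_less_trans)
        ultimately have "(\<lambda>m. e s w * ennreal ((c m s w)\<^sup>2)) \<longlonglongrightarrow> e s w * ennreal ((if Z s w then 1 else 0)\<^sup>2)"
          by (intro ennreal_tendsto_cmult)
        then show ?thesis using True by (cases "Z s w") simp_all
      qed simp
    qed
  qed
  have outer: "(\<lambda>m. \<integral>\<^sup>+w. ?L m w \<partial>M) \<longlonglongrightarrow> (\<integral>\<^sup>+w. ?B w \<partial>M)"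
  proof (rule nn_integral_dominated_convergence[where w = "\<lambda>w. \<integral>\<^sup>+s. ennreal (C\<^sup>2) * indicator {0..t} s \<partial>lborel"])
    show "AE w in M. ?L m w \<le> (\<integral>\<^sup>+s. ennreal (C\<^sup>2) * indicator {0..t} s \<partial>lborel)" for m
      using dom by (intro AE_I2 nn_integral_mono)
    show "AE w in M. (\<lambda>m. ?L m w) \<longlonglongrightarrow> ?B w" using inner by auto
    show "(\<integral>\<^sup>+w. (\<integral>\<^sup>+s. ennreal (C\<^sup>2) * indicator {0..t} s \<partial>(lborel::real measure)) \<partial>M) < \<infinity>"
      using fin_t by (simp add: emeasure_space_1)
    have [measurable]: "(\<lambda>x. e (snd x) (fst x)) \<in> borel_measurable (M \<Otimes>\<^sub>M lborel)"
        "(\<lambda>x. c m (snd x) (fst x)) \<in> borel_measurable (M \<Otimes>\<^sub>M lborel)"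
        "Measurable.pred (M \<Otimes>\<^sub>M lborel) (\<lambda>x. Z (snd x) (fst x))" for m
      using measurable_compose[OF _ e_meas, of "\<lambda>x. (snd x, fst x)" "M \<Otimes>\<^sub>M lborel"]
        measurable_compose[OF _ c_meas, of "\<lambda>x. (snd x, fst x)" "M \<Otimes>\<^sub>M lborel"]
        measurable_compose[OF _ Zj, of "\<lambda>x. (snd x, fst x)" "M \<Otimes>\<^sub>M lborel"] by auto
    show "(\<lambda>w. ?L m w) \<in> borel_measurable M" for m
      by (rule lborel.borel_measurable_nn_integral) (simp add: case_prod_unfold)
    show "(\<lambda>w. ?B w) \<in> borel_measurable M"
      by (rule lborel.borel_measurable_nn_integral) (simp add: case_prod_unfold)
  qed auto
  \<comment> \<open>Monotonicity of \<open>Z\<close> makes all grid tests succeed on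
    \<open>Z t\<close>. Outside this event the square of the stopped integral is dropped, so only an
    inequality results.\<close>
  have step: "(\<integral>\<^sup>+w. (if Z t w then ennreal ((simple_integral W t \<Psi> w)\<^sup>2) else 0) \<partial>M) \<le> (\<integral>\<^sup>+w. ?L m w \<partial>M)" for m
  proof -
    let ?S = "stop_grid (h m) Z \<Psi> (Suc m)"
    have S: "is_simple M F ?S"
      by (rule is_simple_stop_grid[OF \<Psi> h(1)]) (rule Zad[OF kh])
    have "AE w in M. (\<forall>k<Suc m. Z (real k * h m) w) \<longrightarrow>
       simple_integral W t ?S w = (\<Sum>(a, b, A, X)\<leftarrow>\<Psi>. X w * W (({a<..b} \<inter> {..t} \<inter> {..real (Suc m) * h m}) \<times> A) w)"
      by (rule simple_integral_stop_grid[OF \<Psi> h(1)])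
    then have "AE w in M. (if Z t w then ennreal ((simple_integral W t \<Psi> w)\<^sup>2) else 0) \<le> ennreal ((simple_integral W t ?S w)\<^sup>2)"
    proof eventually_elim
      case (elim w)
      show ?case
      proof (cases "Z t w")
        case True
        have "Z (real k * h m) w" if "k < Suc m" for k
          using Zdec[of "real k * h m" t w] kh[OF that] True t by auto
        then have "simple_integral W t ?S w = simple_integral W t \<Psi> w"
          using elim unfolding h(2) by (simp add: simple_integral_def Int_assoc)
        then show ?thesis by simp
      qed simp
    qed
    then have "(\<integral>\<^sup>+w. (if Z t w then ennreal ((simple_integral W t \<Psi> w)\<^sup>2) else 0) \<partial>M)
        \<le> (\<integral>\<^sup>+w. ennreal ((simple_integral W t ?S w)\<^sup>2) \<partial>M)"
      by (rule nn_integral_mono_AE)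
    also have "\<dots> = (\<integral>\<^sup>+w. energy t (\<lambda>s y. simple_value ?S s y w) \<partial>M)" by (rule simple_isometry[OF S])
    also have "\<dots> = (\<integral>\<^sup>+w. ?L m w \<partial>M)"
    proof (intro nn_integral_cong)
      fix w assume w: "w \<in> space M"
      have "(\<integral>\<^sup>+y. ennreal ((simple_value ?S s y w)\<^sup>2) \<partial>unit_lborel) = e s w * ennreal ((c m s w)\<^sup>2)" for s
      proof -
        have [measurable]: "(\<lambda>y. simple_value \<Psi> s y w) \<in> borel_measurable unit_lborel"
          using w by (intro measurable_simple_value[OF \<Psi>]) auto
        have "(\<integral>\<^sup>+y. ennreal ((simple_value ?S s y w)\<^sup>2) \<partial>unit_lborel)
            = (\<integral>\<^sup>+y. ennreal ((simple_value \<Psi> s y w)\<^sup>2) * ennreal ((c m s w)\<^sup>2) \<partial>unit_lborel)"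
          unfolding simple_value_stop_grid c_def[symmetric]
          by (simp add: power_mult_distrib ennreal_mult')
        also have "\<dots> = e s w * ennreal ((c m s w)\<^sup>2)"
          unfolding e_def by (rule nn_integral_multc) measurable
        finally show ?thesis .
      qed
      then show "energy t (\<lambda>s y. simple_value ?S s y w) = ?L m w" unfolding energy_def by simp
    qed
    finally show ?thesis .
  qed
  have "(\<integral>\<^sup>+w. (if Z t w then ennreal ((simple_integral W t \<Psi> w)\<^sup>2) else 0) \<partial>M) \<le> (\<integral>\<^sup>+w. ?B w \<partial>M)"
    by (rule LIMSEQ_le_const[OF outer]) (use step in blast)
  then show ?thesis unfolding e_def .
qed

end

section \<open>Localisation of the Walsh integral\<close>

definition stopped_energy :: "real \<Rightarrow> (real \<Rightarrow> bool) \<Rightarrow> (real \<Rightarrow> real \<Rightarrow> real) \<Rightarrow> ennreal" where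
  "stopped_energy t z \<phi> =
     (\<integral>\<^sup>+s. (if z s then \<integral>\<^sup>+y. ennreal ((\<phi> s y)\<^sup>2) \<partial>unit_lborel else 0) * indicator {0..t} s \<partial>lborel)"

lemma measurable_stopped_energy:
  assumes G: "jointly_measurable M G"
    and Z: "Measurable.pred (borel \<Otimes>\<^sub>M M) (\<lambda>(s, w). Z s w)"
  shows "(\<lambda>w. stopped_energy t (\<lambda>s. Z s w) (\<lambda>s y. G s y w)) \<in> borel_measurable M"
  unfolding stopped_energy_def
proof (rule lborel.borel_measurable_nn_integral)
  have [measurable]: "Measurable.pred (M \<Otimes>\<^sub>M lborel) (\<lambda>x. Z (snd x) (fst x))"
    using measurable_compose[OF _ Z, of "\<lambda>x. (snd x, fst x)" "M \<Otimes>\<^sub>M lborel"] by simp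
  have [measurable]: "(\<lambda>x. \<integral>\<^sup>+y. ennreal ((G (snd x) y (fst x))\<^sup>2) \<partial>unit_lborel) \<in> borel_measurable (M \<Otimes>\<^sub>M lborel)"
    by (rule measurable_square_integral_unit[OF G]) measurable
  show "(\<lambda>(w, s). (if Z s w then \<integral>\<^sup>+y. ennreal ((G s y w)\<^sup>2) \<partial>unit_lborel else 0) * indicator {0..t} s)
     \<in> borel_measurable (M \<Otimes>\<^sub>M lborel)"
    unfolding case_prod_unfold by measurable
qed

lemma measurable_energy:
  assumes G: "jointly_measurable M G"
  shows "(\<lambda>w. energy t (\<lambda>s y. G s y w)) \<in> borel_measurable M"
  using measurable_stopped_energy[OF G, of "\<lambda>_ _. True"] by (simp add: stopped_energy_def energy_def)

text \<open>Young's inequality with a free parameter: \<open>d = 1\<close> gives crude bounds, while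
  letting \<open>d\<close> tend to zero recovers the sharp constant one where it is wanted.\<close>

lemma square_split:
  fixes a b d :: real
  assumes "d > 0"
  shows "a\<^sup>2 \<le> (1 + d) * b\<^sup>2 + (1 + 1 / d) * (a - b)\<^sup>2"
proof -
  have "0 \<le> (d * b - (a - b))\<^sup>2 / d" using assms by simp
  also have "\<dots> = (1 + d) * b\<^sup>2 + (1 + 1 / d) * (a - b)\<^sup>2 - a\<^sup>2"
    using assms by (simp add: power2_eq_square field_simps)
  finally show ?thesis by simp
qed

text \<open>Only the energy of \<open>g\<close> remains stopped. The difference is measured on all
  of \<open>[0,t]\<close>, which is how the approximation of a Walsh integrand is
  controlled.\<close>

lemma stopped_energy_split:
  assumes f: "(\<lambda>(s, y). f s y) \<in> borel_measurable (borel \<Otimes>\<^sub>M borel)"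
    and g: "(\<lambda>(s, y). g s y) \<in> borel_measurable (borel \<Otimes>\<^sub>M borel)"
    and [measurable]: "Measurable.pred borel z" and d: "d > 0"
  shows "stopped_energy t z f \<le> ennreal (1 + d) * stopped_energy t z g + ennreal (1 + 1 / d) * energy t (\<lambda>s y. f s y - g s y)"
proof -
  interpret U: sigma_finite_measure unit_lborel by (rule sigma_finite_unit_lborel)
  let ?I = "\<lambda>h s. \<integral>\<^sup>+y. ennreal ((h s y)\<^sup>2) \<partial>unit_lborel"
  have sec: "(\<lambda>y. h s y) \<in> borel_measurable unit_lborel"
    if h: "(\<lambda>(s, y). h s y) \<in> borel_measurable (borel \<Otimes>\<^sub>M borel)" for h :: "real \<Rightarrow> real \<Rightarrow> real" and s
    using measurable_compose[OF measurable_Pair[OF measurable_const measurable_ident_restrict_borel(2)] h, of s] by simp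
  have meas: "?I h \<in> borel_measurable lborel"
    if h: "(\<lambda>(s, y). h s y) \<in> borel_measurable (borel \<Otimes>\<^sub>M borel)" for h
  proof (rule U.borel_measurable_nn_integral)
    have "(\<lambda>x. h (fst x) (snd x)) \<in> borel_measurable (lborel \<Otimes>\<^sub>M unit_lborel)"
      using measurable_compose[OF measurable_Pair[OF _ measurable_compose[OF measurable_snd measurable_ident_restrict_borel(2)]] h,
        of fst "lborel" "{0..1}"] by simp
    then show "(\<lambda>(s, y). ennreal ((h s y)\<^sup>2)) \<in> borel_measurable (lborel \<Otimes>\<^sub>M unit_lborel)"
      unfolding case_prod_unfold by measurable
  qed
  have fg: "(\<lambda>(s, y). f s y - g s y) \<in> borel_measurable (borel \<Otimes>\<^sub>M borel)"
    using borel_measurable_diff[OF f g] by (simp add: case_prod_unfold)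
  note [measurable] = sec[OF f] sec[OF g] sec[OF fg] meas[OF f] meas[OF g] meas[OF fg]
  have pt: "?I f s \<le> ennreal (1 + d) * ?I g s + ennreal (1 + 1 / d) * ?I (\<lambda>s y. f s y - g s y) s" for s
  proof -
    have "?I f s \<le> (\<integral>\<^sup>+y. ennreal (1 + d) * ennreal ((g s y)\<^sup>2) + ennreal (1 + 1 / d) * ennreal ((f s y - g s y)\<^sup>2) \<partial>unit_lborel)"
    proof (intro nn_integral_mono)
      fix y
      have "ennreal ((f s y)\<^sup>2) \<le> ennreal ((1 + d) * (g s y)\<^sup>2 + (1 + 1 / d) * (f s y - g s y)\<^sup>2)"
        by (intro ennreal_leI square_split d)
      also have "\<dots> = ennreal (1 + d) * ennreal ((g s y)\<^sup>2) + ennreal (1 + 1 / d) * ennreal ((f s y - g s y)\<^sup>2)"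
        using d by (subst ennreal_plus) (simp_all add: ennreal_mult'')
      finally show "ennreal ((f s y)\<^sup>2) \<le> ennreal (1 + d) * ennreal ((g s y)\<^sup>2) + ennreal (1 + 1 / d) * ennreal ((f s y - g s y)\<^sup>2)" .
    qed
    also have "\<dots> = ennreal (1 + d) * ?I g s + ennreal (1 + 1 / d) * ?I (\<lambda>s y. f s y - g s y) s"
      by (subst nn_integral_add) (auto simp: nn_integral_cmult)
    finally show ?thesis .
  qed
  have "stopped_energy t z f \<le> (\<integral>\<^sup>+s. ennreal (1 + d) * ((if z s then ?I g s else 0) * indicator {0..t} s)
      + ennreal (1 + 1 / d) * (?I (\<lambda>s y. f s y - g s y) s * indicator {0..t} s) \<partial>lborel)"
    unfolding stopped_energy_def using pt by (intro nn_integral_mono) (auto simp: indicator_def)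
  also have "\<dots> = ennreal (1 + d) * stopped_energy t z g + ennreal (1 + 1 / d) * energy t (\<lambda>s y. f s y - g s y)"
    unfolding stopped_energy_def energy_def
    by (subst nn_integral_add) (auto simp: nn_integral_cmult)
  finally show ?thesis .
qed

text \<open>Fatou's lemma along times increasing to \<open>s\<close>. It provides the left-closure
  clause of \<open>stop_time\<close> for levels of a running integral.\<close>

lemma running_integral_left_continuous:
  fixes e :: "real \<Rightarrow> ennreal"
  assumes [measurable]: "e \<in> borel_measurable borel" and s: "0 < s"
    and le: "\<And>r. 0 \<le> r \<Longrightarrow> r < s \<Longrightarrow> (\<integral>\<^sup>+x. e x * indicator {0..<r} x \<partial>lborel) \<le> K"
  shows "(\<integral>\<^sup>+x. e x * indicator {0..<s} x \<partial>lborel) \<le> K"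
proof -
  let ?r = "\<lambda>i. s - inverse (real (Suc i))"
  have "e x * indicator {0..<s} x \<le> liminf (\<lambda>i. e x * indicator {0..<?r i} x)" for x
  proof (cases "x < s")
    case True
    have "(\<lambda>i. inverse (real (Suc i))) \<longlonglongrightarrow> 0" by (rule LIMSEQ_inverse_real_of_nat)
    then have "\<forall>\<^sub>F i in sequentially. inverse (real (Suc i)) < s - x"
      using True by (intro order_tendstoD) auto
    then have "\<forall>\<^sub>F i in sequentially. e x * indicator {0..<s} x \<le> e x * indicator {0..<?r i} x"
      by eventually_elim (use True in \<open>auto simp: indicator_def\<close>)
    then show ?thesis by (intro Liminf_bounded)
  qed simp
  then have "(\<integral>\<^sup>+x. e x * indicator {0..<s} x \<partial>lborel) \<le> (\<integral>\<^sup>+x. liminf (\<lambda>i. e x * indicator {0..<?r i} x) \<partial>lborel)"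
    by (intro nn_integral_mono)
  also have "\<dots> \<le> liminf (\<lambda>i. \<integral>\<^sup>+x. e x * indicator {0..<?r i} x \<partial>lborel)"
    by (rule nn_integral_liminf) measurable
  also have "\<dots> \<le> K"
  proof (rule Liminf_le)
    have "(\<integral>\<^sup>+x. e x * indicator {0..<?r i} x \<partial>lborel) \<le> K" for i
    proof (cases "0 \<le> ?r i")
      case False
      then have "{0..<?r i} = {}" by auto
      then show ?thesis by simp
    qed (auto intro!: le)
    then show "\<forall>\<^sub>F i in sequentially. (\<integral>\<^sup>+x. e x * indicator {0..<?r i} x \<partial>lborel) \<le> K" by simp
  qed simp
  finally show ?thesis .
qed

text \<open>Up to a null set the truncated integrand lives before the supremum \<open>m\<close> of
  the times at which the running integral is at most \<open>K\<close>. The integral may jump to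
  infinity right after \<open>m\<close>, but from the left it is continuous, so at \<open>m\<close>
  the bound \<open>K\<close> persists.\<close>

lemma running_integral_truncation:
  fixes e :: "real \<Rightarrow> ennreal"
  assumes [measurable]: "e \<in> borel_measurable borel" and t: "0 \<le> t"
  shows "(\<integral>\<^sup>+s. (if (\<integral>\<^sup>+x. e x * indicator {0..<s} x \<partial>lborel) \<le> K then e s else 0) * indicator {0..t} s \<partial>lborel) \<le> K"
proof -
  define A where "A s = (\<integral>\<^sup>+x. e x * indicator {0..<s} x \<partial>lborel)" for s
  have mono: "A r \<le> A s" if "r \<le> s" for r s
    unfolding A_def using that by (intro nn_integral_mono) (auto simp: indicator_def)
  have A0: "A 0 = 0" by (simp add: A_def)
  define S where "S = {s \<in> {0..t}. A s \<le> K}"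
  define m where "m = Sup S"
  have S0: "0 \<in> S" using A0 t by (simp add: S_def)
  have bdd: "bdd_above S" by (auto simp: S_def bdd_above_def)
  have upper: "s \<le> m" if "s \<in> S" for s unfolding m_def using that bdd by (rule cSup_upper)
  have Am: "A m \<le> K"
  proof (cases "m = 0")
    case False
    then have m0: "0 < m" using upper[OF S0] by simp
    show ?thesis unfolding A_def
    proof (rule running_integral_left_continuous[OF _ m0])
      fix r assume "r < m"
      then obtain s where "s \<in> S" "r < s" unfolding m_def using less_cSupE[of r S] S0 by blast
      then have "A r \<le> A s" "A s \<le> K" using mono[of r s] by (auto simp: S_def)
      then show "(\<integral>\<^sup>+x. e x * indicator {0..<r} x \<partial>lborel) \<le> K" by (simp add: A_def)
    qed simp
  qed (simp add: A0)
  have "(\<integral>\<^sup>+s. (if A s \<le> K then e s else 0) * indicator {0..t} s \<partial>lborel) \<le> (\<integral>\<^sup>+s. e s * indicator {0..<m} s \<partial>lborel)"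
  proof (rule nn_integral_mono_AE)
    show "AE s in lborel. (if A s \<le> K then e s else 0) * indicator {0..t} s \<le> e s * indicator {0..<m} s"
      using AE_lborel_singleton[of m]
    proof eventually_elim
      case (elim s)
      then show ?case using upper[of s] by (auto simp: S_def indicator_def)
    qed
  qed
  also have "\<dots> \<le> K" using Am by (simp add: A_def)
  finally show ?thesis by (simp add: A_def)
qed

text \<open>Borel-Cantelli with summable probabilities \<open>(1/2)^n\<close>. Each index is
  selected so that both sequences are small at once, since the integrands and the integrals must
  converge along the same subsequence.\<close>

lemma (in prob_space) tendsto_zero_in_prob_subseq:
  assumes [measurable]: "\<And>n. X n \<in> borel_measurable M" "\<And>n. Y n \<in> borel_measurable M"
    and X: "tendsto_zero_in_prob M X" and Y: "tendsto_zero_in_prob M Y"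
  obtains r :: "nat \<Rightarrow> nat" where "AE w in M. (\<lambda>n. X (r n) w) \<longlonglongrightarrow> 0" "AE w in M. (\<lambda>n. Y (r n) w) \<longlonglongrightarrow> 0"
proof -
  have ex: "\<exists>m. measure M {w \<in> space M. ennreal ((1/2)^n) < X m w} < (1/2)^n \<and>
      measure M {w \<in> space M. ennreal ((1/2)^n) < Y m w} < (1/2)^n" for n :: nat
  proof -
    have pos: "(0::real) < (1/2)^n" by simp
    have "\<forall>\<^sub>F m in sequentially. measure M {w \<in> space M. ennreal ((1/2)^n) < X m w} < (1/2)^n"
      using X pos unfolding tendsto_zero_in_prob_def by (intro order_tendstoD(2)[of _ 0]) auto
    moreover have "\<forall>\<^sub>F m in sequentially. measure M {w \<in> space M. ennreal ((1/2)^n) < Y m w} < (1/2)^n"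
      using Y pos unfolding tendsto_zero_in_prob_def by (intro order_tendstoD(2)[of _ 0]) auto
    ultimately have "\<forall>\<^sub>F m in sequentially. measure M {w \<in> space M. ennreal ((1/2)^n) < X m w} < (1/2)^n \<and>
      measure M {w \<in> space M. ennreal ((1/2)^n) < Y m w} < (1/2)^n" by eventually_elim simp
    then show ?thesis by (auto simp: eventually_sequentially)
  qed
  have "\<exists>r. \<forall>n. measure M {w \<in> space M. ennreal ((1/2)^n) < X (r n) w} < (1/2)^n \<and>
      measure M {w \<in> space M. ennreal ((1/2)^n) < Y (r n) w} < (1/2)^n"
    by (rule choice) (rule allI, rule ex)
  then obtain r where r:
      "\<And>n. measure M {w \<in> space M. ennreal ((1/2)^n) < X (r n) w} < (1/2)^n"
      "\<And>n. measure M {w \<in> space M. ennreal ((1/2)^n) < Y (r n) w} < (1/2)^n" by blast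
  have conv: "AE w in M. (\<lambda>n. V n w) \<longlonglongrightarrow> 0"
    if [measurable]: "\<And>n. V n \<in> borel_measurable M"
      and small: "\<And>n. measure M {w \<in> space M. ennreal ((1/2)^n) < V n w} < (1/2)^n" for V :: "nat \<Rightarrow> 'a \<Rightarrow> ennreal"
  proof -
    let ?S = "\<lambda>n. {w \<in> space M. ennreal ((1/2)^n) < V n w}"
    have geo: "summable (\<lambda>n. (1/2::real)^n)" by (rule summable_geometric) simp
    have "norm (measure M (?S n)) \<le> (1/2)^n" for n
      using small[of n] by (simp only: real_norm_def abs_of_nonneg[OF measure_nonneg] less_imp_le)
    then have "summable (\<lambda>n. measure M (?S n))"
      by (rule summable_comparison_test'[OF geo])
    moreover have "?S n \<in> sets M" for n by measurable
    moreover have "emeasure M (?S n) < \<infinity>" for n by (simp add: less_top[symmetric])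
    ultimately have "AE w in M. \<forall>\<^sub>F n in sequentially. w \<in> space M - ?S n"
      by (intro borel_cantelli_AE1)
    then show ?thesis
    proof eventually_elim
      case (elim w)
      have "\<forall>\<^sub>F n in sequentially. V n w \<le> ennreal ((1/2)^n)"
        using elim by eventually_elim (simp only: Diff_iff mem_Collect_eq not_less de_Morgan_conj, blast)
      moreover have "(\<lambda>n. ennreal ((1/2)^n)) \<longlonglongrightarrow> 0"
        unfolding ennreal_0[symmetric] by (intro tendsto_ennrealI LIMSEQ_realpow_zero) simp_all
      ultimately show ?case
        by (rule tendsto_sandwich[OF always_eventually[OF allI[OF zero_le]] _ tendsto_const])
    qed
  qed
  show ?thesis
    by (rule that[of r]; rule conv; (rule assms(1,2) | rule r(1) | rule r(2)))
qed

section \<open>Stopping the approximating processes at an energy level\<close>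

context space_time_white_noise
begin

text \<open>Adaptedness of the running energy is the point to be checked; left closure comes from
  Fatou's lemma. The guard \<open>w \<in> space M\<close> is present because the order clauses of
  \<open>stop_time\<close> range over all \<open>w\<close>, while sections are known to be
  measurable on the space only.\<close>

lemma stop_time_truncated:
  assumes \<Psi>: "is_simple M F \<Psi>" and Z: "stop_time M F t Z"
  defines "A \<equiv> \<lambda>s w. \<integral>\<^sup>+r. (\<integral>\<^sup>+y. ennreal ((simple_value \<Psi> r y w)\<^sup>2) \<partial>unit_lborel) * indicator {0..<s} r \<partial>lborel"
  shows "stop_time M F t (\<lambda>s w. Z s w \<and> (w \<in> space M \<longrightarrow> A s w \<le> K))"
proof -
  have Zad: "\<And>s. s \<in> {0..t} \<Longrightarrow> Measurable.pred (F s) (Z s)"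
    and Zj: "Measurable.pred (borel \<Otimes>\<^sub>M M) (\<lambda>(s, w). Z s w)"
    and Zdec: "\<And>r s w. 0 \<le> r \<Longrightarrow> r \<le> s \<Longrightarrow> s \<le> t \<Longrightarrow> Z s w \<Longrightarrow> Z r w"
    and Zleft: "\<And>s w. 0 < s \<Longrightarrow> s \<le> t \<Longrightarrow> (\<And>r. 0 \<le> r \<Longrightarrow> r < s \<Longrightarrow> Z r w) \<Longrightarrow> Z s w"
    using Z unfolding stop_time_def by blast+
  have e_sec: "(\<lambda>r. \<integral>\<^sup>+y. ennreal ((simple_value \<Psi> r y w)\<^sup>2) \<partial>unit_lborel) \<in> borel_measurable borel"
    if "w \<in> space M" for w
    by (rule measurable_square_integral_unit[OF measurable_simple_value_triple[OF \<Psi>]]) (use that in auto)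
  have Aad: "(\<lambda>w. A s w) \<in> borel_measurable (F s)" if s: "s \<in> {0..t}" for s
  proof -
    \<comment> \<open>Entries that start at \<open>s\<close> or later vanish on
      \<open>{0..<s}\<close>, and the coefficients of the remaining ones are measurable with respect
      to \<open>F s\<close>.\<close>
    define \<Psi>' where "\<Psi>' = filter (\<lambda>(a, b, B, X). a < s) \<Psi>"
    have eq: "simple_value \<Psi> r y w = simple_value \<Psi>' r y w" if "r < s" for r y w
      unfolding \<Psi>'_def
    proof (induction \<Psi>)
      case (Cons p \<Psi>)
      obtain a b B X where p: "p = (a, b, B, X)" by (cases p) auto
      show ?case
      proof (cases "a < s")
        case False
        then have "r \<notin> {a<..b}" using that by simp
        with False Cons show ?thesis by (simp add: p simple_value_Cons)
      qed (use Cons in \<open>simp add: p simple_value_Cons\<close>)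
    qed simp
    have "(\<lambda>(r, y, w). simple_value \<Psi>' r y w) \<in> borel_measurable (borel \<Otimes>\<^sub>M (borel \<Otimes>\<^sub>M F s))"
      unfolding case_prod_unfold
    proof (rule measurable_simple_value_general[where G = "F s"])
      fix a b B X assume "(a, b, B, X) \<in> set \<Psi>'"
      then have mem: "(a, b, B, X) \<in> set \<Psi>" "a < s" unfolding \<Psi>'_def set_filter by blast+
      from bspec[OF \<Psi>[unfolded is_simple_def] mem(1)]
      have "0 \<le> a" "B \<in> sets borel" "X \<in> borel_measurable (F a)" unfolding split_conv by blast+
      then show "B \<in> sets borel \<and> X \<in> borel_measurable (F s)"
        using measurable_F_mono[of X a s] less_imp_le[OF mem(2)] by blast
    qed (rule measurable_fst measurable_compose[OF measurable_snd measurable_fst]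
        measurable_compose[OF measurable_snd measurable_snd])+
    then have [measurable]: "(\<lambda>x. \<integral>\<^sup>+y. ennreal ((simple_value \<Psi>' (snd x) y (fst x))\<^sup>2) \<partial>unit_lborel)
        \<in> borel_measurable (F s \<Otimes>\<^sub>M lborel)"
      by (rule measurable_square_integral_unit) measurable
    have "A s w = (\<integral>\<^sup>+r. (\<integral>\<^sup>+y. ennreal ((simple_value \<Psi>' r y w)\<^sup>2) \<partial>unit_lborel) * indicator {0..<s} r \<partial>lborel)" for w
      unfolding A_def by (intro nn_integral_cong) (auto simp: indicator_def eq)
    moreover have "(\<lambda>w. \<integral>\<^sup>+r. (\<integral>\<^sup>+y. ennreal ((simple_value \<Psi>' r y w)\<^sup>2) \<partial>unit_lborel) * indicator {0..<s} r \<partial>lborel)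
        \<in> borel_measurable (F s)"
      by (rule lborel.borel_measurable_nn_integral) (unfold case_prod_unfold, measurable)
    ultimately show ?thesis by simp
  qed
  have Aj: "(\<lambda>(s, w). A s w) \<in> borel_measurable (borel \<Otimes>\<^sub>M M)"
  proof -
    have [measurable]: "(\<lambda>x. \<integral>\<^sup>+y. ennreal ((simple_value \<Psi> (snd x) y (snd (fst x)))\<^sup>2) \<partial>unit_lborel)
        \<in> borel_measurable ((borel \<Otimes>\<^sub>M M) \<Otimes>\<^sub>M lborel)"
      by (rule measurable_square_integral_unit[OF measurable_simple_value_triple[OF \<Psi>]]) measurable
    have "(\<lambda>x. A (fst x) (snd x)) \<in> borel_measurable ((borel :: real measure) \<Otimes>\<^sub>M M)"
      unfolding A_def
      by (rule lborel.borel_measurable_nn_integral) (unfold case_prod_unfold indicator_def atLeastLessThan_iff, measurable)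
    then show ?thesis by (simp add: case_prod_unfold)
  qed
  show ?thesis unfolding stop_time_def
  proof (intro conjI ballI allI impI)
    fix s assume s: "s \<in> {0..t}"
    have sp: "w \<in> space (F s) \<longleftrightarrow> w \<in> space M" for w using space_F[of s] s by simp
    have "Measurable.pred (F s) (\<lambda>w. Z s w \<and> A s w \<le> K)"
      using Zad[OF s] Aad[OF s] by measurable
    then show "Measurable.pred (F s) (\<lambda>w. Z s w \<and> (w \<in> space M \<longrightarrow> A s w \<le> K))"
      by (rule measurable_cong[THEN iffD1, rotated]) (simp add: sp)
  next
    have "Measurable.pred (borel \<Otimes>\<^sub>M M) (\<lambda>x. (case x of (s, w) \<Rightarrow> Z s w) \<and> (case x of (s, w) \<Rightarrow> A s w) \<le> K)"
      using Zj Aj by measurable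
    then show "Measurable.pred (borel \<Otimes>\<^sub>M M) (\<lambda>(s, w). Z s w \<and> (w \<in> space M \<longrightarrow> A s w \<le> K))"
      by (rule measurable_cong[THEN iffD1, rotated]) (auto simp: space_pair_measure)
  next
    fix r s w assume *: "0 \<le> r" "r \<le> s" "s \<le> t" "Z s w \<and> (w \<in> space M \<longrightarrow> A s w \<le> K)"
    then show "Z r w" using Zdec by blast
    assume "w \<in> space M"
    moreover have "A r w \<le> A s w" unfolding A_def using * by (intro nn_integral_mono) (auto simp: indicator_def)
    ultimately show "A r w \<le> K" using * by auto
  next
    fix s w assume *: "0 < s" "s \<le> t" "\<forall>r\<ge>0. r < s \<longrightarrow> Z r w \<and> (w \<in> space M \<longrightarrow> A r w \<le> K)"
    then show "Z s w" using Zleft by blast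
    assume w: "w \<in> space M"
    show "A s w \<le> K"
      unfolding A_def by (rule running_integral_left_continuous[OF e_sec[OF w] *(1)]) (use * w in \<open>auto simp: A_def\<close>)
  qed
qed

lemma measurable_simple_integral_diff:
  assumes "is_simple M F \<Psi>" "J \<in> borel_measurable M"
  shows "(\<lambda>w. ennreal \<bar>simple_integral W t \<Psi> w - J w\<bar>) \<in> borel_measurable M"
  using borel_measurable_diff[OF simple_integral_measurable[OF assms(1)] assms(2)] by measurable

lemma measurable_triple_diff:
  assumes "jointly_measurable M f"
    and "jointly_measurable M g"
  shows "jointly_measurable M (\<lambda>s y w. f s y w - g s y w :: real)"
  using borel_measurable_diff[OF assms] by (simp add: case_prod_unfold)

lemma measurable_triple_section:
  assumes "jointly_measurable M f" and w: "w \<in> space M"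
  shows "(\<lambda>(s, y). f s y w) \<in> borel_measurable (borel \<Otimes>\<^sub>M borel)"
  unfolding case_prod_unfold
  by (rule measurable_triple_compose[OF assms(1) measurable_fst measurable_snd measurable_const[OF w]])

lemma simple_energy_finite:
  assumes \<Psi>: "is_simple M F \<Psi>" and w: "w \<in> space M"
  shows "energy t (\<lambda>s y. simple_value \<Psi> s y w) < \<infinity>"
proof -
  obtain C where C: "C \<ge> 0" "\<forall>w\<in>space M. \<forall>s y. \<bar>simple_value \<Psi> s y w\<bar> \<le> C"
    using simple_value_bounded[OF \<Psi>] by auto
  have "(\<integral>\<^sup>+y. ennreal ((simple_value \<Psi> s y w)\<^sup>2) \<partial>unit_lborel) \<le> ennreal (C\<^sup>2)" for s
  proof -
    have "(simple_value \<Psi> s y w)\<^sup>2 \<le> C\<^sup>2" for y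
      using power_mono[of "\<bar>simple_value \<Psi> s y w\<bar>" C 2] C(2)[rule_format, OF w] by simp
    then have "(\<integral>\<^sup>+y. ennreal ((simple_value \<Psi> s y w)\<^sup>2) \<partial>unit_lborel) \<le> (\<integral>\<^sup>+y. ennreal (C\<^sup>2) \<partial>unit_lborel)"
      by (intro nn_integral_mono ennreal_leI)
    then show ?thesis by (simp add: emeasure_restrict_space)
  qed
  then have "energy t (\<lambda>s y. simple_value \<Psi> s y w) \<le> (\<integral>\<^sup>+s. ennreal (C\<^sup>2) * indicator {0..t} s \<partial>lborel)"
    unfolding energy_def by (intro nn_integral_mono mult_right_mono) auto
  also have "\<dots> < \<infinity>" by (cases "0 \<le> t") (simp_all add: nn_integral_cmult ennreal_mult_less_top)
  finally show ?thesis .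
qed

text \<open>The approximating simple processes converge in probability only. They are therefore stopped
  additionally when their own running energy exceeds a level \<open>K\<close>, which is removed at the end.\<close>

lemma localized_walsh_core:
  assumes \<Phi>: "jointly_measurable M \<Phi>"
    and J[measurable]: "J \<in> borel_measurable M"
    and \<Psi>: "\<And>n. is_simple M F (\<Psi> n)"
    and lim_energy: "AE w in M. (\<lambda>n. energy t (\<lambda>s y. simple_value (\<Psi> n) s y w - \<Phi> s y w)) \<longlonglongrightarrow> 0"
    and lim_int: "AE w in M. (\<lambda>n. ennreal \<bar>simple_integral W t (\<Psi> n) w - J w\<bar>) \<longlonglongrightarrow> 0"
    and t: "0 \<le> t" and Z: "stop_time M F t Z"
  shows "(\<integral>\<^sup>+w. (if Z t w then ennreal ((J w)\<^sup>2) else 0) \<partial>M)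
     \<le> (\<integral>\<^sup>+w. stopped_energy t (\<lambda>s. Z s w) (\<lambda>s y. \<Phi> s y w) \<partial>M)"
proof -
  have Zj: "Measurable.pred (borel \<Otimes>\<^sub>M M) (\<lambda>(s, w). Z s w)" using Z by (simp add: stop_time_def)
  have Zt[measurable]: "Measurable.pred M (Z t)"
    using measurable_compose[OF measurable_Pair[OF measurable_const measurable_ident] Zj, of t] by simp
  have Zs: "Measurable.pred borel (\<lambda>s. Z s w)" if "w \<in> space M" for w
    using measurable_Pair1[OF Zj that] by simp
  note v = measurable_simple_value_triple[OF \<Psi>]
  note diff = measurable_triple_diff[OF v \<Phi>]
  note [measurable] = simple_integral_measurable[OF \<Psi>]
  define A where "A n s w = (\<integral>\<^sup>+r. (\<integral>\<^sup>+y. ennreal ((simple_value (\<Psi> n) r y w)\<^sup>2) \<partial>unit_lborel) * indicator {0..<s} r \<partial>lborel)" for n s w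
  define E where "E w = energy t (\<lambda>s y. \<Phi> s y w)" for w
  define B where "B w = stopped_energy t (\<lambda>s. Z s w) (\<lambda>s y. \<Phi> s y w)" for w
  define D where "D n w = energy t (\<lambda>s y. simple_value (\<Psi> n) s y w - \<Phi> s y w)" for n w
  have [measurable]: "E \<in> borel_measurable M" "B \<in> borel_measurable M" "D n \<in> borel_measurable M" for n
    unfolding E_def B_def D_def
    by (rule measurable_energy[OF \<Phi>] measurable_stopped_energy[OF \<Phi> Zj] measurable_energy[OF diff])+
  have D0: "AE w in M. (\<lambda>n. D n w) \<longlonglongrightarrow> 0" using lim_energy by (simp add: D_def)
  have A_meas: "Measurable.pred M (\<lambda>w. Z t w \<and> (w \<in> space M \<longrightarrow> A n t w \<le> K))" for n K
  proof -
    have "stop_time M F t (\<lambda>s w. Z s w \<and> (w \<in> space M \<longrightarrow> A n s w \<le> K))"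
      unfolding A_def by (rule stop_time_truncated[OF \<Psi> Z])
    then have "Measurable.pred (F t) (\<lambda>w. Z t w \<and> (w \<in> space M \<longrightarrow> A n t w \<le> K))"
      using t by (auto simp: stop_time_def)
    then show ?thesis by (rule measurable_F_M[OF _ t])
  qed
  \<comment> \<open>The stopped energy is bounded by \<open>K\<close> through the truncation, and by
    the energy of \<open>\<Phi>\<close> plus an error through the splitting. The minimum of the two
    keeps the error dominated, so that its almost sure convergence carries over to
    expectations.\<close>
  have stopped: "(\<integral>\<^sup>+w. (if Z t w \<and> (w \<in> space M \<longrightarrow> A n t w \<le> ennreal K) then ennreal ((simple_integral W t (\<Psi> n) w)\<^sup>2) else 0) \<partial>M)
      \<le> ennreal (1 + d) * (\<integral>\<^sup>+w. B w \<partial>M) + (\<integral>\<^sup>+w. min (ennreal K) (ennreal (1 + 1 / d) * D n w) \<partial>M)"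
    if d: "d > 0" for n K d
  proof -
    have "stop_time M F t (\<lambda>s w. Z s w \<and> (w \<in> space M \<longrightarrow> A n s w \<le> ennreal K))"
      unfolding A_def by (rule stop_time_truncated[OF \<Psi> Z])
    from stopped_simple_bound[OF \<Psi> t this]
    have "(\<integral>\<^sup>+w. (if Z t w \<and> (w \<in> space M \<longrightarrow> A n t w \<le> ennreal K) then ennreal ((simple_integral W t (\<Psi> n) w)\<^sup>2) else 0) \<partial>M)
      \<le> (\<integral>\<^sup>+w. stopped_energy t (\<lambda>s. Z s w \<and> (w \<in> space M \<longrightarrow> A n s w \<le> ennreal K)) (\<lambda>s y. simple_value (\<Psi> n) s y w) \<partial>M)"
      unfolding stopped_energy_def .
    also have "\<dots> \<le> (\<integral>\<^sup>+w. ennreal (1 + d) * B w + min (ennreal K) (ennreal (1 + 1 / d) * D n w) \<partial>M)"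
    proof (rule nn_integral_mono)
      fix w assume w: "w \<in> space M"
      let ?G = "stopped_energy t (\<lambda>s. Z s w \<and> (w \<in> space M \<longrightarrow> A n s w \<le> ennreal K)) (\<lambda>s y. simple_value (\<Psi> n) s y w)"
      have e: "(\<lambda>r. \<integral>\<^sup>+y. ennreal ((simple_value (\<Psi> n) r y w)\<^sup>2) \<partial>unit_lborel) \<in> borel_measurable borel"
        by (rule measurable_square_integral_unit[OF v]) (use w in auto)
      have "?G \<le> (\<integral>\<^sup>+s. (if A n s w \<le> ennreal K then \<integral>\<^sup>+y. ennreal ((simple_value (\<Psi> n) s y w)\<^sup>2) \<partial>unit_lborel else 0) * indicator {0..t} s \<partial>lborel)"
        unfolding stopped_energy_def using w by (intro nn_integral_mono mult_right_mono) auto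
      also have "\<dots> \<le> ennreal K"
        unfolding A_def by (rule running_integral_truncation[OF e t])
      finally have 1: "?G \<le> ennreal K" .
      have "?G \<le> stopped_energy t (\<lambda>s. Z s w) (\<lambda>s y. simple_value (\<Psi> n) s y w)"
        unfolding stopped_energy_def by (intro nn_integral_mono mult_right_mono) auto
      also have "\<dots> \<le> ennreal (1 + d) * B w + ennreal (1 + 1 / d) * D n w"
        unfolding B_def D_def
        by (rule stopped_energy_split[OF measurable_triple_section[OF v w] measurable_triple_section[OF \<Phi> w] Zs[OF w] d])
      finally have 2: "?G \<le> ennreal (1 + d) * B w + ennreal (1 + 1 / d) * D n w" .
      show "?G \<le> ennreal (1 + d) * B w + min (ennreal K) (ennreal (1 + 1 / d) * D n w)"
      proof (cases "ennreal K \<le> ennreal (1 + 1 / d) * D n w")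
        case True
        have "ennreal K \<le> ennreal (1 + d) * B w + ennreal K" by simp
        with 1 have "?G \<le> ennreal (1 + d) * B w + ennreal K" by (rule order_trans)
        with True show ?thesis by (simp add: min_def)
      next
        case False
        with 2 show ?thesis by (simp add: min_def)
      qed
    qed
    also have "\<dots> = ennreal (1 + d) * (\<integral>\<^sup>+w. B w \<partial>M) + (\<integral>\<^sup>+w. min (ennreal K) (ennreal (1 + 1 / d) * D n w) \<partial>M)"
      by (subst nn_integral_add) (auto simp: nn_integral_cmult)
    finally show ?thesis .
  qed
  have vanish: "(\<lambda>n. \<integral>\<^sup>+w. min (ennreal K) (ennreal (1 + 1 / d) * D n w) \<partial>M) \<longlonglongrightarrow> 0" for K d
  proof -
    have "(\<lambda>n. \<integral>\<^sup>+w. min (ennreal K) (ennreal (1 + 1 / d) * D n w) \<partial>M) \<longlonglongrightarrow> (\<integral>\<^sup>+w. 0 \<partial>M)"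
    proof (rule nn_integral_dominated_convergence[where w = "\<lambda>w. ennreal K"])
      show "AE w in M. (\<lambda>n. min (ennreal K) (ennreal (1 + 1 / d) * D n w)) \<longlonglongrightarrow> 0"
        using D0
      proof eventually_elim
        case (elim w)
        have "(\<lambda>n. ennreal (1 + 1 / d) * D n w) \<longlonglongrightarrow> ennreal (1 + 1 / d) * 0"
          by (intro ennreal_tendsto_cmult elim) simp
        then have "(\<lambda>n. min (ennreal K) (ennreal (1 + 1 / d) * D n w)) \<longlonglongrightarrow> min (ennreal K) (ennreal (1 + 1 / d) * 0)"
          by (intro tendsto_min tendsto_const)
        then show ?case by simp
      qed
    qed (auto simp: emeasure_space_1 less_top[symmetric])
    then show ?thesis by simp
  qed
  \<comment> \<open>Where \<open>2 * E w < K\<close> the extra stopping is eventually inactive,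
    because the energy of the approximations is at most \<open>2 * E w + 2 * D n w\<close>. Fatou's
    lemma then passes from the simple integrals to \<open>J\<close>.\<close>
  have trunc: "(\<integral>\<^sup>+w. (if Z t w \<and> 2 * E w < ennreal K then ennreal ((J w)\<^sup>2) else 0) \<partial>M)
      \<le> ennreal (1 + d) * (\<integral>\<^sup>+w. B w \<partial>M)" if d: "d > 0" for K d
  proof -
    let ?S = "\<lambda>n w. if Z t w \<and> (w \<in> space M \<longrightarrow> A n t w \<le> ennreal K) then ennreal ((simple_integral W t (\<Psi> n) w)\<^sup>2) else 0"
    have [measurable]: "?S n \<in> borel_measurable M" for n
      using A_meas[of n "ennreal K"] by measurable
    have "AE w in M. (if Z t w \<and> 2 * E w < ennreal K then ennreal ((J w)\<^sup>2) else 0) \<le> liminf (\<lambda>n. ?S n w)"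
      using D0 lim_int AE_space
    proof eventually_elim
      case (elim w)
      show ?case
      proof (cases "Z t w \<and> 2 * E w < ennreal K")
        case True
        have "A n t w \<le> 2 * E w + 2 * D n w" for n
        proof -
          have "A n t w \<le> stopped_energy t (\<lambda>s. True) (\<lambda>s y. simple_value (\<Psi> n) s y w)"
            unfolding A_def stopped_energy_def by (intro nn_integral_mono) (auto simp: indicator_def)
          also have "\<dots> \<le> ennreal (1 + 1) * stopped_energy t (\<lambda>s. True) (\<lambda>s y. \<Phi> s y w) + ennreal (1 + 1 / 1) * D n w"
            unfolding D_def
            by (rule stopped_energy_split[OF measurable_triple_section[OF v elim(3)] measurable_triple_section[OF \<Phi> elim(3)]]) auto
          also have "\<dots> = 2 * E w + 2 * D n w" by (simp add: E_def stopped_energy_def energy_def)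
          finally show ?thesis .
        qed
        moreover have "\<forall>\<^sub>F n in sequentially. 2 * E w + 2 * D n w < ennreal K"
        proof -
          have "(\<lambda>n. 2 * E w + 2 * D n w) \<longlonglongrightarrow> 2 * E w + 2 * 0"
            by (intro tendsto_add tendsto_const ennreal_tendsto_cmult elim(1)) simp
          then show ?thesis using True by (intro order_tendstoD(2)) auto
        qed
        ultimately have ev: "\<forall>\<^sub>F n in sequentially. A n t w \<le> ennreal K"
          by (auto elim!: eventually_mono intro: order_trans less_imp_le)
        have "(\<lambda>n. \<bar>simple_integral W t (\<Psi> n) w - J w\<bar>) \<longlonglongrightarrow> 0"
          using elim(2) by (simp add: ennreal_tendsto_0_iff)
        then have "(\<lambda>n. simple_integral W t (\<Psi> n) w) \<longlonglongrightarrow> J w"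
          by (simp add: LIM_zero_iff tendsto_rabs_zero_iff)
        then have "(\<lambda>n. ennreal ((simple_integral W t (\<Psi> n) w)\<^sup>2)) \<longlonglongrightarrow> ennreal ((J w)\<^sup>2)"
          by (intro tendsto_intros)
        then have "(\<lambda>n. ?S n w) \<longlonglongrightarrow> ennreal ((J w)\<^sup>2)"
          by (rule Lim_transform_eventually) (use ev True in \<open>auto elim!: eventually_mono\<close>)
        then have "liminf (\<lambda>n. ?S n w) = ennreal ((J w)\<^sup>2)"
          by (rule lim_imp_Liminf[rotated]) simp
        then show ?thesis using True by simp
      qed auto
    qed
    then have "(\<integral>\<^sup>+w. (if Z t w \<and> 2 * E w < ennreal K then ennreal ((J w)\<^sup>2) else 0) \<partial>M) \<le> (\<integral>\<^sup>+w. liminf (\<lambda>n. ?S n w) \<partial>M)"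
      by (rule nn_integral_mono_AE)
    also have "\<dots> \<le> liminf (\<lambda>n. \<integral>\<^sup>+w. ?S n w \<partial>M)"
      by (rule nn_integral_liminf) measurable
    also have "\<dots> \<le> liminf (\<lambda>n. ennreal (1 + d) * (\<integral>\<^sup>+w. B w \<partial>M) + (\<integral>\<^sup>+w. min (ennreal K) (ennreal (1 + 1 / d) * D n w) \<partial>M))"
      using stopped[OF d] by (intro Liminf_mono) auto
    also have "\<dots> = ennreal (1 + d) * (\<integral>\<^sup>+w. B w \<partial>M)"
    proof (rule lim_imp_Liminf)
      have "(\<lambda>n. ennreal (1 + d) * (\<integral>\<^sup>+w. B w \<partial>M) + (\<integral>\<^sup>+w. min (ennreal K) (ennreal (1 + 1 / d) * D n w) \<partial>M))
          \<longlonglongrightarrow> ennreal (1 + d) * (\<integral>\<^sup>+w. B w \<partial>M) + 0"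
        by (intro tendsto_add tendsto_const vanish)
      then show "(\<lambda>n. ennreal (1 + d) * (\<integral>\<^sup>+w. B w \<partial>M) + (\<integral>\<^sup>+w. min (ennreal K) (ennreal (1 + 1 / d) * D n w) \<partial>M))
          \<longlonglongrightarrow> ennreal (1 + d) * (\<integral>\<^sup>+w. B w \<partial>M)" by simp
    qed simp
    finally show ?thesis .
  qed
  \<comment> \<open>Almost surely \<open>\<Phi>\<close> is at finite distance from a simple process,
    whose energy is finite since it is bounded.\<close>
  have E_fin: "AE w in M. E w < \<infinity>"
    using D0 AE_space
  proof eventually_elim
    case (elim w)
    have "\<forall>\<^sub>F n in sequentially. D n w < 1" using elim(1) by (intro order_tendstoD) auto
    then obtain n where n: "D n w < 1" by (auto simp: eventually_sequentially)
    have eq: "energy t (\<lambda>s y. \<Phi> s y w - simple_value (\<Psi> n) s y w) = D n w"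
      unfolding D_def energy_def by (simp add: power2_commute)
    have "E w = stopped_energy t (\<lambda>s. True) (\<lambda>s y. \<Phi> s y w)" by (simp add: E_def stopped_energy_def energy_def)
    also have "\<dots> \<le> ennreal (1 + 1) * stopped_energy t (\<lambda>s. True) (\<lambda>s y. simple_value (\<Psi> n) s y w)
        + ennreal (1 + 1 / 1) * energy t (\<lambda>s y. \<Phi> s y w - simple_value (\<Psi> n) s y w)"
      by (rule stopped_energy_split[OF measurable_triple_section[OF \<Phi> elim(2)] measurable_triple_section[OF v elim(2)]]) auto
    also have "\<dots> = 2 * energy t (\<lambda>s y. simple_value (\<Psi> n) s y w) + 2 * D n w"
      unfolding eq by (simp add: stopped_energy_def energy_def)
    also have "\<dots> < \<infinity>"
      using n simple_energy_finite[OF \<Psi> elim(2)] by (auto simp: ennreal_mult_less_top less_trans[OF _ ennreal_one_less_top])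
    finally show ?case .
  qed
  \<comment> \<open>With the energy of \<open>\<Phi>\<close> finite almost surely, the level is
    removed by Fatou's lemma; \<open>d\<close> is sent to zero only afterwards.\<close>
  have all: "(\<integral>\<^sup>+w. (if Z t w then ennreal ((J w)\<^sup>2) else 0) \<partial>M) \<le> ennreal (1 + d) * (\<integral>\<^sup>+w. B w \<partial>M)" if d: "d > 0" for d
  proof -
    let ?T = "\<lambda>i w. if Z t w \<and> 2 * E w < ennreal (real i) then ennreal ((J w)\<^sup>2) else 0"
    have "AE w in M. (if Z t w then ennreal ((J w)\<^sup>2) else 0) \<le> liminf (\<lambda>i. ?T i w)"
      using E_fin
    proof eventually_elim
      case (elim w)
      then have "2 * E w < top" by (simp add: ennreal_mult_less_top)
      then obtain m where "2 * E w < of_nat m" using ennreal_Ex_less_of_nat by blast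
      then have "\<forall>\<^sub>F i in sequentially. (if Z t w then ennreal ((J w)\<^sup>2) else 0) \<le> ?T i w"
        unfolding eventually_sequentially ennreal_of_nat_eq_real_of_nat
        by (intro exI[of _ m] allI impI) (auto intro: less_le_trans simp: ennreal_leI)
      then show ?case by (rule Liminf_bounded)
    qed
    then have "(\<integral>\<^sup>+w. (if Z t w then ennreal ((J w)\<^sup>2) else 0) \<partial>M) \<le> (\<integral>\<^sup>+w. liminf (\<lambda>i. ?T i w) \<partial>M)"
      by (rule nn_integral_mono_AE)
    also have "\<dots> \<le> liminf (\<lambda>i. \<integral>\<^sup>+w. ?T i w \<partial>M)"
      by (rule nn_integral_liminf) measurable
    also have "\<dots> \<le> ennreal (1 + d) * (\<integral>\<^sup>+w. B w \<partial>M)"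
      by (rule Liminf_le) (use trunc[OF d] in auto)
    finally show ?thesis .
  qed
  show ?thesis
  proof (cases "(\<integral>\<^sup>+w. B w \<partial>M) = \<infinity>")
    case False
    have "(\<lambda>n. ennreal (1 + inverse (real (Suc n))) * (\<integral>\<^sup>+w. B w \<partial>M)) \<longlonglongrightarrow> ennreal (1 + 0) * (\<integral>\<^sup>+w. B w \<partial>M)"
      using False
      by (intro tendsto_mult_ennreal tendsto_ennrealI tendsto_add tendsto_const LIMSEQ_inverse_real_of_nat) auto
    then have "(\<integral>\<^sup>+w. (if Z t w then ennreal ((J w)\<^sup>2) else 0) \<partial>M) \<le> ennreal (1 + 0) * (\<integral>\<^sup>+w. B w \<partial>M)"
      by (rule LIMSEQ_le_const) (use all in auto)
    then show ?thesis by (simp add: B_def)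
  qed (simp add: B_def)
qed

end

section \<open>Extension by zero, and sums and negatives of approximations\<close>

lemma measurable_extend_triple:
  assumes f: "(\<lambda>(s, y, w). f s y w) \<in> borel_measurable (restrict_space borel A \<Otimes>\<^sub>M (restrict_space borel B \<Otimes>\<^sub>M M))"
    and [measurable]: "A \<in> sets borel" "B \<in> sets borel"
  shows "jointly_measurable M (\<lambda>s y w. if s \<in> A \<and> y \<in> B then f s y w else (0::real))"
proof -
  let ?N = "borel \<Otimes>\<^sub>M (borel \<Otimes>\<^sub>M M)"
  let ?O = "A \<times> B \<times> space M"
  have sub: "?O \<inter> space ?N \<in> sets ?N"
    by (intro sets.Int pair_measureI sets.top) auto
  have 1: "fst \<in> measurable (restrict_space ?N ?O) (restrict_space borel A)"
    by (rule measurable_restrict_space2) (auto simp: space_restrict_space intro!: measurable_restrict_space1)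
  have 2: "(\<lambda>x. fst (snd x)) \<in> measurable (restrict_space ?N ?O) (restrict_space borel B)"
    by (rule measurable_restrict_space2) (auto simp: space_restrict_space intro: measurable_restrict_space1)
  have 3: "(\<lambda>x. snd (snd x)) \<in> measurable (restrict_space ?N ?O) M"
    by (rule measurable_restrict_space1) measurable
  have "(\<lambda>x. f (fst x) (fst (snd x)) (snd (snd x))) \<in> borel_measurable (restrict_space ?N ?O)"
    using measurable_compose[OF measurable_Pair[OF 1 measurable_Pair[OF 2 3]] f] by (simp add: case_prod_unfold)
  then have "(\<lambda>x. if x \<in> ?O then f (fst x) (fst (snd x)) (snd (snd x)) else 0) \<in> borel_measurable ?N"
    by (subst (asm) measurable_restrict_space_iff[where c = 0]) (use sub in auto)
  then show ?thesis
    by (rule measurable_cong[THEN iffD1, rotated]) (auto simp: space_pair_measure split: if_splits)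
qed

lemma energy_set_nn_integral:
  "(\<integral>\<^sup>+ s\<in>{0..t}. (\<integral>\<^sup>+ y\<in>{0..1}. ennreal ((\<phi> s y)\<^sup>2) \<partial>lborel) \<partial>lborel) = energy t \<phi>"
  unfolding energy_def by (simp add: nn_integral_restrict_space)

lemma nn_integral_unit_cong:
  assumes "\<And>y. y \<in> {0..1} \<Longrightarrow> f y = g y"
  shows "(\<integral>\<^sup>+y. f y \<partial>unit_lborel) = (\<integral>\<^sup>+y. g y \<partial>unit_lborel)"
  using assms by (intro nn_integral_cong) (simp add: space_restrict_space)

lemma energy_cong:
  assumes "\<And>s y. s \<in> {0..t} \<Longrightarrow> y \<in> {0..1} \<Longrightarrow> \<phi> s y = \<psi> s y"
  shows "energy t \<phi> = energy t \<psi>"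
  unfolding energy_def using assms
  by (intro nn_integral_cong) (auto simp: indicator_def intro!: nn_integral_unit_cong)

lemma stopped_energy_cong:
  assumes "\<And>s y. s \<in> {0..t} \<Longrightarrow> y \<in> {0..1} \<Longrightarrow> \<phi> s y = \<psi> s y"
  shows "stopped_energy t z \<phi> = stopped_energy t z \<psi>"
  unfolding stopped_energy_def using assms
  by (intro nn_integral_cong) (auto simp: indicator_def intro!: nn_integral_unit_cong)

lemma (in prob_space) tendsto_zero_in_prob_add:
  assumes [measurable]: "\<And>n. X n \<in> borel_measurable M" "\<And>n. Y n \<in> borel_measurable M"
    and X: "tendsto_zero_in_prob M X" and Y: "tendsto_zero_in_prob M Y"
  shows "tendsto_zero_in_prob M (\<lambda>n w. X n w + Y n w)"
  unfolding tendsto_zero_in_prob_def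
proof (intro allI impI)
  fix \<epsilon> :: real assume e: "\<epsilon> > 0"
  let ?S = "\<lambda>V n. {w \<in> space M. ennreal (\<epsilon> / 2) < V n w}"
  have "(\<lambda>n. measure M (?S X n)) \<longlonglongrightarrow> 0" "(\<lambda>n. measure M (?S Y n)) \<longlonglongrightarrow> 0"
    using X Y half_gt_zero[OF e] unfolding tendsto_zero_in_prob_def by blast+
  then have lim: "(\<lambda>n. measure M (?S X n) + measure M (?S Y n)) \<longlonglongrightarrow> 0"
    using tendsto_add[of _ 0 _ _ 0] by fastforce
  have "measure M {w \<in> space M. ennreal \<epsilon> < X n w + Y n w} \<le> measure M (?S X n) + measure M (?S Y n)" for n
  proof -
    have "{w \<in> space M. ennreal \<epsilon> < X n w + Y n w} \<subseteq> ?S X n \<union> ?S Y n"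
    proof (rule subsetI, rule ccontr)
      fix w assume w: "w \<in> {w \<in> space M. ennreal \<epsilon> < X n w + Y n w}" "w \<notin> ?S X n \<union> ?S Y n"
      then have "X n w + Y n w \<le> ennreal (\<epsilon> / 2) + ennreal (\<epsilon> / 2)"
        by (intro add_mono) auto
      also have "\<dots> = ennreal \<epsilon>" using e by (subst ennreal_plus[symmetric]) auto
      finally show False using w(1) by auto
    qed
    then have "measure M {w \<in> space M. ennreal \<epsilon> < X n w + Y n w} \<le> measure M (?S X n \<union> ?S Y n)"
      by (intro finite_measure_mono) measurable
    also have "\<dots> \<le> measure M (?S X n) + measure M (?S Y n)"
      by (rule measure_Un_le) measurable
    finally show ?thesis .
  qed
  then show "(\<lambda>n. measure M {w \<in> space M. ennreal \<epsilon> < X n w + Y n w}) \<longlonglongrightarrow> 0"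
    by (intro tendsto_sandwich[OF always_eventually always_eventually tendsto_const lim] allI) simp
qed

definition neg_simple :: "'w simple_process \<Rightarrow> 'w simple_process" where
  "neg_simple \<Psi> = map (\<lambda>(a, b, A, X). (a, b, A, \<lambda>w. - X w)) \<Psi>"

lemma simple_value_neg: "simple_value (neg_simple \<Psi>) s y w = - simple_value \<Psi> s y w"
  by (induction \<Psi>) (auto simp: neg_simple_def simple_value_Cons)

lemma simple_integral_neg: "simple_integral W t (neg_simple \<Psi>) w = - simple_integral W t \<Psi> w"
  by (induction \<Psi>) (auto simp: neg_simple_def simple_integral_Cons)

lemma is_simple_neg:
  assumes "is_simple M F \<Psi>"
  shows "is_simple M F (neg_simple \<Psi>)"
  unfolding is_simple_def
proof (rule ballI)
  fix p assume "p \<in> set (neg_simple \<Psi>)"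
  then obtain a b A X where p: "p = (a, b, A, \<lambda>w. - X w)" "(a, b, A, X) \<in> set \<Psi>"
    by (auto simp: neg_simple_def)
  from bspec[OF assms[unfolded is_simple_def] p(2)]
  have *: "0 \<le> a" "a \<le> b" "A \<in> sets borel" "A \<subseteq> {0..1}" "X \<in> borel_measurable (F a)" "\<exists>C. \<forall>\<omega>\<in>space M. \<bar>X \<omega>\<bar> \<le> C"
    unfolding split_conv by blast+
  have "\<exists>C. \<forall>\<omega>\<in>space M. \<bar>- X \<omega>\<bar> \<le> C" using *(6) by (simp only: abs_minus_cancel)
  moreover note borel_measurable_uminus[OF *(5)]
  ultimately show "case p of (a, b, A, X) \<Rightarrow> 0 \<le> a \<and> a \<le> b \<and> A \<in> sets borel \<and> A \<subseteq> {0..1} \<and>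
     X \<in> borel_measurable (F a) \<and> (\<exists>C. \<forall>\<omega>\<in>space M. \<bar>X \<omega>\<bar> \<le> C)"
    unfolding p(1) split_conv using * by blast
qed

section \<open>The modulus of the drift\<close>

text \<open>The tangent of the concave function \<open>- r * ln r\<close> at
  \<open>exp (- N)\<close> has slope \<open>N - 1\<close> and intercept \<open>exp (- N)\<close>;
  the slope is rounded up to \<open>N\<close>. For \<open>r \<ge> 1\<close> and for
  \<open>r = 0\<close> the left side vanishes.\<close>

lemma log_plus_linear_bound:
  assumes "0 \<le> r" "0 \<le> N"
  shows "r * log_plus (1 / r) \<le> N * r + exp (- N)"
proof (cases "0 < r \<and> r < 1")
  case True
  then have "ln (exp (- N) / r) \<le> exp (- N) / r - 1" by (intro ln_le_minus_one) auto
  moreover have "ln (exp (- N) / r) = - N - ln r" using True by (simp add: ln_div)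
  ultimately have "r * (- ln r) \<le> r * (N + exp (- N) / r - 1)"
    using True by (intro mult_left_mono) auto
  also have "\<dots> \<le> N * r + exp (- N)" using True by (simp add: algebra_simps)
  finally have "r * (- ln r) \<le> N * r + exp (- N)" .
  moreover have "log_plus (1 / r) = - ln r"
    using True by (simp add: log_plus_def max_def ln_div)
  ultimately show ?thesis by simp
next
  case False
  then have 0: "r * log_plus (1 / r) = 0" using assms by (auto simp: log_plus_def max_def)
  show ?thesis unfolding 0 using assms by (intro add_nonneg_nonneg mult_nonneg_nonneg) auto
qed

lemma log_plus_le: "0 \<le> z \<Longrightarrow> log_plus z \<le> z"
  using ln_le_minus_one[of "max 1 z"] by (auto simp: log_plus_def max_def)

text \<open>The grouping on the right anticipates the splitting of the drift: the first bracket
  serves as clamping level and the last summand bounds the remainder.\<close>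

lemma log_modulus_linear_bound:
  assumes nonneg: "c3 \<ge> 0" "c4 \<ge> 0" and N: "0 \<le> N"
    and b: "\<And>u v. \<bar>b u - b v\<bar> \<le> c3 * \<bar>u - v\<bar> * log_plus (1 / \<bar>u - v\<bar>)
           + c4 * log_plus (max \<bar>u\<bar> \<bar>v\<bar>) * \<bar>u - v\<bar> + c5 * \<bar>u - v\<bar>"
  shows "\<bar>b u - b v\<bar> \<le> ((c3 * N + c5) * \<bar>u - v\<bar> + c3 * exp (- N)) + c4 * ((\<bar>u\<bar> + \<bar>v\<bar>) * \<bar>u - v\<bar>)"
proof -
  have "c3 * (\<bar>u - v\<bar> * log_plus (1 / \<bar>u - v\<bar>)) \<le> c3 * (N * \<bar>u - v\<bar> + exp (- N))"
    using nonneg N by (intro mult_left_mono log_plus_linear_bound) auto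
  moreover have "c4 * (log_plus (max \<bar>u\<bar> \<bar>v\<bar>) * \<bar>u - v\<bar>) \<le> c4 * ((\<bar>u\<bar> + \<bar>v\<bar>) * \<bar>u - v\<bar>)"
  proof (intro mult_left_mono mult_right_mono)
    have "log_plus (max \<bar>u\<bar> \<bar>v\<bar>) \<le> max \<bar>u\<bar> \<bar>v\<bar>" by (rule log_plus_le) simp
    also have "\<dots> \<le> \<bar>u\<bar> + \<bar>v\<bar>" by simp
    finally show "log_plus (max \<bar>u\<bar> \<bar>v\<bar>) \<le> \<bar>u\<bar> + \<bar>v\<bar>" .
  qed (use nonneg in auto)
  ultimately show ?thesis using b[of u v] by (simp add: algebra_simps)
qed

text \<open>The modulus makes \<open>b\<close> continuous: first \<open>N\<close> is taken so large
  that the constant \<open>c3 * exp (- N)\<close> is below \<open>e / 2\<close>, then the remaining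
  terms vanish as \<open>u\<close> tends to \<open>x\<close> with this \<open>N\<close>
  fixed.\<close>

lemma log_modulus_measurable:
  fixes b :: "real \<Rightarrow> real"
  assumes nonneg: "c3 \<ge> 0" "c4 \<ge> 0"
    and b: "\<And>u v. \<bar>b u - b v\<bar> \<le> c3 * \<bar>u - v\<bar> * log_plus (1 / \<bar>u - v\<bar>)
           + c4 * log_plus (max \<bar>u\<bar> \<bar>v\<bar>) * \<bar>u - v\<bar> + c5 * \<bar>u - v\<bar>"
  shows "b \<in> borel_measurable borel"
proof (rule borel_measurable_continuous_onI, unfold continuous_on_eq_continuous_at[OF open_UNIV], rule ballI)
  fix x
  show "isCont b x" unfolding isCont_def
  proof (rule tendstoI)
    fix e :: real assume e: "e > 0"
    have "((\<lambda>N::real. c3 * exp (- N)) \<longlongrightarrow> c3 * 0) at_top"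
      by (intro tendsto_intros filterlim_compose[OF exp_at_bot] filterlim_uminus_at_bot_at_top)
    then have "\<forall>\<^sub>F N in at_top. c3 * exp (- N) < e / 2"
      using e by (intro order_tendstoD(2)) auto
    then have "\<forall>\<^sub>F N in at_top. c3 * exp (- N) < e / 2 \<and> 0 \<le> N"
      using eventually_ge_at_top[of 0] by eventually_elim simp
    then obtain N where N: "c3 * exp (- N) < e / 2" "0 \<le> N"
      by (auto dest: eventually_happens)
    have "((\<lambda>u. (c3 * N + c5) * \<bar>u - x\<bar> + c4 * ((\<bar>u\<bar> + \<bar>x\<bar>) * \<bar>u - x\<bar>)) \<longlongrightarrow>
        (c3 * N + c5) * \<bar>x - x\<bar> + c4 * ((\<bar>x\<bar> + \<bar>x\<bar>) * \<bar>x - x\<bar>)) (at x)"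
      by (intro tendsto_intros)
    then have "\<forall>\<^sub>F u in at x. (c3 * N + c5) * \<bar>u - x\<bar> + c4 * ((\<bar>u\<bar> + \<bar>x\<bar>) * \<bar>u - x\<bar>) < e / 2"
      using e by (intro order_tendstoD(2)) auto
    then show "\<forall>\<^sub>F u in at x. dist (b u) (b x) < e"
    proof eventually_elim
      case (elim u)
      then show ?case
        using log_modulus_linear_bound[OF nonneg N(2) b, of u x] N(1) unfolding dist_real_def by linarith
    qed
  qed
qed

section \<open>Splitting the drift and estimating its two parts\<close>

definition clamp_abs :: "real \<Rightarrow> real \<Rightarrow> real" where
  "clamp_abs m f = max (- m) (min m f)"

text \<open>The second and third bounds pass integrability from \<open>f\<close> to both of its
  parts; the fourth turns a bound of \<open>f\<close> by a sum into a bound of the remainder by the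
  second summand.\<close>

lemma clamp_abs_bounds:
  assumes "0 \<le> m"
  shows "\<bar>clamp_abs m f\<bar> \<le> m" "\<bar>clamp_abs m f\<bar> \<le> \<bar>f\<bar>" "\<bar>f - clamp_abs m f\<bar> \<le> \<bar>f\<bar>"
    "\<bar>f\<bar> \<le> m + k \<Longrightarrow> 0 \<le> k \<Longrightarrow> \<bar>f - clamp_abs m f\<bar> \<le> k"
  using assms by (auto simp: clamp_abs_def max_def min_def)

text \<open>If \<open>w\<close> vanishes almost everywhere then so does \<open>f\<close>; this is
  the source of the case distinction in the Gronwall lemma. Otherwise the factor \<open>2\<close>
  comes from the square of a sum, and \<open>1 \<le> N\<close> allows \<open>c5\<close> to be
  absorbed into \<open>c5 * N\<close>.\<close>

lemma clamped_part_square_integral: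
  fixes f w :: "real \<Rightarrow> real" and c N :: real
  assumes [measurable]: "w \<in> borel_measurable unit_lborel" "f \<in> borel_measurable unit_lborel"
    and N: "1 \<le> N" and c: "0 \<le> c3" "0 \<le> c5"
    and bound: "\<And>y. \<bar>f y\<bar> \<le> (c3 * N + c5) * \<bar>w y\<bar> + c3 * exp (- N)" and zero: "\<And>y. w y = 0 \<Longrightarrow> f y = 0"
  defines "X \<equiv> \<integral>\<^sup>+y. ennreal ((w y)\<^sup>2) \<partial>unit_lborel"
  shows "(\<integral>\<^sup>+y. ennreal ((f y)\<^sup>2) \<partial>unit_lborel)
     \<le> ennreal (2 * (c3 + c5)\<^sup>2) * (if X = 0 then 0 else ennreal (N\<^sup>2) * X + ennreal (exp (- 2 * N)))"
proof (cases "X = 0")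
  case True
  then have "AE y in unit_lborel. ennreal ((w y)\<^sup>2) = 0"
    unfolding X_def by (subst (asm) nn_integral_0_iff_AE) measurable
  then have "AE y in unit_lborel. ennreal ((f y)\<^sup>2) = 0"
    by eventually_elim (simp add: zero)
  then have "(\<integral>\<^sup>+y. ennreal ((f y)\<^sup>2) \<partial>unit_lborel) = 0"
    by (subst nn_integral_0_iff_AE) measurable
  then show ?thesis by simp
next
  case False
  have pt: "(f y)\<^sup>2 \<le> 2 * (c3 + c5)\<^sup>2 * (N\<^sup>2 * (w y)\<^sup>2 + exp (- 2 * N))" for y
  proof -
    have "c3 * N + c5 * 1 \<le> c3 * N + c5 * N" using c N by (intro add_left_mono mult_left_mono) auto
    then have "(c3 * N + c5) * \<bar>w y\<bar> \<le> ((c3 + c5) * N) * \<bar>w y\<bar>"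
      by (intro mult_right_mono) (auto simp: algebra_simps)
    moreover have "c3 * exp (- N) \<le> (c3 + c5) * exp (- N)" using c by (intro mult_right_mono) auto
    ultimately have "\<bar>f y\<bar> \<le> (c3 + c5) * (N * \<bar>w y\<bar> + exp (- N))"
      using bound[of y] by (simp add: algebra_simps)
    then have "\<bar>f y\<bar>\<^sup>2 \<le> ((c3 + c5) * (N * \<bar>w y\<bar> + exp (- N)))\<^sup>2" by (rule power_mono) simp
    also have "\<dots> = (c3 + c5)\<^sup>2 * (N * \<bar>w y\<bar> + exp (- N))\<^sup>2" by (simp add: power_mult_distrib)
    also have "\<dots> \<le> (c3 + c5)\<^sup>2 * (2 * ((N * \<bar>w y\<bar>)\<^sup>2 + (exp (- N))\<^sup>2))"
    proof (intro mult_left_mono)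
      show "(N * \<bar>w y\<bar> + exp (- N))\<^sup>2 \<le> 2 * ((N * \<bar>w y\<bar>)\<^sup>2 + (exp (- N))\<^sup>2)"
        using zero_le_power2[of "N * \<bar>w y\<bar> - exp (- N)"] by (simp add: power2_sum power2_diff)
    qed simp
    also have "(exp (- N))\<^sup>2 = exp (- 2 * N)" by (simp flip: exp_of_nat_mult)
    finally show ?thesis by (simp add: power_mult_distrib algebra_simps)
  qed
  have "(\<integral>\<^sup>+y. ennreal ((f y)\<^sup>2) \<partial>unit_lborel)
      \<le> (\<integral>\<^sup>+y. ennreal (2 * (c3 + c5)\<^sup>2) * (ennreal (N\<^sup>2) * ennreal ((w y)\<^sup>2) + ennreal (exp (- 2 * N))) \<partial>unit_lborel)"
  proof (intro nn_integral_mono)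
    fix y
    have "ennreal ((f y)\<^sup>2) \<le> ennreal (2 * (c3 + c5)\<^sup>2 * (N\<^sup>2 * (w y)\<^sup>2 + exp (- 2 * N)))"
      by (intro ennreal_leI pt)
    also have "\<dots> = ennreal (2 * (c3 + c5)\<^sup>2) * (ennreal (N\<^sup>2) * ennreal ((w y)\<^sup>2) + ennreal (exp (- 2 * N)))"
      by (subst ennreal_mult, simp, simp, subst ennreal_plus, simp, simp, subst ennreal_mult) simp_all
    finally show "ennreal ((f y)\<^sup>2) \<le> ennreal (2 * (c3 + c5)\<^sup>2) * (ennreal (N\<^sup>2) * ennreal ((w y)\<^sup>2) + ennreal (exp (- 2 * N)))" .
  qed
  also have "\<dots> = ennreal (2 * (c3 + c5)\<^sup>2) * (ennreal (N\<^sup>2) * X + ennreal (exp (- 2 * N)))"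
    unfolding X_def
    by (subst nn_integral_cmult, measurable, subst nn_integral_add, measurable)
       (simp add: nn_integral_cmult emeasure_restrict_space)
  finally show ?thesis using False by simp
qed

text \<open>Cauchy-Schwarz in space. Of the factor \<open>4\<close>, one \<open>2\<close> comes from
  squaring \<open>\<bar>u\<bar> + \<bar>v\<bar>\<close> and the other from adding the two bounds
  \<open>R\<close>.\<close>

lemma quadratic_part_integral:
  fixes f u v w :: "real \<Rightarrow> real"
  assumes [measurable]: "u \<in> borel_measurable unit_lborel" "v \<in> borel_measurable unit_lborel"
      "w \<in> borel_measurable unit_lborel"
    and c: "0 \<le> c" and bound: "\<And>y. \<bar>f y\<bar> \<le> c * ((\<bar>u y\<bar> + \<bar>v y\<bar>) * \<bar>w y\<bar>)"
    and R: "(\<integral>\<^sup>+y. ennreal ((u y)\<^sup>2) \<partial>unit_lborel) \<le> ennreal R" "(\<integral>\<^sup>+y. ennreal ((v y)\<^sup>2) \<partial>unit_lborel) \<le> ennreal R" "0 \<le> R"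
  shows "(\<integral>\<^sup>+y. ennreal \<bar>f y\<bar> \<partial>unit_lborel)\<^sup>2 \<le> ennreal (4 * c\<^sup>2 * R) * (\<integral>\<^sup>+y. ennreal ((w y)\<^sup>2) \<partial>unit_lborel)"
proof -
  let ?I = "\<lambda>g. \<integral>\<^sup>+y. ennreal ((g y)\<^sup>2) \<partial>unit_lborel"
  have "(\<integral>\<^sup>+y. ennreal \<bar>f y\<bar> \<partial>unit_lborel) \<le> (\<integral>\<^sup>+y. ennreal (c * (\<bar>u y\<bar> + \<bar>v y\<bar>)) * ennreal \<bar>w y\<bar> \<partial>unit_lborel)"
    using bound c by (intro nn_integral_mono) (simp add: ennreal_mult''[symmetric] mult.assoc ennreal_leI)
  then have "(\<integral>\<^sup>+y. ennreal \<bar>f y\<bar> \<partial>unit_lborel)\<^sup>2 \<le> (\<integral>\<^sup>+y. ennreal (c * (\<bar>u y\<bar> + \<bar>v y\<bar>)) * ennreal \<bar>w y\<bar> \<partial>unit_lborel)\<^sup>2"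
    by (rule power_mono) simp
  also have "\<dots> \<le> (\<integral>\<^sup>+y. ennreal (c * (\<bar>u y\<bar> + \<bar>v y\<bar>)) ^ 2 \<partial>unit_lborel) * (\<integral>\<^sup>+y. ennreal \<bar>w y\<bar> ^ 2 \<partial>unit_lborel)"
    by (rule Cauchy_Schwarz_nn_integral) measurable
  also have "(\<integral>\<^sup>+y. ennreal \<bar>w y\<bar> ^ 2 \<partial>unit_lborel) = ?I w" by (simp add: ennreal_power)
  also have "(\<integral>\<^sup>+y. ennreal (c * (\<bar>u y\<bar> + \<bar>v y\<bar>)) ^ 2 \<partial>unit_lborel)
      \<le> (\<integral>\<^sup>+y. ennreal (2 * c\<^sup>2) * (ennreal ((u y)\<^sup>2) + ennreal ((v y)\<^sup>2)) \<partial>unit_lborel)"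
  proof (intro nn_integral_mono)
    fix y
    have "(c * (\<bar>u y\<bar> + \<bar>v y\<bar>))\<^sup>2 \<le> c\<^sup>2 * (2 * ((u y)\<^sup>2 + (v y)\<^sup>2))"
      unfolding power_mult_distrib using zero_le_power2[of "\<bar>u y\<bar> - \<bar>v y\<bar>"]
      by (intro mult_left_mono) (auto simp: power2_sum power2_diff)
    then have "ennreal ((c * (\<bar>u y\<bar> + \<bar>v y\<bar>))\<^sup>2) \<le> ennreal (2 * c\<^sup>2 * ((u y)\<^sup>2 + (v y)\<^sup>2))"
      by (intro ennreal_leI) (simp only: mult_ac)
    also have "\<dots> = ennreal (2 * c\<^sup>2) * (ennreal ((u y)\<^sup>2) + ennreal ((v y)\<^sup>2))"
      by (subst ennreal_mult, simp, simp, subst ennreal_plus) simp_all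
    finally show "ennreal (c * (\<bar>u y\<bar> + \<bar>v y\<bar>)) ^ 2 \<le> ennreal (2 * c\<^sup>2) * (ennreal ((u y)\<^sup>2) + ennreal ((v y)\<^sup>2))"
      using c by (simp add: ennreal_power)
  qed
  also have "\<dots> = ennreal (2 * c\<^sup>2) * (?I u + ?I v)"
    by (subst nn_integral_cmult, measurable, subst nn_integral_add) auto
  also have "\<dots> \<le> ennreal (2 * c\<^sup>2) * (ennreal R + ennreal R)"
    by (intro mult_left_mono add_mono R) simp
  also have "\<dots> = ennreal (4 * c\<^sup>2 * R)"
    using R by (simp flip: ennreal_plus ennreal_mult' add: algebra_simps)
  finally show ?thesis by (simp add: mult_right_mono)
qed

text \<open>The absolute value is taken after the space integral. The semigroup estimates concern
  the value of that integral, in which cancellation of the sine series matters, and not the integral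
  of the absolute kernel.\<close>

lemma abs_set_integral_le_iterated:
  fixes h :: "real \<Rightarrow> real \<Rightarrow> real"
  assumes "set_integrable lborel ({0..t} \<times> {0..1}) (\<lambda>(s, y). h s y)"
  shows "ennreal \<bar>set_lebesgue_integral lborel ({0..t} \<times> {0..1}) (\<lambda>(s, y). h s y)\<bar>
     \<le> (\<integral>\<^sup>+s. ennreal \<bar>LINT y|unit_lborel. h s y\<bar> * indicator {0..t} s \<partial>lborel)"
proof -
  let ?f = "\<lambda>x. indicator ({0..t} \<times> {0..1}) x *\<^sub>R (case x of (s, y) \<Rightarrow> h s y) :: real"
  have f: "integrable (lborel \<Otimes>\<^sub>M lborel) ?f"
    using assms unfolding set_integrable_def lborel_prod .
  have inner: "(LINT y|lborel. ?f (s, y)) = indicator {0..t} s * (LINT y|unit_lborel. h s y)" for s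
  proof -
    have "(LINT y|lborel. ?f (s, y)) = (LINT y|lborel. indicator {0..t} s * (indicator {0..1} y *\<^sub>R h s y))"
      by (intro Bochner_Integration.integral_cong) (auto simp: indicator_def)
    also have "\<dots> = indicator {0..t} s * (LINT y|unit_lborel. h s y)"
      by (subst integral_restrict_space) auto
    finally show ?thesis .
  qed
  have "set_lebesgue_integral lborel ({0..t} \<times> {0..1}) (\<lambda>(s, y). h s y) = (LINT s|lborel. LINT y|lborel. ?f (s, y))"
    unfolding set_lebesgue_integral_def lborel_pair.integral_fst'[OF f] by (simp add: lborel_prod)
  also have "ennreal \<bar>\<dots>\<bar> \<le> (\<integral>\<^sup>+s. ennreal (norm (LINT y|lborel. ?f (s, y))) \<partial>lborel)"
    using integral_norm_bound_ennreal[OF lborel_pair.integrable_fst'[OF f]] by simp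
  also have "\<dots> = (\<integral>\<^sup>+s. ennreal \<bar>LINT y|unit_lborel. h s y\<bar> * indicator {0..t} s \<partial>lborel)"
    unfolding inner by (intro nn_integral_cong) (auto simp: indicator_def)
  finally show ?thesis .
qed

text \<open>The factor \<open>1 / l\<close> is the integral of the squared weight
  \<open>exp (- (l * (t - s)))\<close>. It is the first of the two factors that keep the rate of the
  Gronwall weight linear in \<open>N\<close>.\<close>

lemma weighted_Cauchy_Schwarz:
  fixes a :: "real \<Rightarrow> real"
  assumes [measurable]: "a \<in> borel_measurable borel" and l: "l > 0" and t: "0 \<le> t"
  shows "(\<integral>\<^sup>+s. ennreal \<bar>a s\<bar> * indicator {0..t} s \<partial>lborel)\<^sup>2
     \<le> ennreal (1 / l) * (\<integral>\<^sup>+s. ennreal (exp (l * (t - s))) * ennreal ((a s)\<^sup>2) * indicator {0..t} s \<partial>lborel)"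
proof -
  let ?r = "\<lambda>s. ennreal (exp (- (l * (t - s)) / 2)) * indicator {0..t} s"
  let ?k = "\<lambda>s. ennreal (exp (l * (t - s) / 2) * \<bar>a s\<bar>) * indicator {0..t} s"
  have "ennreal \<bar>a s\<bar> * indicator {0..t} s = ?r s * ?k s" for s
    by (auto simp: indicator_def ennreal_mult'[symmetric] mult.assoc[symmetric] exp_add[symmetric])
  then have "(\<integral>\<^sup>+s. ennreal \<bar>a s\<bar> * indicator {0..t} s \<partial>lborel)\<^sup>2 = (\<integral>\<^sup>+s. ?r s * ?k s \<partial>lborel)\<^sup>2"
    by simp
  also have "\<dots> \<le> (\<integral>\<^sup>+s. ?r s ^ 2 \<partial>lborel) * (\<integral>\<^sup>+s. ?k s ^ 2 \<partial>lborel)"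
    by (rule Cauchy_Schwarz_nn_integral) measurable
  also have "(\<integral>\<^sup>+s. ?r s ^ 2 \<partial>lborel) = (\<integral>\<^sup>+s. ennreal (exp (- (l * (t - s)))) * indicator {0..t} s \<partial>lborel)"
    by (intro nn_integral_cong) (auto simp: indicator_def ennreal_power simp flip: exp_of_nat_mult)
  also have "(\<integral>\<^sup>+s. ?k s ^ 2 \<partial>lborel) = (\<integral>\<^sup>+s. ennreal (exp (l * (t - s))) * ennreal ((a s)\<^sup>2) * indicator {0..t} s \<partial>lborel)"
    by (intro nn_integral_cong)
       (auto simp: indicator_def ennreal_power power_mult_distrib ennreal_mult'[symmetric] simp flip: exp_of_nat_mult)
  finally show ?thesis
    using nn_integral_exp_kernel_le[OF l t] by (meson order_trans mult_right_mono zero_le)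
qed

lemma Cauchy_Schwarz_interval:
  fixes a :: "real \<Rightarrow> real"
  assumes [measurable]: "a \<in> borel_measurable borel" and t: "0 \<le> t"
  shows "(\<integral>\<^sup>+s. ennreal \<bar>a s\<bar> * indicator {0..t} s \<partial>lborel)\<^sup>2
     \<le> ennreal t * (\<integral>\<^sup>+s. ennreal ((a s)\<^sup>2) * indicator {0..t} s \<partial>lborel)"
proof -
  have "ennreal \<bar>a s\<bar> * indicator {0..t} s = indicator {0..t} s * (ennreal \<bar>a s\<bar> * indicator {0..t} s)" for s
    by (auto simp: indicator_def)
  then have "(\<integral>\<^sup>+s. ennreal \<bar>a s\<bar> * indicator {0..t} s \<partial>lborel)\<^sup>2
      = (\<integral>\<^sup>+s. indicator {0..t} s * (ennreal \<bar>a s\<bar> * indicator {0..t} s) \<partial>lborel)\<^sup>2" by simp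
  also have "\<dots> \<le> (\<integral>\<^sup>+s. indicator {0..t} s ^ 2 \<partial>lborel) * (\<integral>\<^sup>+s. (ennreal \<bar>a s\<bar> * indicator {0..t} s) ^ 2 \<partial>lborel)"
    by (rule Cauchy_Schwarz_nn_integral) measurable
  also have "(\<integral>\<^sup>+s. indicator {0..t} s ^ 2 \<partial>lborel) = (\<integral>\<^sup>+s. indicator {0..t} s \<partial>lborel)"
    by (intro nn_integral_cong) (auto simp: indicator_def)
  also have "(\<integral>\<^sup>+s. indicator {0..t} s \<partial>lborel) = ennreal t" using t by simp
  also have "(\<integral>\<^sup>+s. (ennreal \<bar>a s\<bar> * indicator {0..t} s) ^ 2 \<partial>lborel) = (\<integral>\<^sup>+s. ennreal ((a s)\<^sup>2) * indicator {0..t} s \<partial>lborel)"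
    by (intro nn_integral_cong) (auto simp: indicator_def ennreal_power)
  finally show ?thesis .
qed

section \<open>Differences of Walsh integrals and adaptedness\<close>

context space_time_white_noise
begin

text \<open>Linearity is built into the approximation: an approximating process for the first
  integral is concatenated with the negative of one for the second, and the localised bound is
  applied to the result.\<close>

lemma walsh_difference_bound:
  assumes w1: "has_walsh_integral M F W t \<Phi>1 J1" and w2: "has_walsh_integral M F W t \<Phi>2 J2"
    and t: "0 \<le> t" and Z: "stop_time M F t Z"
  shows "(\<integral>\<^sup>+w. (if Z t w then ennreal ((J1 w - J2 w)\<^sup>2) else 0) \<partial>M)
     \<le> (\<integral>\<^sup>+w. stopped_energy t (\<lambda>s. Z s w) (\<lambda>s y. \<Phi>1 s y w - \<Phi>2 s y w) \<partial>M)"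
proof -
  \<comment> \<open>\<open>has_walsh_integral\<close> gives measurability on the rectangle only; the
    energies do not see the extension by zero.\<close>
  define E1 where "E1 s y w = (if s \<in> {0..t} \<and> y \<in> {0..1} then \<Phi>1 s y w else 0)" for s y w
  define E2 where "E2 s y w = (if s \<in> {0..t} \<and> y \<in> {0..1} then \<Phi>2 s y w else 0)" for s y w
  have E1: "jointly_measurable M E1"
    unfolding E1_def
    by (rule measurable_extend_triple[OF w1[unfolded has_walsh_integral_def, THEN conjunct1]]) simp_all
  have E2: "jointly_measurable M E2"
    unfolding E2_def
    by (rule measurable_extend_triple[OF w2[unfolded has_walsh_integral_def, THEN conjunct1]]) simp_all
  have J[measurable]: "J1 \<in> borel_measurable M" "J2 \<in> borel_measurable M"
    using w1 w2 unfolding has_walsh_integral_def by blast+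
  obtain \<Psi>1 where \<Psi>1: "\<And>n. is_simple M F (\<Psi>1 n)"
    "tendsto_zero_in_prob M (\<lambda>n w. energy t (\<lambda>s y. simple_value (\<Psi>1 n) s y w - \<Phi>1 s y w))"
    "tendsto_zero_in_prob M (\<lambda>n w. ennreal \<bar>simple_integral W t (\<Psi>1 n) w - J1 w\<bar>)"
    using w1 unfolding has_walsh_integral_def energy_set_nn_integral by blast
  obtain \<Psi>2 where \<Psi>2: "\<And>n. is_simple M F (\<Psi>2 n)"
    "tendsto_zero_in_prob M (\<lambda>n w. energy t (\<lambda>s y. simple_value (\<Psi>2 n) s y w - \<Phi>2 s y w))"
    "tendsto_zero_in_prob M (\<lambda>n w. ennreal \<bar>simple_integral W t (\<Psi>2 n) w - J2 w\<bar>)"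
    using w2 unfolding has_walsh_integral_def energy_set_nn_integral by blast
  let ?X1 = "\<lambda>n w. energy t (\<lambda>s y. simple_value (\<Psi>1 n) s y w - E1 s y w)"
  let ?X2 = "\<lambda>n w. energy t (\<lambda>s y. simple_value (\<Psi>2 n) s y w - E2 s y w)"
  let ?Y1 = "\<lambda>n w. ennreal \<bar>simple_integral W t (\<Psi>1 n) w - J1 w\<bar>"
  let ?Y2 = "\<lambda>n w. ennreal \<bar>simple_integral W t (\<Psi>2 n) w - J2 w\<bar>"
  have X1: "?X1 = (\<lambda>n w. energy t (\<lambda>s y. simple_value (\<Psi>1 n) s y w - \<Phi>1 s y w))"
    and X2: "?X2 = (\<lambda>n w. energy t (\<lambda>s y. simple_value (\<Psi>2 n) s y w - \<Phi>2 s y w))"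
    by (auto intro!: ext energy_cong simp: E1_def E2_def)
  have [measurable]: "?X1 n \<in> borel_measurable M" "?X2 n \<in> borel_measurable M"
      "?Y1 n \<in> borel_measurable M" "?Y2 n \<in> borel_measurable M" for n
    by (intro measurable_energy measurable_triple_diff measurable_simple_value_triple
        measurable_simple_integral_diff \<Psi>1 \<Psi>2 E1 E2 J)+
  \<comment> \<open>The errors of the two integrals are added before a subsequence is chosen, so
    that one subsequence serves both.\<close>
  have X: "tendsto_zero_in_prob M (\<lambda>n w. ?X1 n w + ?X2 n w)"
    by (rule tendsto_zero_in_prob_add) (measurable, use \<Psi>1(2) \<Psi>2(2) in \<open>simp_all only: X1 X2\<close>)
  have Y: "tendsto_zero_in_prob M (\<lambda>n w. ?Y1 n w + ?Y2 n w)"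
    by (rule tendsto_zero_in_prob_add) (measurable, use \<Psi>1(3) \<Psi>2(3) in simp_all)
  obtain r where r: "AE w in M. (\<lambda>n. ?X1 (r n) w + ?X2 (r n) w) \<longlonglongrightarrow> 0"
      "AE w in M. (\<lambda>n. ?Y1 (r n) w + ?Y2 (r n) w) \<longlonglongrightarrow> 0"
    by (rule tendsto_zero_in_prob_subseq[OF _ _ X Y]) measurable
  let ?\<Psi> = "\<lambda>n. \<Psi>1 (r n) @ neg_simple (\<Psi>2 (r n))"
  have \<Psi>: "is_simple M F (?\<Psi> n)" for n
    unfolding is_simple_append by (intro conjI is_simple_neg \<Psi>1(1) \<Psi>2(1))
  have lim_energy: "AE w in M. (\<lambda>n. energy t (\<lambda>s y. simple_value (?\<Psi> n) s y w - (E1 s y w - E2 s y w))) \<longlonglongrightarrow> 0"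
    using r(1) AE_space
  proof eventually_elim
    case (elim w)
    have le: "energy t (\<lambda>s y. simple_value (?\<Psi> n) s y w - (E1 s y w - E2 s y w)) \<le> 2 * (?X1 (r n) w + ?X2 (r n) w)" for n
    proof -
      let ?f = "\<lambda>s y. simple_value (?\<Psi> n) s y w - (E1 s y w - E2 s y w)"
      let ?g = "\<lambda>s y. simple_value (\<Psi>1 (r n)) s y w - E1 s y w"
      have "energy t ?f = stopped_energy t (\<lambda>_. True) ?f" by (simp add: stopped_energy_def energy_def)
      also have "\<dots> \<le> ennreal (1 + 1) * stopped_energy t (\<lambda>_. True) ?g + ennreal (1 + 1 / 1) * energy t (\<lambda>s y. ?f s y - ?g s y)"
        by (rule stopped_energy_split[OF
              measurable_triple_section[OF measurable_triple_diff[OF measurable_simple_value_triple[OF \<Psi>]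
                measurable_triple_diff[OF E1 E2]] elim(2)]
              measurable_triple_section[OF measurable_triple_diff[OF measurable_simple_value_triple[OF \<Psi>1(1)] E1] elim(2)]])
           simp_all
      also have "energy t (\<lambda>s y. ?f s y - ?g s y) = ?X2 (r n) w"
        unfolding energy_def simple_value_append simple_value_neg
        by (simp add: power2_commute)
      finally show ?thesis by (simp add: stopped_energy_def energy_def distrib_left)
    qed
    have "(\<lambda>n. 2 * (?X1 (r n) w + ?X2 (r n) w)) \<longlonglongrightarrow> 2 * 0"
      by (intro ennreal_tendsto_cmult elim) simp
    then have "(\<lambda>n. 2 * (?X1 (r n) w + ?X2 (r n) w)) \<longlonglongrightarrow> 0" by simp
    then show ?case
      by (rule tendsto_sandwich[OF always_eventually always_eventually tendsto_const, rotated -1]) (use le in auto)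
  qed
  have lim_int: "AE w in M. (\<lambda>n. ennreal \<bar>simple_integral W t (?\<Psi> n) w - (J1 w - J2 w)\<bar>) \<longlonglongrightarrow> 0"
    using r(2)
  proof eventually_elim
    case (elim w)
    have "ennreal \<bar>simple_integral W t (?\<Psi> n) w - (J1 w - J2 w)\<bar> \<le> ?Y1 (r n) w + ?Y2 (r n) w" for n
    proof -
      have "ennreal \<bar>simple_integral W t (?\<Psi> n) w - (J1 w - J2 w)\<bar>
          \<le> ennreal (\<bar>simple_integral W t (\<Psi>1 (r n)) w - J1 w\<bar> + \<bar>simple_integral W t (\<Psi>2 (r n)) w - J2 w\<bar>)"
        unfolding simple_integral_append simple_integral_neg by (rule ennreal_leI) linarith
      also have "\<dots> = ?Y1 (r n) w + ?Y2 (r n) w" by (rule ennreal_plus) simp_all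
      finally show ?thesis .
    qed
    then show ?case
      by (intro tendsto_sandwich[OF always_eventually always_eventually tendsto_const elim]) auto
  qed
  have "(\<integral>\<^sup>+w. (if Z t w then ennreal ((J1 w - J2 w)\<^sup>2) else 0) \<partial>M)
     \<le> (\<integral>\<^sup>+w. stopped_energy t (\<lambda>s. Z s w) (\<lambda>s y. E1 s y w - E2 s y w) \<partial>M)"
    by (rule localized_walsh_core[OF measurable_triple_diff[OF E1 E2] _ \<Psi> lim_energy lim_int t Z]) measurable
  also have "\<dots> = (\<integral>\<^sup>+w. stopped_energy t (\<lambda>s. Z s w) (\<lambda>s y. \<Phi>1 s y w - \<Phi>2 s y w) \<partial>M)"
    by (intro nn_integral_cong stopped_energy_cong) (simp add: E1_def E2_def)
  finally show ?thesis .
qed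

text \<open>Completeness of the filtration is used here: the set where the two variables differ, and
  each of its subsets, already belongs to \<open>F 0\<close>.\<close>

lemma measurable_F_AE_cong:
  fixes X Y :: "'w \<Rightarrow> real"
  assumes X: "X \<in> borel_measurable (F t)" and Y: "Y \<in> borel_measurable M"
    and eq: "AE w in M. X w = Y w" and t: "0 \<le> t"
  shows "Y \<in> borel_measurable (F t)"
proof (rule measurableI)
  fix S :: "real set" assume S: "S \<in> sets borel"
  obtain N where N: "N \<in> null_sets M" "{w \<in> space M. \<not> X w = Y w} \<subseteq> N"
    using eq unfolding eventually_ae_filter by blast
  have null: "A \<in> sets (F t)" if "A \<subseteq> N" for A
    using complete[OF N(1) that] mono[of 0 t] t by auto
  have "X -` S \<inter> space M \<in> sets (F t)"
    using measurable_sets[OF X S] unfolding space_F[OF t] .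
  moreover have "{w \<in> space M. \<not> X w = Y w} \<in> sets (F t)" by (rule null) (rule N(2))
  moreover have "Y -` S \<inter> {w \<in> space M. \<not> X w = Y w} \<in> sets (F t)" by (rule null) (use N(2) in auto)
  ultimately have "(X -` S \<inter> space M - {w \<in> space M. \<not> X w = Y w}) \<union> (Y -` S \<inter> {w \<in> space M. \<not> X w = Y w}) \<in> sets (F t)"
    by (intro sets.Un sets.Diff)
  moreover have "Y -` S \<inter> space M = (X -` S \<inter> space M - {w \<in> space M. \<not> X w = Y w}) \<union> (Y -` S \<inter> {w \<in> space M. \<not> X w = Y w})"
    by auto
  ultimately show "Y -` S \<inter> space (F t) \<in> sets (F t)"
    unfolding space_F[OF t] by (simp only:)
qed simp

lemma integrable_zero_AE:
  fixes Y :: "'w \<Rightarrow> real"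
  assumes Y: "integrable M Y" and zero: "\<And>A. A \<in> sets M \<Longrightarrow> (LINT w|M. indicator A w * Y w) = 0"
  shows "AE w in M. Y w = 0"
proof -
  have [measurable]: "Y \<in> borel_measurable M" using Y by simp
  have pos: "AE w in M. V w \<le> 0"
    if V: "integrable M V" and z: "\<And>A. A \<in> sets M \<Longrightarrow> (LINT w|M. indicator A w * V w) = 0" for V :: "'w \<Rightarrow> real"
  proof -
    have [measurable]: "V \<in> borel_measurable M" using V by simp
    let ?A = "{w \<in> space M. 0 < V w}"
    have int: "integrable M (\<lambda>w. indicator ?A w * V w)"
      by (rule integrable_bounded_mult[where C = 1]) (use V in \<open>auto simp: indicator_def\<close>)
    have "AE w in M. indicator ?A w * V w = 0"
      using z[of ?A] int by (subst integral_nonneg_eq_0_iff_AE[symmetric]) (auto simp: indicator_def)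
    then show ?thesis using AE_space by eventually_elim (auto simp: indicator_def split: if_splits)
  qed
  have "AE w in M. Y w \<le> 0" by (rule pos[OF Y zero])
  moreover have "AE w in M. - Y w \<le> 0"
  proof (rule pos)
    show "integrable M (\<lambda>w. - Y w)" using Y by (rule Bochner_Integration.integrable_minus)
    show "(LINT w|M. indicator A w * - Y w) = 0" if "A \<in> sets M" for A
      using zero[OF that] by (simp only: mult_minus_right Bochner_Integration.integral_minus minus_zero)
  qed
  ultimately show ?thesis by eventually_elim simp
qed

text \<open>Joint measurability is available with respect to \<open>M\<close> only. Comparing the integral with its
  conditional expectation given \<open>F q\<close> shows that the two agree almost surely, and \<open>F q\<close> contains the
  null sets.\<close>

lemma adapted_bounded_section_integral:
  fixes g :: "real \<Rightarrow> 'w \<Rightarrow> real"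
  assumes q: "0 \<le> q" and g: "(\<lambda>(y, w). g y w) \<in> borel_measurable (unit_lborel \<Otimes>\<^sub>M M)"
    and ad: "\<And>y. y \<in> {0..1} \<Longrightarrow> g y \<in> borel_measurable (F q)"
    and bd: "\<And>y w. \<bar>g y w\<bar> \<le> c"
  shows "(\<lambda>w. LINT y|unit_lborel. g y w) \<in> borel_measurable (F q)"
proof -
  interpret U: finite_measure unit_lborel by (rule finite_measure_unit_lborel)
  interpret P: pair_sigma_finite unit_lborel M ..
  interpret C: finite_measure_subalgebra M "F q"
    using subalg[OF q] by unfold_locales
  define G where "G w = (LINT y|unit_lborel. g y w)" for w
  define E where "E = real_cond_exp M (F q)"
  have g'[measurable]: "(\<lambda>x. g (fst x) (snd x)) \<in> borel_measurable (unit_lborel \<Otimes>\<^sub>M M)"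
    using g by (simp add: case_prod_unfold)
  have G_meas: "G \<in> borel_measurable M"
    unfolding G_def
    by (rule U.borel_measurable_lebesgue_integral)
       (use measurable_compose[OF measurable_Pair[OF measurable_snd measurable_fst] g'] in \<open>simp add: case_prod_unfold\<close>)
  have sec: "(\<lambda>y. g y w) \<in> borel_measurable unit_lborel" if "w \<in> space M" for w
    using measurable_Pair1[OF g that] by simp
  have c: "0 \<le> c" using bd[of 0] by (meson abs_ge_zero order_trans)
  have G_bd: "\<bar>G w\<bar> \<le> c" if w: "w \<in> space M" for w
  proof -
    have "\<bar>G w\<bar> \<le> (LINT y|unit_lborel. \<bar>g y w\<bar>)" unfolding G_def by (rule integral_abs_bound)
    also have "\<dots> \<le> (LINT y|unit_lborel. c)"
      using bd sec[OF w] c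
      by (intro integral_mono integrable_abs integrable_bounded_unit_lborel[where C = c]) auto
    finally show ?thesis by (simp add: measure_restrict_space)
  qed
  have G_int: "integrable M G"
    using integrable_bounded_mult[OF G_meas G_bd, of "\<lambda>_. 1"] by simp
  have swap: "(LINT w|M. X w * G w) = (LINT y|unit_lborel. LINT w|M. X w * g y w)" if X: "integrable M X" for X
  proof -
    have [measurable]: "X \<in> borel_measurable M" using X by simp
    have "integrable (unit_lborel \<Otimes>\<^sub>M M) (\<lambda>(y, w). X w * g y w)"
    proof (rule integrableI_bounded)
      show "(\<lambda>(y, w). X w * g y w) \<in> borel_measurable (unit_lborel \<Otimes>\<^sub>M M)"
        unfolding case_prod_unfold by measurable
      have "(\<integral>\<^sup>+z. ennreal (norm (case z of (y, w) \<Rightarrow> X w * g y w)) \<partial>(unit_lborel \<Otimes>\<^sub>M M))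
          \<le> (\<integral>\<^sup>+z. ennreal c * ennreal \<bar>X (snd z)\<bar> \<partial>(unit_lborel \<Otimes>\<^sub>M M))"
        using bd c by (intro nn_integral_mono)
          (auto simp: case_prod_unfold abs_mult ennreal_mult'[symmetric] mult.commute[of c] intro!: ennreal_leI mult_left_mono)
      also have "\<dots> = (\<integral>\<^sup>+y. \<integral>\<^sup>+w. ennreal c * ennreal \<bar>X w\<bar> \<partial>M \<partial>unit_lborel)"
        by (subst nn_integral_fst[symmetric]) auto
      also have "\<dots> = ennreal c * (\<integral>\<^sup>+w. ennreal \<bar>X w\<bar> \<partial>M)"
        by (simp add: nn_integral_cmult emeasure_restrict_space)
      also have "\<dots> < \<infinity>" using X by (auto simp: integrable_iff_bounded ennreal_mult_less_top)
      finally show "(\<integral>\<^sup>+z. ennreal (norm (case z of (y, w) \<Rightarrow> X w * g y w)) \<partial>(unit_lborel \<Otimes>\<^sub>M M)) < \<infinity>" .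
    qed
    from P.Fubini_integral[OF this] show ?thesis unfolding G_def by simp
  qed
  have E_meas: "E V \<in> borel_measurable (F q)" "E V \<in> borel_measurable M" for V
    unfolding E_def by (rule borel_measurable_cond_exp, rule borel_measurable_cond_exp2)
  have gM: "g y \<in> borel_measurable M" if "y \<in> {0..1}" for y by (rule measurable_F_M[OF ad[OF that] q])
  \<comment> \<open>Self-adjointness of the conditional expectation. For each fixed \<open>y\<close>
    the section is \<open>F q\<close>-measurable, so under the space integral the indicator may be
    exchanged for its conditional expectation; after swapping the integrals back, the conditional
    expectation moves over to \<open>G\<close>.\<close>
  have zero: "(LINT w|M. indicator A w * (G w - E G w)) = 0" if A: "A \<in> sets M" for A
  proof -
    let ?i = "indicator A :: 'w \<Rightarrow> real"
    have i_meas: "?i \<in> borel_measurable M" using A by simp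
    have i_int: "integrable M ?i" using A by (simp add: less_top[symmetric])
    have Ei_int: "integrable M (E ?i)" unfolding E_def by (rule C.real_cond_exp_int(1)[OF i_int])
    have EG_int: "integrable M (E G)" unfolding E_def by (rule C.real_cond_exp_int(1)[OF G_int])
    have iG: "integrable M (\<lambda>w. ?i w * G w)"
      by (rule integrable_bounded_mult[OF i_meas _ G_int, where C = 1]) (simp add: indicator_def)
    have iEG: "integrable M (\<lambda>w. ?i w * E G w)"
      by (rule integrable_bounded_mult[OF i_meas _ EG_int, where C = 1]) (simp add: indicator_def)
    have EiG: "integrable M (\<lambda>w. E ?i w * G w)"
      using integrable_bounded_mult[OF G_meas G_bd Ei_int] by (simp add: mult.commute)
    have "(LINT w|M. ?i w * G w) = (LINT y|unit_lborel. LINT w|M. ?i w * g y w)" by (rule swap[OF i_int])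
    also have "\<dots> = (LINT y|unit_lborel. LINT w|M. E ?i w * g y w)"
    proof (rule Bochner_Integration.integral_cong[OF refl])
      fix y assume "y \<in> space unit_lborel"
      then have y: "y \<in> {0..1}" by (simp add: space_restrict_space)
      have "integrable M (\<lambda>w. g y w * ?i w)" by (rule integrable_bounded_mult[OF gM[OF y] bd i_int])
      from C.real_cond_exp_intg(2)[OF this ad[OF y] i_meas]
      show "(LINT w|M. ?i w * g y w) = (LINT w|M. E ?i w * g y w)" by (simp add: E_def mult.commute)
    qed
    also have "\<dots> = (LINT w|M. E ?i w * G w)" by (rule swap[OF Ei_int, symmetric])
    also have "\<dots> = (LINT w|M. E ?i w * E G w)"
      unfolding E_def by (rule C.real_cond_exp_intg(2)[symmetric]) (use EiG E_meas G_meas in \<open>simp_all only: E_def\<close>)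
    also have "\<dots> = (LINT w|M. E G w * E ?i w)" by (simp only: mult.commute)
    also have "\<dots> = (LINT w|M. E G w * ?i w)"
      unfolding E_def by (rule C.real_cond_exp_intg(2)) (use iEG E_meas i_meas in \<open>simp_all only: E_def mult.commute\<close>)
    finally have "(LINT w|M. ?i w * G w) = (LINT w|M. ?i w * E G w)" by (simp only: mult.commute)
    then show ?thesis using iG iEG by (simp add: right_diff_distrib)
  qed
  have EG_int: "integrable M (E G)" unfolding E_def by (rule C.real_cond_exp_int(1)[OF G_int])
  have "AE w in M. G w - E G w = 0"
    by (rule integrable_zero_AE[OF Bochner_Integration.integrable_diff[OF G_int EG_int] zero])
  then have "AE w in M. E G w = G w" by eventually_elim simp
  then have "G \<in> borel_measurable (F q)"
    by (rule measurable_F_AE_cong[OF E_meas(1) G_meas _ q])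
  then show ?thesis by (simp only: G_def[abs_def])
qed

text \<open>Truncation at integers reduces this to the bounded case, and monotone convergence in the
  truncation level preserves \<open>F q\<close>-measurability.\<close>

lemma adapted_square_integral:
  fixes u :: "real \<Rightarrow> 'w \<Rightarrow> real"
  assumes q: "0 \<le> q" and u: "(\<lambda>(y, w). u y w) \<in> borel_measurable (unit_lborel \<Otimes>\<^sub>M M)"
    and ad: "\<And>y. y \<in> {0..1} \<Longrightarrow> u y \<in> borel_measurable (F q)"
  shows "(\<lambda>w. \<integral>\<^sup>+y. ennreal ((u y w)\<^sup>2) \<partial>unit_lborel) \<in> borel_measurable (F q)"
proof -
  let ?g = "\<lambda>i y w. min (real i) ((u y w)\<^sup>2)"
  have u'[measurable]: "(\<lambda>x. u (fst x) (snd x)) \<in> borel_measurable (unit_lborel \<Otimes>\<^sub>M M)"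
    using u by (simp add: case_prod_unfold)
  have meas: "(\<lambda>w. LINT y|unit_lborel. ?g i y w) \<in> borel_measurable (F q)" for i
  proof (rule adapted_bounded_section_integral[OF q])
    show "(\<lambda>(y, w). ?g i y w) \<in> borel_measurable (unit_lborel \<Otimes>\<^sub>M M)"
      unfolding case_prod_unfold by measurable
    show "(\<lambda>w. ?g i y w) \<in> borel_measurable (F q)" if "y \<in> {0..1}" for y
      by (intro borel_measurable_min borel_measurable_const borel_measurable_power ad[OF that])
    show "\<bar>?g i y w\<bar> \<le> real i" for y w by (auto simp: min_def)
  qed
  have sec: "(\<lambda>y. u y w) \<in> borel_measurable unit_lborel" if "w \<in> space M" for w
    using measurable_Pair1[OF u that] by simp
  have eq: "(\<integral>\<^sup>+y. ennreal ((u y w)\<^sup>2) \<partial>unit_lborel) = (SUP i. ennreal (LINT y|unit_lborel. ?g i y w))"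
    if w: "w \<in> space M" for w
  proof -
    note [measurable] = sec[OF w]
    have "ennreal ((u y w)\<^sup>2) = (SUP i. ennreal (?g i y w))" for y
    proof (rule antisym)
      obtain i where "(u y w)\<^sup>2 \<le> real i" using real_arch_simple by blast
      then have "ennreal ((u y w)\<^sup>2) \<le> ennreal (?g i y w)" by simp
      then show "ennreal ((u y w)\<^sup>2) \<le> (SUP i. ennreal (?g i y w))" by (rule SUP_upper2[OF UNIV_I])
      show "(SUP i. ennreal (?g i y w)) \<le> ennreal ((u y w)\<^sup>2)" by (intro SUP_least ennreal_leI) simp
    qed
    then have "(\<integral>\<^sup>+y. ennreal ((u y w)\<^sup>2) \<partial>unit_lborel) = (\<integral>\<^sup>+y. (SUP i. ennreal (?g i y w)) \<partial>unit_lborel)"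
      by simp
    also have "\<dots> = (SUP i. \<integral>\<^sup>+y. ennreal (?g i y w) \<partial>unit_lborel)"
      by (rule nn_integral_monotone_convergence_SUP)
         (auto simp: incseq_def le_fun_def intro!: ennreal_leI)
    also have "\<dots> = (SUP i. ennreal (LINT y|unit_lborel. ?g i y w))"
    proof (rule SUP_cong[OF refl])
      fix i :: nat
      have "\<bar>?g i y w\<bar> \<le> real i" for y by (auto simp: min_def)
      then have "integrable unit_lborel (\<lambda>y. ?g i y w)"
        by (rule integrable_bounded_unit_lborel[rotated]) measurable
      then show "(\<integral>\<^sup>+y. ennreal (?g i y w) \<partial>unit_lborel) = ennreal (LINT y|unit_lborel. ?g i y w)"
        by (rule nn_integral_eq_integral) simp
    qed
    finally show ?thesis .
  qed
  have "(\<lambda>w. SUP i. ennreal (LINT y|unit_lborel. ?g i y w)) \<in> borel_measurable (F q)"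
    by (rule borel_measurable_SUP[OF countableI_type measurable_compose[OF meas measurable_ennreal]])
  then show ?thesis
    by (rule measurable_cong[THEN iffD1, rotated]) (simp add: eq space_F[OF q])
qed

end

section \<open>Paths in \<open>L\<^sup>2\<close>\<close>

text \<open>Extended-valued, so that it is meaningful for every path and measurable in the path
  before square integrability is known.\<close>

definition sq_norm :: "(real \<Rightarrow> real) \<Rightarrow> ennreal" where
  "sq_norm f = (\<integral>\<^sup>+y. ennreal ((f y)\<^sup>2) \<partial>unit_lborel)"

lemma sq_norm_split:
  assumes [measurable]: "f \<in> borel_measurable unit_lborel" "g \<in> borel_measurable unit_lborel" and d: "d > 0"
  shows "sq_norm f \<le> ennreal (1 + d) * sq_norm g + ennreal (1 + 1 / d) * sq_norm (\<lambda>y. f y - g y)"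
proof -
  have "sq_norm f \<le> (\<integral>\<^sup>+y. ennreal (1 + d) * ennreal ((g y)\<^sup>2) + ennreal (1 + 1 / d) * ennreal ((f y - g y)\<^sup>2) \<partial>unit_lborel)"
    unfolding sq_norm_def
  proof (intro nn_integral_mono)
    fix y
    have "ennreal ((f y)\<^sup>2) \<le> ennreal ((1 + d) * (g y)\<^sup>2 + (1 + 1 / d) * (f y - g y)\<^sup>2)"
      by (intro ennreal_leI square_split d)
    also have "\<dots> = ennreal (1 + d) * ennreal ((g y)\<^sup>2) + ennreal (1 + 1 / d) * ennreal ((f y - g y)\<^sup>2)"
      using d by (subst ennreal_plus) (simp_all add: ennreal_mult'')
    finally show "ennreal ((f y)\<^sup>2) \<le> ennreal (1 + d) * ennreal ((g y)\<^sup>2) + ennreal (1 + 1 / d) * ennreal ((f y - g y)\<^sup>2)" .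
  qed
  also have "\<dots> = ennreal (1 + d) * sq_norm g + ennreal (1 + 1 / d) * sq_norm (\<lambda>y. f y - g y)"
    unfolding sq_norm_def by (subst nn_integral_add) (auto simp: nn_integral_cmult)
  finally show ?thesis .
qed

lemma sq_norm_split2:
  assumes "f \<in> borel_measurable unit_lborel" "g \<in> borel_measurable unit_lborel"
  shows "sq_norm f \<le> 2 * sq_norm g + 2 * sq_norm (\<lambda>y. f y - g y)"
  using sq_norm_split[OF assms, of 1] by simp

lemma sq_norm_commute: "sq_norm (\<lambda>y. f y - g y) = sq_norm (\<lambda>y. g y - f y)"
  unfolding sq_norm_def by (simp add: power2_commute)

lemma borel_measurable_sq_norm:
  assumes "jointly_measurable M G"
    and "f \<in> borel_measurable N" "h \<in> measurable N M"
  shows "(\<lambda>z. sq_norm (\<lambda>y. G (f z) y (h z))) \<in> borel_measurable N"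
  unfolding sq_norm_def by (rule measurable_square_integral_unit[OF assms])

lemma measurable_section_unit:
  assumes "jointly_measurable M G" "w \<in> space M"
  shows "(\<lambda>y. G s y w) \<in> borel_measurable unit_lborel"
  by (rule measurable_triple_compose[OF assms(1) measurable_const measurable_ident_restrict_borel(2) measurable_const[OF assms(2)]]) simp

text \<open>The Borel analogue of \<open>path_in_C_L2\<close>, expressed through
  \<open>sq_norm\<close>.\<close>

definition L2_path :: "real \<Rightarrow> (real \<Rightarrow> real \<Rightarrow> real) \<Rightarrow> bool" where
  "L2_path T f \<longleftrightarrow> (\<forall>t\<in>{0..T}. f t \<in> borel_measurable unit_lborel \<and> sq_norm (f t) < \<infinity>) \<and>
     (\<forall>s\<in>{0..T}. ((\<lambda>t. sq_norm (\<lambda>x. f t x - f s x)) \<longlongrightarrow> 0) (at s within {0..T}))"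

lemma L2_path_near:
  assumes f: "L2_path T f" and s: "s \<in> {0..T}" and e: "e > 0"
  obtains d where "d > 0" "\<And>t. t \<in> {0..T} \<Longrightarrow> \<bar>t - s\<bar> < d \<Longrightarrow> sq_norm (\<lambda>x. f t x - f s x) < e"
proof -
  have "\<forall>\<^sub>F t in at s within {0..T}. sq_norm (\<lambda>x. f t x - f s x) < e"
    using f s e unfolding L2_path_def by (intro order_tendstoD(2)) auto
  then obtain d where d: "d > 0" "\<forall>t\<in>{0..T}. t \<noteq> s \<and> dist t s < d \<longrightarrow> sq_norm (\<lambda>x. f t x - f s x) < e"
    unfolding eventually_at by blast
  have "sq_norm (\<lambda>x. f t x - f s x) < e" if "t \<in> {0..T}" "\<bar>t - s\<bar> < d" for t
    using d(2) that e by (cases "t = s") (auto simp: sq_norm_def dist_real_def)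
  with d(1) show ?thesis by (rule that)
qed

text \<open>Compactness of the time interval. The bound is a natural number because the cut-off
  levels are exhausted along a countable sequence.\<close>

lemma L2_path_bounded:
  assumes f: "L2_path T f"
  obtains n :: nat where "\<And>t. t \<in> {0..T} \<Longrightarrow> sq_norm (f t) \<le> ennreal (real n)"
proof -
  have "\<exists>d>0. \<forall>t\<in>{0..T}. \<bar>t - s\<bar> < d \<longrightarrow> sq_norm (\<lambda>x. f t x - f s x) < 1" if "s \<in> {0..T}" for s
    using L2_path_near[OF f that, of 1] by (metis zero_less_one)
  then obtain d where d: "\<And>s. s \<in> {0..T} \<Longrightarrow> d s > 0"
      "\<And>s t. s \<in> {0..T} \<Longrightarrow> t \<in> {0..T} \<Longrightarrow> \<bar>t - s\<bar> < d s \<Longrightarrow> sq_norm (\<lambda>x. f t x - f s x) < 1"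
    by metis
  have cover: "{0..T} \<subseteq> (\<Union>s\<in>{0..T}. ball s (d s))" using d(1) by force
  obtain S where S: "S \<subseteq> {0..T}" "finite S" "{0..T} \<subseteq> (\<Union>s\<in>S. ball s (d s))"
    by (rule compactE_image[OF compact_Icc _ cover]) auto
  define B where "B = (\<Sum>s\<in>S. 2 * sq_norm (f s)) + 2"
  have "B < top"
    using S f by (auto simp: B_def L2_path_def ennreal_mult_less_top subset_iff)
  then obtain n where n: "B < of_nat n" using ennreal_Ex_less_of_nat by blast
  show ?thesis
  proof (rule that[of n])
    fix t assume t: "t \<in> {0..T}"
    then obtain s where s: "s \<in> S" "t \<in> ball s (d s)" using S by blast
    have "sq_norm (f t) \<le> 2 * sq_norm (f s) + 2 * sq_norm (\<lambda>x. f t x - f s x)"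
      using f t s S by (intro sq_norm_split2) (auto simp: L2_path_def)
    also have "\<dots> \<le> (\<Sum>s\<in>S. 2 * sq_norm (f s)) + 2 * 1"
    proof (intro add_mono mult_left_mono)
      show "2 * sq_norm (f s) \<le> (\<Sum>s\<in>S. 2 * sq_norm (f s))"
        by (rule member_le_sum) (use S s in auto)
      have "\<bar>t - s\<bar> < d s" using s(2) by (simp add: dist_real_def abs_minus_commute)
      then show "sq_norm (\<lambda>x. f t x - f s x) \<le> 1"
        using d(2)[of s t] s(1) S(1) t by (auto intro: less_imp_le)
    qed simp
    also have "\<dots> \<le> ennreal (real n)" using n by (simp add: B_def ennreal_of_nat_eq_real_of_nat less_imp_le)
    finally show "sq_norm (f t) \<le> ennreal (real n)" .
  qed
qed

text \<open>The error \<open>e\<close> is sent to zero first and the parameter \<open>d\<close> of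
  the splitting afterwards. This order preserves the constant \<open>R\<close>, which the crude
  splitting would double.\<close>

lemma L2_path_left_bound:
  assumes f: "L2_path T f" and s: "0 < s" "s \<le> T"
    and bound: "\<And>q::rat. 0 \<le> q \<Longrightarrow> of_rat q < s \<Longrightarrow> sq_norm (f (of_rat q)) \<le> ennreal R"
  shows "sq_norm (f s) \<le> ennreal R"
proof -
  have step: "sq_norm (f s) \<le> ennreal (1 + d) * ennreal R + ennreal (1 + 1 / d) * e" if d: "d > 0" and e: "e > 0" for d e
  proof -
    obtain r where r: "r > 0" "\<And>t. t \<in> {0..T} \<Longrightarrow> \<bar>t - s\<bar> < r \<Longrightarrow> sq_norm (\<lambda>x. f t x - f s x) < e"
      using L2_path_near[OF f _ e, of s] s by auto
    obtain q :: rat where q: "max 0 (s - r) < of_rat q" "of_rat q < s"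
      using of_rat_dense[of "max 0 (s - r)" s] s r(1) by auto
    have "sq_norm (f s) \<le> ennreal (1 + d) * sq_norm (f (of_rat q)) + ennreal (1 + 1 / d) * sq_norm (\<lambda>x. f s x - f (of_rat q) x)"
      using f s q d by (intro sq_norm_split) (auto simp: L2_path_def)
    also have "\<dots> \<le> ennreal (1 + d) * ennreal R + ennreal (1 + 1 / d) * e"
      using bound[of q] q r(2)[of "of_rat q"] s
      by (intro add_mono mult_left_mono) (auto simp: sq_norm_commute[of "f s"] less_imp_le)
    finally show ?thesis .
  qed
  have 1: "sq_norm (f s) \<le> ennreal (1 + d) * ennreal R" if d: "d > 0" for d
  proof (rule LIMSEQ_le_const)
    have "(\<lambda>n. inverse (real (Suc n))) \<longlonglongrightarrow> 0" by (rule LIMSEQ_inverse_real_of_nat)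
    then have "(\<lambda>n. ennreal (inverse (real (Suc n)))) \<longlonglongrightarrow> ennreal 0" by (rule tendsto_ennrealI)
    then have "(\<lambda>n. ennreal (1 + d) * ennreal R + ennreal (1 + 1 / d) * ennreal (inverse (real (Suc n))))
        \<longlonglongrightarrow> ennreal (1 + d) * ennreal R + ennreal (1 + 1 / d) * ennreal 0"
      by (intro tendsto_add tendsto_const ennreal_tendsto_cmult) auto
    then show "(\<lambda>n. ennreal (1 + d) * ennreal R + ennreal (1 + 1 / d) * ennreal (inverse (real (Suc n))))
        \<longlonglongrightarrow> ennreal (1 + d) * ennreal R" by simp
    show "\<exists>N. \<forall>n\<ge>N. sq_norm (f s) \<le> ennreal (1 + d) * ennreal R + ennreal (1 + 1 / d) * ennreal (inverse (real (Suc n)))"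
      by (intro exI[of _ 0] allI impI step d) simp
  qed
  show ?thesis
  proof (rule LIMSEQ_le_const)
    have "(\<lambda>n. ennreal (1 + inverse (real (Suc n))) * ennreal R) \<longlonglongrightarrow> ennreal (1 + 0) * ennreal R"
      by (intro tendsto_mult_ennreal tendsto_ennrealI tendsto_add tendsto_const LIMSEQ_inverse_real_of_nat) auto
    then show "(\<lambda>n. ennreal (1 + inverse (real (Suc n))) * ennreal R) \<longlonglongrightarrow> ennreal R" by simp
    show "\<exists>N. \<forall>n\<ge>N. sq_norm (f s) \<le> ennreal (1 + inverse (real (Suc n))) * ennreal R"
      by (intro exI[of _ 0] allI impI 1) simp
  qed
qed

lemma L2_path_eq_of_rat:
  assumes f: "L2_path T f" and g: "L2_path T g" and T: "0 < T"
    and eq: "\<And>q::rat. of_rat q \<in> {0..T} \<Longrightarrow> sq_norm (\<lambda>x. f (of_rat q) x - g (of_rat q) x) = 0"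
    and s: "s \<in> {0..T}"
  shows "sq_norm (\<lambda>x. f s x - g s x) = 0"
proof -
  have step: "sq_norm (\<lambda>x. f s x - g s x) \<le> 8 * ennreal e" if e: "e > 0" for e :: real
  proof -
    have e': "ennreal e > 0" using e by simp
    obtain r where r: "r > 0" "\<And>t. t \<in> {0..T} \<Longrightarrow> \<bar>t - s\<bar> < r \<Longrightarrow> sq_norm (\<lambda>x. f t x - f s x) < ennreal e"
      using L2_path_near[OF f s e'] by blast
    obtain r' where r': "r' > 0" "\<And>t. t \<in> {0..T} \<Longrightarrow> \<bar>t - s\<bar> < r' \<Longrightarrow> sq_norm (\<lambda>x. g t x - g s x) < ennreal e"
      using L2_path_near[OF g s e'] by blast
    \<comment> \<open>The maximum and minimum force the rational time into the interior of the
      interval even if \<open>s\<close> is an endpoint; \<open>0 < T\<close> makes this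
      possible.\<close>
    have "max 0 (s - min r r') < min T (s + min r r')" using r(1) r'(1) s T by auto
    then obtain q :: rat where q: "max 0 (s - min r r') < of_rat q" "of_rat q < min T (s + min r r')"
      using of_rat_dense by blast
    let ?q = "of_rat q :: real"
    have qT: "?q \<in> {0..T}" "\<bar>?q - s\<bar> < r" "\<bar>?q - s\<bar> < r'" using q by auto
    have [measurable]: "f s \<in> borel_measurable unit_lborel" "g s \<in> borel_measurable unit_lborel"
        "f ?q \<in> borel_measurable unit_lborel" "g ?q \<in> borel_measurable unit_lborel"
      using f g s qT by (auto simp: L2_path_def)
    let ?w = "\<lambda>t x. f t x - g t x"
    have "sq_norm (?w s) \<le> 2 * sq_norm (?w ?q) + 2 * sq_norm (\<lambda>x. ?w s x - ?w ?q x)"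
      by (rule sq_norm_split2) measurable
    also have "sq_norm (\<lambda>x. ?w s x - ?w ?q x) \<le> 2 * sq_norm (\<lambda>x. f ?q x - f s x) + 2 * sq_norm (\<lambda>x. g ?q x - g s x)"
    proof -
      have "sq_norm (\<lambda>x. ?w ?q x - ?w s x) \<le> 2 * sq_norm (\<lambda>x. f ?q x - f s x)
          + 2 * sq_norm (\<lambda>x. (?w ?q x - ?w s x) - (f ?q x - f s x))"
        by (rule sq_norm_split2) measurable
      also have "sq_norm (\<lambda>x. (?w ?q x - ?w s x) - (f ?q x - f s x)) = sq_norm (\<lambda>x. g ?q x - g s x)"
        unfolding sq_norm_def by (intro nn_integral_cong arg_cong[where f = ennreal]) (simp add: power2_eq_square algebra_simps)
      finally show ?thesis by (simp add: sq_norm_commute[of "?w s"])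
    qed
    also have "\<dots> \<le> 2 * ennreal e + 2 * ennreal e"
      using r(2)[OF qT(1,2)] r'(2)[OF qT(1,3)] by (intro add_mono mult_left_mono) auto
    finally have "sq_norm (?w s) \<le> 2 * sq_norm (?w ?q) + 2 * (2 * ennreal e + 2 * ennreal e)"
      by (simp add: add_left_mono mult_left_mono)
    also have "\<dots> = 8 * ennreal e"
      using eq[OF qT(1)] e
      by (simp add: ennreal_mult'[symmetric] ennreal_plus[symmetric] ennreal_numeral[symmetric] del: ennreal_plus ennreal_numeral)
    finally show ?thesis .
  qed
  have "sq_norm (\<lambda>x. f s x - g s x) \<le> 0"
  proof (rule LIMSEQ_le_const)
    have "(\<lambda>n. inverse (real (Suc n))) \<longlonglongrightarrow> 0" by (rule LIMSEQ_inverse_real_of_nat)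
    then have "(\<lambda>n. ennreal (inverse (real (Suc n)))) \<longlonglongrightarrow> ennreal 0" by (rule tendsto_ennrealI)
    then have "(\<lambda>n. 8 * ennreal (inverse (real (Suc n)))) \<longlonglongrightarrow> 8 * ennreal 0"
      by (intro ennreal_tendsto_cmult) auto
    then show "(\<lambda>n. 8 * ennreal (inverse (real (Suc n)))) \<longlonglongrightarrow> 0" by simp
    show "\<exists>N. \<forall>n\<ge>N. sq_norm (\<lambda>x. f s x - g s x) \<le> 8 * ennreal (inverse (real (Suc n)))"
      by (intro exI[of _ 0] allI impI step) simp
  qed
  then show ?thesis by simp
qed

section \<open>The difference of two solutions\<close>

lemma ennreal_square_sum3:
  fixes a b c :: real
  shows "ennreal ((a + b + c)\<^sup>2) \<le> 3 * (ennreal (a\<^sup>2) + ennreal (b\<^sup>2) + ennreal (c\<^sup>2))"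
proof -
  have "0 \<le> (a - b)\<^sup>2 + (b - c)\<^sup>2 + (a - c)\<^sup>2" by simp
  then have "(a + b + c)\<^sup>2 \<le> 3 * (a\<^sup>2 + b\<^sup>2 + c\<^sup>2)"
    by (simp add: power2_eq_square algebra_simps)
  then have "ennreal ((a + b + c)\<^sup>2) \<le> ennreal (3 * (a\<^sup>2 + b\<^sup>2 + c\<^sup>2))" by (rule ennreal_leI)
  also have "\<dots> = ennreal 3 * ennreal (a\<^sup>2 + b\<^sup>2 + c\<^sup>2)" by (rule ennreal_mult) simp_all
  also have "ennreal (a\<^sup>2 + b\<^sup>2 + c\<^sup>2) = ennreal (a\<^sup>2) + ennreal (b\<^sup>2) + ennreal (c\<^sup>2)"
    by (subst ennreal_plus, simp, simp, subst ennreal_plus) simp_all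
  finally show ?thesis by simp
qed

text \<open>Time becomes the outermost and space the innermost variable, so that semigroup estimates
  can act at a fixed time on a fixed path.\<close>

lemma nn_integral_triple_swap:
  assumes L: "sigma_finite_measure L" and P: "sigma_finite_measure P" and Q: "sigma_finite_measure Q"
    and X: "(\<lambda>z. X (fst z) (fst (snd z)) (snd (snd z))) \<in> borel_measurable (P \<Otimes>\<^sub>M (Q \<Otimes>\<^sub>M L))"
  shows "(\<integral>\<^sup>+x. \<integral>\<^sup>+w. \<integral>\<^sup>+s. X x w s \<partial>L \<partial>Q \<partial>P) = (\<integral>\<^sup>+s. \<integral>\<^sup>+w. \<integral>\<^sup>+x. X x w s \<partial>P \<partial>Q \<partial>L)"
proof -
  interpret L: sigma_finite_measure L by fact
  interpret P: sigma_finite_measure P by fact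
  interpret Q: sigma_finite_measure Q by fact
  interpret QL: pair_sigma_finite Q L by (rule pair_sigma_finite.intro[OF Q L])
  interpret PQL: pair_sigma_finite P "Q \<Otimes>\<^sub>M L"
    by (rule pair_sigma_finite.intro[OF P sigma_finite_pair_measure[OF Q L]])
  have X1: "(\<lambda>z. X x (fst z) (snd z)) \<in> borel_measurable (Q \<Otimes>\<^sub>M L)" if "x \<in> space P" for x
    using measurable_compose[OF measurable_Pair1'[OF that] X] by simp
  have X2: "(\<lambda>z. \<integral>\<^sup>+x. X x (fst z) (snd z) \<partial>P) \<in> borel_measurable (Q \<Otimes>\<^sub>M L)"
    using measurable_compose[OF measurable_Pair[OF measurable_snd measurable_fst] X]
    by (intro P.borel_measurable_nn_integral) (simp add: case_prod_unfold)
  have "(\<integral>\<^sup>+x. \<integral>\<^sup>+w. \<integral>\<^sup>+s. X x w s \<partial>L \<partial>Q \<partial>P) = (\<integral>\<^sup>+x. \<integral>\<^sup>+z. X x (fst z) (snd z) \<partial>(Q \<Otimes>\<^sub>M L) \<partial>P)"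
  proof (rule nn_integral_cong)
    fix x assume "x \<in> space P"
    from L.nn_integral_fst[OF X1[OF this]]
    show "(\<integral>\<^sup>+w. \<integral>\<^sup>+s. X x w s \<partial>L \<partial>Q) = (\<integral>\<^sup>+z. X x (fst z) (snd z) \<partial>(Q \<Otimes>\<^sub>M L))"
      unfolding fst_conv snd_conv .
  qed
  also have "\<dots> = (\<integral>\<^sup>+z. \<integral>\<^sup>+x. X x (fst z) (snd z) \<partial>P \<partial>(Q \<Otimes>\<^sub>M L))"
    by (rule PQL.Fubini'[symmetric]) (use X in \<open>simp only: case_prod_unfold\<close>)
  also have "\<dots> = (\<integral>\<^sup>+w. \<integral>\<^sup>+s. \<integral>\<^sup>+x. X x w s \<partial>P \<partial>L \<partial>Q)"
    using L.nn_integral_fst[OF X2] unfolding fst_conv snd_conv by (rule sym)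
  also have "\<dots> = (\<integral>\<^sup>+s. \<integral>\<^sup>+w. \<integral>\<^sup>+x. X x w s \<partial>P \<partial>Q \<partial>L)"
    by (rule QL.Fubini'[symmetric]) (use X2 in \<open>simp only: case_prod_unfold\<close>)
  finally show ?thesis .
qed

lemma measurable_heat_integral:
  assumes \<phi>: "jointly_measurable M \<phi>"
    and f: "f \<in> borel_measurable N" and g: "g \<in> borel_measurable N" and h: "h \<in> measurable N M"
  shows "(\<lambda>z. LINT y|unit_lborel. heat_kernel (t - f z) (g z) y * \<phi> (f z) y (h z)) \<in> borel_measurable N"
proof -
  interpret U: sigma_finite_measure unit_lborel by (rule sigma_finite_unit_lborel)
  note f1 = measurable_compose[OF measurable_fst f] and g1 = measurable_compose[OF measurable_fst g]
    and h1 = measurable_compose[OF measurable_fst h]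
    and y1 = measurable_compose[OF measurable_snd measurable_ident_restrict_borel(2)]
  have "(\<lambda>x. heat_kernel (t - f (fst x)) (g (fst x)) (snd x) * \<phi> (f (fst x)) (snd x) (h (fst x)))
      \<in> borel_measurable (N \<Otimes>\<^sub>M unit_lborel)"
    by (intro borel_measurable_times measurable_heat_kernel borel_measurable_diff borel_measurable_const
        f1 g1 y1 measurable_triple_compose[OF \<phi> f1 y1 h1])
  then show ?thesis
    by (intro U.borel_measurable_lebesgue_integral) (simp add: case_prod_unfold)
qed

text \<open>The processes \<open>u\<close> and \<open>v\<close> stand for zero extensions of
  solutions. The Walsh integrands are therefore existentially quantified and pinned down on
  \<open>[0,t] \<times> [0,1]\<close> only: the integrals were given for the unextended processes.
  The initial value has already cancelled in \<open>mild_difference\<close>.\<close>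

locale two_solutions = space_time_white_noise M F W
  for M :: "'w measure" and F :: "real \<Rightarrow> 'w measure" and W :: "(real \<times> real) set \<Rightarrow> 'w \<Rightarrow> real" +
  fixes b \<sigma> :: "real \<Rightarrow> real" and c3 c4 c5 d3 T :: real and u v :: "real \<Rightarrow> real \<Rightarrow> 'w \<Rightarrow> real"
  assumes nonneg: "c3 \<ge> 0" "c4 \<ge> 0" "c5 \<ge> 0" "d3 \<ge> 0" and T: "T > 0"
    and drift: "\<And>x y. \<bar>b x - b y\<bar> \<le> c3 * \<bar>x - y\<bar> * log_plus (1 / \<bar>x - y\<bar>)
           + c4 * log_plus (max \<bar>x\<bar> \<bar>y\<bar>) * \<bar>x - y\<bar> + c5 * \<bar>x - y\<bar>"
    and lipschitz: "\<And>x y. \<bar>\<sigma> x - \<sigma> y\<bar> \<le> d3 * \<bar>x - y\<bar>"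
    and u_meas: "jointly_measurable M u"
    and v_meas: "jointly_measurable M v"
    and u_adapted: "\<And>t x. t \<in> {0..T} \<Longrightarrow> x \<in> {0..1} \<Longrightarrow> u t x \<in> borel_measurable (F t)"
    and v_adapted: "\<And>t x. t \<in> {0..T} \<Longrightarrow> x \<in> {0..1} \<Longrightarrow> v t x \<in> borel_measurable (F t)"
    and u_path: "AE w in M. L2_path T (\<lambda>t x. u t x w)"
    and v_path: "AE w in M. L2_path T (\<lambda>t x. v t x w)"
    and mild_difference: "\<And>t. t \<in> {0..T} \<Longrightarrow> AE x in unit_lborel. \<exists>J1 J2 \<Phi>1 \<Phi>2.
        has_walsh_integral M F W t \<Phi>1 J1 \<and> has_walsh_integral M F W t \<Phi>2 J2 \<and>
        (\<forall>s\<in>{0..t}. \<forall>y\<in>{0..1}. \<forall>w. \<Phi>1 s y w = heat_kernel (t - s) x y * \<sigma> (u s y w) \<and>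
           \<Phi>2 s y w = heat_kernel (t - s) x y * \<sigma> (v s y w)) \<and>
        (AE w in M.
           set_integrable lborel ({0..t} \<times> {0..1}) (\<lambda>(s, y). heat_kernel (t - s) x y * b (u s y w)) \<and>
           set_integrable lborel ({0..t} \<times> {0..1}) (\<lambda>(s, y). heat_kernel (t - s) x y * b (v s y w)) \<and>
           u t x w - v t x w =
             set_lebesgue_integral lborel ({0..t} \<times> {0..1}) (\<lambda>(s, y). heat_kernel (t - s) x y * b (u s y w))
             - set_lebesgue_integral lborel ({0..t} \<times> {0..1}) (\<lambda>(s, y). heat_kernel (t - s) x y * b (v s y w))
             + (J1 w - J2 w))"
begin

definition diff :: "real \<Rightarrow> real \<Rightarrow> 'w \<Rightarrow> real" where
  "diff s y w = u s y w - v s y w"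

definition fdiff :: "real \<Rightarrow> real \<Rightarrow> 'w \<Rightarrow> real" where
  "fdiff s y w = b (u s y w) - b (v s y w)"

definition gdiff :: "real \<Rightarrow> real \<Rightarrow> 'w \<Rightarrow> real" where
  "gdiff s y w = \<sigma> (u s y w) - \<sigma> (v s y w)"

text \<open>The drift difference is clamped at the part of its modulus that is affine in \<open>diff\<close>. The clamped
  part is handled by the contraction property of the semigroup on \<open>L\<^sup>2\<close>, the remainder, which is of
  the size of a product of two \<open>L\<^sup>2\<close> functions, by the smoothing from \<open>L\<^sup>1\<close> to \<open>L\<^sup>2\<close>.\<close>

definition fbounded :: "real \<Rightarrow> real \<Rightarrow> real \<Rightarrow> 'w \<Rightarrow> real" where
  "fbounded N s y w = clamp_abs ((c3 * N + c5) * \<bar>diff s y w\<bar> + c3 * exp (- N)) (fdiff s y w)"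

definition frest :: "real \<Rightarrow> real \<Rightarrow> real \<Rightarrow> 'w \<Rightarrow> real" where
  "frest N s y w = fdiff s y w - fbounded N s y w"

lemma b_meas: "b \<in> borel_measurable borel"
  by (rule log_modulus_measurable[OF nonneg(1,2) drift])

lemma sigma_meas: "\<sigma> \<in> borel_measurable borel"
proof (rule borel_measurable_continuous_onI)
  have "d3-lipschitz_on UNIV \<sigma>"
    by (rule lipschitz_onI) (use lipschitz nonneg in \<open>auto simp: dist_real_def\<close>)
  then show "continuous_on UNIV \<sigma>" by (rule lipschitz_on_continuous_on)
qed

lemma diff_meas: "jointly_measurable M diff"
  unfolding diff_def by (rule measurable_triple_diff[OF u_meas v_meas])

lemma fdiff_meas: "jointly_measurable M fdiff"
  using borel_measurable_diff[OF measurable_compose[OF u_meas b_meas] measurable_compose[OF v_meas b_meas]]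
  by (simp add: fdiff_def case_prod_unfold)

lemma gdiff_meas: "jointly_measurable M gdiff"
  using borel_measurable_diff[OF measurable_compose[OF u_meas sigma_meas] measurable_compose[OF v_meas sigma_meas]]
  by (simp add: gdiff_def case_prod_unfold)

lemma fbounded_meas: "jointly_measurable M (\<lambda>s y w. fbounded N s y w)"
proof -
  have [measurable]: "(\<lambda>x. diff (fst x) (fst (snd x)) (snd (snd x))) \<in> borel_measurable (borel \<Otimes>\<^sub>M (borel \<Otimes>\<^sub>M M))"
    "(\<lambda>x. fdiff (fst x) (fst (snd x)) (snd (snd x))) \<in> borel_measurable (borel \<Otimes>\<^sub>M (borel \<Otimes>\<^sub>M M))"
    using diff_meas fdiff_meas by (simp_all add: case_prod_unfold)
  show ?thesis unfolding fbounded_def clamp_abs_def case_prod_unfold by measurable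
qed

lemma frest_meas: "jointly_measurable M (\<lambda>s y w. frest N s y w)"
  unfolding frest_def by (rule measurable_triple_diff[OF fdiff_meas fbounded_meas])

lemma clamp_level_nonneg: "1 \<le> N \<Longrightarrow> 0 \<le> (c3 * N + c5) * \<bar>diff s y w\<bar> + c3 * exp (- N)"
  using nonneg by (intro add_nonneg_nonneg mult_nonneg_nonneg) auto

lemma fbounded_bounds:
  assumes "1 \<le> N"
  shows "\<bar>fbounded N s y w\<bar> \<le> (c3 * N + c5) * \<bar>diff s y w\<bar> + c3 * exp (- N)"
    "\<bar>fbounded N s y w\<bar> \<le> \<bar>fdiff s y w\<bar>"
    "diff s y w = 0 \<Longrightarrow> fbounded N s y w = 0"
    "\<bar>frest N s y w\<bar> \<le> \<bar>fdiff s y w\<bar>"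
    "\<bar>frest N s y w\<bar> \<le> c4 * ((\<bar>u s y w\<bar> + \<bar>v s y w\<bar>) * \<bar>diff s y w\<bar>)"
proof -
  note m = clamp_level_nonneg[OF assms, of s y w]
  show "\<bar>fbounded N s y w\<bar> \<le> (c3 * N + c5) * \<bar>diff s y w\<bar> + c3 * exp (- N)"
    unfolding fbounded_def by (rule clamp_abs_bounds(1)[OF m])
  show 2: "\<bar>fbounded N s y w\<bar> \<le> \<bar>fdiff s y w\<bar>"
    unfolding fbounded_def by (rule clamp_abs_bounds(2)[OF m])
  show "fbounded N s y w = 0" if "diff s y w = 0"
    using 2 that by (simp add: diff_def fdiff_def)
  show "\<bar>frest N s y w\<bar> \<le> \<bar>fdiff s y w\<bar>"
    unfolding frest_def fbounded_def by (rule clamp_abs_bounds(3)[OF m])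
  show "\<bar>frest N s y w\<bar> \<le> c4 * ((\<bar>u s y w\<bar> + \<bar>v s y w\<bar>) * \<bar>diff s y w\<bar>)"
    unfolding frest_def fbounded_def
  proof (rule clamp_abs_bounds(4)[OF m])
    show "\<bar>fdiff s y w\<bar> \<le> (c3 * N + c5) * \<bar>diff s y w\<bar> + c3 * exp (- N) + c4 * ((\<bar>u s y w\<bar> + \<bar>v s y w\<bar>) * \<bar>diff s y w\<bar>)"
      unfolding fdiff_def diff_def using assms by (intro log_modulus_linear_bound[OF nonneg(1,2) _ drift]) simp
    show "0 \<le> c4 * ((\<bar>u s y w\<bar> + \<bar>v s y w\<bar>) * \<bar>diff s y w\<bar>)" using nonneg by simp
  qed
qed

lemma gdiff_bound: "(gdiff s y w)\<^sup>2 \<le> d3\<^sup>2 * (diff s y w)\<^sup>2"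
proof -
  have "\<bar>gdiff s y w\<bar>\<^sup>2 \<le> (d3 * \<bar>diff s y w\<bar>)\<^sup>2"
    unfolding gdiff_def diff_def by (intro power_mono lipschitz) simp
  then show ?thesis by (simp add: power_mult_distrib)
qed

text \<open>Rational times make this event measurable; on continuous paths it bounds the norms up to and
  including time \<open>s\<close>. The clause \<open>q = 0\<close> covers \<open>s = 0\<close>.\<close>

definition below :: "real \<Rightarrow> real \<Rightarrow> 'w \<Rightarrow> bool" where
  "below R s w \<longleftrightarrow> (\<forall>q::rat. 0 \<le> q \<longrightarrow> of_rat q \<le> T \<longrightarrow> of_rat q < s \<or> q = 0 \<longrightarrow>
     sq_norm (\<lambda>y. u (of_rat q) y w) \<le> ennreal R \<and> sq_norm (\<lambda>y. v (of_rat q) y w) \<le> ennreal R)"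

lemma below_antimono: "below R s w \<Longrightarrow> r \<le> s \<Longrightarrow> below R r w"
  unfolding below_def
proof (intro allI impI)
  fix q :: rat
  assume all: "\<forall>q::rat. 0 \<le> q \<longrightarrow> of_rat q \<le> T \<longrightarrow> of_rat q < s \<or> q = 0 \<longrightarrow>
     sq_norm (\<lambda>y. u (of_rat q) y w) \<le> ennreal R \<and> sq_norm (\<lambda>y. v (of_rat q) y w) \<le> ennreal R"
    and rs: "r \<le> s" and q: "0 \<le> q" "of_rat q \<le> T" "of_rat q < r \<or> q = 0"
  have "of_rat q < s \<or> q = 0" using q(3) rs by linarith
  with all q(1,2) show "sq_norm (\<lambda>y. u (of_rat q) y w) \<le> ennreal R \<and> sq_norm (\<lambda>y. v (of_rat q) y w) \<le> ennreal R"
    by blast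
qed

lemma sq_norm_adapted:
  assumes q: "q \<in> {0..T}"
  shows "(\<lambda>w. sq_norm (\<lambda>y. u q y w)) \<in> borel_measurable (F q)"
    "(\<lambda>w. sq_norm (\<lambda>y. v q y w)) \<in> borel_measurable (F q)"
proof -
  have *: "(\<lambda>(y, w). g q y w) \<in> borel_measurable (unit_lborel \<Otimes>\<^sub>M M)"
    if "jointly_measurable M g" for g :: "real \<Rightarrow> real \<Rightarrow> 'w \<Rightarrow> real"
    unfolding case_prod_unfold
    by (rule measurable_triple_compose[OF that measurable_const
        measurable_compose[OF measurable_fst measurable_ident_restrict_borel(2)] measurable_snd]) simp
  have 0: "0 \<le> q" using q by simp
  show "(\<lambda>w. sq_norm (\<lambda>y. u q y w)) \<in> borel_measurable (F q)"
    unfolding sq_norm_def by (rule adapted_square_integral[OF 0 *[OF u_meas] u_adapted[OF q]])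
  show "(\<lambda>w. sq_norm (\<lambda>y. v q y w)) \<in> borel_measurable (F q)"
    unfolding sq_norm_def by (rule adapted_square_integral[OF 0 *[OF v_meas] v_adapted[OF q]])
qed

lemma below_joint: "Measurable.pred (borel \<Otimes>\<^sub>M M) (\<lambda>(s, w). below R s w)"
proof -
  have n: "(\<lambda>x. sq_norm (\<lambda>y. g (of_rat q) y (snd x))) \<in> borel_measurable ((borel :: real measure) \<Otimes>\<^sub>M M)"
    if "jointly_measurable M g" for g :: "real \<Rightarrow> real \<Rightarrow> 'w \<Rightarrow> real" and q
    by (rule borel_measurable_sq_norm[OF that measurable_const measurable_snd]) simp
  note [measurable] = n[OF u_meas] n[OF v_meas]
  show ?thesis unfolding below_def case_prod_unfold by measurable
qed

lemma stop_time_below: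
  assumes t: "t \<in> {0..T}"
  shows "stop_time M F t (below R)"
  unfolding stop_time_def
proof (intro conjI ballI allI impI)
  fix s assume s: "s \<in> {0..t}"
  have "Measurable.pred (F s) (\<lambda>w. 0 \<le> q \<longrightarrow> of_rat q \<le> T \<longrightarrow> of_rat q < s \<or> q = 0 \<longrightarrow>
     sq_norm (\<lambda>y. u (of_rat q) y w) \<le> ennreal R \<and> sq_norm (\<lambda>y. v (of_rat q) y w) \<le> ennreal R)" for q :: rat
  proof (cases "0 \<le> q \<and> of_rat q \<le> T \<and> (of_rat q < s \<or> q = 0)")
    case True
    then have q: "of_rat q \<in> {0..T}" "of_rat q \<le> s" using s by auto
    have lift: "V \<in> borel_measurable (F s)" if "V \<in> borel_measurable (F (of_rat q))" for V :: "'w \<Rightarrow> ennreal"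
      using that by (rule measurable_mono[THEN subsetD, rotated -1])
        (use q s t mono[of "of_rat q" s] space_F[of "of_rat q"] space_F[of s] in auto)
    have [measurable]: "(\<lambda>w. sq_norm (\<lambda>y. u (of_rat q) y w)) \<in> borel_measurable (F s)"
        "(\<lambda>w. sq_norm (\<lambda>y. v (of_rat q) y w)) \<in> borel_measurable (F s)"
      by (rule lift[OF sq_norm_adapted(1)[OF q(1)]], rule lift[OF sq_norm_adapted(2)[OF q(1)]])
    have "Measurable.pred (F s) (\<lambda>w. sq_norm (\<lambda>y. u (of_rat q) y w) \<le> ennreal R \<and> sq_norm (\<lambda>y. v (of_rat q) y w) \<le> ennreal R)"
      by measurable
    then show ?thesis using True by simp
  next
    case False
    then have eq: "(\<lambda>w. 0 \<le> q \<longrightarrow> of_rat q \<le> T \<longrightarrow> of_rat q < s \<or> q = 0 \<longrightarrow>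
     sq_norm (\<lambda>y. u (of_rat q) y w) \<le> ennreal R \<and> sq_norm (\<lambda>y. v (of_rat q) y w) \<le> ennreal R) = (\<lambda>w. True)" by auto
    show ?thesis unfolding eq by simp
  qed
  then show "Measurable.pred (F s) (below R s)"
    unfolding below_def[abs_def] by (rule pred_intros_countable)
next
  show "Measurable.pred (borel \<Otimes>\<^sub>M M) (\<lambda>(s, w). below R s w)" by (rule below_joint)
next
  fix r s w assume "r \<le> s" "below R s w"
  then show "below R r w" using below_antimono by blast
next
  fix s w assume s: "0 < s" and all: "\<forall>r\<ge>0. r < s \<longrightarrow> below R r w"
  show "below R s w" unfolding below_def
  proof (intro allI impI)
    fix q :: rat assume q: "0 \<le> q" "of_rat q \<le> T" "of_rat q < s \<or> q = 0"
    \<comment> \<open>Left closure: the condition at \<open>q < s\<close> is already part of the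
      event at a time strictly between \<open>q\<close> and \<open>s\<close>.\<close>
    define r where "r = (of_rat q + s) / 2"
    have "0 \<le> r" "r < s" "of_rat q < r \<or> q = 0" using q s by (auto simp: r_def)
    then show "sq_norm (\<lambda>y. u (of_rat q) y w) \<le> ennreal R \<and> sq_norm (\<lambda>y. v (of_rat q) y w) \<le> ennreal R"
      using all q unfolding below_def by blast
  qed
qed

text \<open>Continuity from the left carries the bound from rational times to \<open>s\<close>
  itself, on an exceptional set common to all \<open>s\<close>.\<close>

lemma below_bound:
  "AE w in M. \<forall>s\<in>{0..T}. below R s w \<longrightarrow> sq_norm (\<lambda>y. u s y w) \<le> ennreal R \<and> sq_norm (\<lambda>y. v s y w) \<le> ennreal R"
  using u_path v_path
proof eventually_elim
  case (elim w)
  show ?case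
  proof (intro ballI impI)
    fix s assume s: "s \<in> {0..T}" and b: "below R s w"
    show "sq_norm (\<lambda>y. u s y w) \<le> ennreal R \<and> sq_norm (\<lambda>y. v s y w) \<le> ennreal R"
    proof (cases "s = 0")
      case True
      then show ?thesis using b[unfolded below_def, rule_format, of 0] T by simp
    next
      case False
      then have s': "0 < s" "s \<le> T" using s by auto
      have "sq_norm (\<lambda>y. u (of_rat q) y w) \<le> ennreal R \<and> sq_norm (\<lambda>y. v (of_rat q) y w) \<le> ennreal R"
        if "0 \<le> q" "of_rat q < s" for q :: rat
        using b that s' unfolding below_def by auto
      then show ?thesis
        using L2_path_left_bound[OF elim(1) s'] L2_path_left_bound[OF elim(2) s'] by blast
    qed
  qed
qed

section \<open>The estimate at a fixed point of space\<close>

definition heat_int :: "(real \<Rightarrow> real \<Rightarrow> 'w \<Rightarrow> real) \<Rightarrow> real \<Rightarrow> real \<Rightarrow> real \<Rightarrow> 'w \<Rightarrow> real" where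
  "heat_int \<phi> t s x w = (LINT y|unit_lborel. heat_kernel (t - s) x y * \<phi> s y w)"

text \<open>The function \<open>H\<close> of the Gronwall lemma. A path is discarded once it exceeds
  the level, rather than frozen there: the kernel in the mild equation depends on \<open>t\<close>,
  so a frozen path would no longer satisfy it.\<close>

definition second_moment :: "real \<Rightarrow> real \<Rightarrow> ennreal" where
  "second_moment R s = (\<integral>\<^sup>+w. (if below R s w then sq_norm (\<lambda>y. diff s y w) else 0) \<partial>M)"

lemma below_pred:
  assumes "f \<in> borel_measurable N" "h \<in> measurable N M"
  shows "Measurable.pred N (\<lambda>z. below R (f z) (h z))"
  using measurable_compose[OF measurable_Pair[OF assms] below_joint] by simp

lemma heat_int_meas:
  assumes \<phi>: "jointly_measurable M \<phi>"
    and "f \<in> borel_measurable N" "g \<in> borel_measurable N" "h \<in> measurable N M"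
  shows "(\<lambda>z. heat_int \<phi> t (f z) (g z) (h z)) \<in> borel_measurable N"
  unfolding heat_int_def by (rule measurable_heat_integral[OF assms])

text \<open>Both parts are dominated in absolute value by \<open>fdiff\<close>, so integrability
  against the kernel passes to each, and Fubini can be applied to them separately.\<close>

lemma drift_decomposition:
  assumes N: "1 \<le> N" and w: "w \<in> space M"
    and int_u: "set_integrable lborel ({0..t} \<times> {0..1}) (\<lambda>(s, y). heat_kernel (t - s) x y * b (u s y w))"
    and int_v: "set_integrable lborel ({0..t} \<times> {0..1}) (\<lambda>(s, y). heat_kernel (t - s) x y * b (v s y w))"
  obtains D1 D2 where
    "set_lebesgue_integral lborel ({0..t} \<times> {0..1}) (\<lambda>(s, y). heat_kernel (t - s) x y * b (u s y w))
     - set_lebesgue_integral lborel ({0..t} \<times> {0..1}) (\<lambda>(s, y). heat_kernel (t - s) x y * b (v s y w)) = D1 + D2"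
    "ennreal \<bar>D1\<bar> \<le> (\<integral>\<^sup>+s. ennreal \<bar>heat_int (fbounded N) t s x w\<bar> * indicator {0..t} s \<partial>lborel)"
    "ennreal \<bar>D2\<bar> \<le> (\<integral>\<^sup>+s. ennreal \<bar>heat_int (frest N) t s x w\<bar> * indicator {0..t} s \<partial>lborel)"
proof -
  let ?S = "{0..t} \<times> {0..1::real}"
  let ?p = "\<lambda>\<phi> (s, y). heat_kernel (t - s) x y * \<phi> s y w"
  have int_f: "set_integrable lborel ?S (?p fdiff)"
    using set_integral_diff(1)[OF int_u int_v]
    by (simp add: fdiff_def case_prod_unfold right_diff_distrib)
  have dom: "set_integrable lborel ?S (?p \<phi>)"
    if \<phi>: "jointly_measurable M \<phi>"
      and le: "\<And>s y. \<bar>\<phi> s y w\<bar> \<le> \<bar>fdiff s y w\<bar>" for \<phi>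
  proof -
    have [measurable]: "(\<lambda>z. \<phi> (fst z) (snd z) w) \<in> borel_measurable (borel \<Otimes>\<^sub>M borel)"
      by (rule measurable_triple_compose[OF \<phi> measurable_fst measurable_snd measurable_const[OF w]])
    have m: "?p \<phi> \<in> borel_measurable (borel \<Otimes>\<^sub>M borel)"
      unfolding case_prod_unfold by measurable
    then have "?p \<phi> \<in> borel_measurable lborel" by (simp add: borel_prod)
    moreover have "?S \<in> sets lborel" by (simp add: borel_Times)
    ultimately have meas: "(\<lambda>z. indicator ?S z *\<^sub>R ?p \<phi> z) \<in> borel_measurable lborel"
      by (intro borel_measurable_scaleR borel_measurable_indicator)
    show ?thesis
      unfolding set_integrable_def
    proof (rule Bochner_Integration.integrable_bound[OF int_f[unfolded set_integrable_def] meas], rule AE_I2)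
      fix z :: "real \<times> real"
      show "norm (indicator ?S z *\<^sub>R ?p \<phi> z) \<le> norm (indicator ?S z *\<^sub>R ?p fdiff z)"
        using le by (auto simp: case_prod_unfold abs_mult indicator_def intro!: mult_left_mono)
    qed
  qed
  have i1: "set_integrable lborel ?S (?p (fbounded N))"
    by (rule dom[OF fbounded_meas fbounded_bounds(2)[OF N]])
  have i2: "set_integrable lborel ?S (?p (frest N))"
    by (rule dom[OF frest_meas fbounded_bounds(4)[OF N]])
  let ?L = "set_lebesgue_integral lborel ?S"
  have "?L (\<lambda>(s, y). heat_kernel (t - s) x y * b (u s y w)) - ?L (\<lambda>(s, y). heat_kernel (t - s) x y * b (v s y w)) = ?L (?p fdiff)"
    using set_integral_diff(2)[OF int_u int_v, symmetric]
    by (simp add: fdiff_def case_prod_unfold right_diff_distrib)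
  also have "\<dots> = ?L (\<lambda>z. ?p (fbounded N) z + ?p (frest N) z)"
    by (simp add: frest_def case_prod_unfold algebra_simps)
  also have "\<dots> = ?L (?p (fbounded N)) + ?L (?p (frest N))" by (rule set_integral_add(2)[OF i1 i2])
  finally have eq: "?L (\<lambda>(s, y). heat_kernel (t - s) x y * b (u s y w)) - ?L (\<lambda>(s, y). heat_kernel (t - s) x y * b (v s y w))
     = ?L (?p (fbounded N)) + ?L (?p (frest N))" .
  show ?thesis
    by (rule that[OF eq]) (use abs_set_integral_le_iterated[OF i1] abs_set_integral_le_iterated[OF i2] in \<open>simp_all add: heat_int_def\<close>)
qed

text \<open>The weighted Cauchy-Schwarz inequality is reserved for the clamped part; the remainder
  relies on its integrable kernel and takes the unweighted one. The factor \<open>1\<close> gives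
  both terms the same shape, so that one lemma integrates them over space.\<close>

lemma pointwise_estimate:
  assumes t: "t \<in> {0..T}" and N: "1 \<le> N" and l: "0 < l"
  shows "AE x in unit_lborel. (\<integral>\<^sup>+w. (if below R t w then ennreal ((diff t x w)\<^sup>2) else 0) \<partial>M) \<le>
     3 * (ennreal (1 / l) * (\<integral>\<^sup>+w. \<integral>\<^sup>+s. ennreal (exp (l * (t - s))) *
            ((if below R s w then ennreal ((heat_int (fbounded N) t s x w)\<^sup>2) else 0) * indicator {0..t} s) \<partial>lborel \<partial>M)
        + ennreal t * (\<integral>\<^sup>+w. \<integral>\<^sup>+s. 1 *
            ((if below R s w then ennreal ((heat_int (frest N) t s x w)\<^sup>2) else 0) * indicator {0..t} s) \<partial>lborel \<partial>M)
        + (\<integral>\<^sup>+w. stopped_energy t (\<lambda>s. below R s w) (\<lambda>s y. heat_kernel (t - s) x y * gdiff s y w) \<partial>M))"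
  using mild_difference[OF t]
proof eventually_elim
  case (elim x)
  have t0: "0 \<le> t" using t by simp
  obtain J1 J2 \<Phi>1 \<Phi>2 where walsh: "has_walsh_integral M F W t \<Phi>1 J1" "has_walsh_integral M F W t \<Phi>2 J2"
    and \<Phi>: "\<And>s y w. s \<in> {0..t} \<Longrightarrow> y \<in> {0..1} \<Longrightarrow> \<Phi>1 s y w = heat_kernel (t - s) x y * \<sigma> (u s y w) \<and>
           \<Phi>2 s y w = heat_kernel (t - s) x y * \<sigma> (v s y w)"
    and eq: "AE w in M.
           set_integrable lborel ({0..t} \<times> {0..1}) (\<lambda>(s, y). heat_kernel (t - s) x y * b (u s y w)) \<and>
           set_integrable lborel ({0..t} \<times> {0..1}) (\<lambda>(s, y). heat_kernel (t - s) x y * b (v s y w)) \<and>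
           u t x w - v t x w =
             set_lebesgue_integral lborel ({0..t} \<times> {0..1}) (\<lambda>(s, y). heat_kernel (t - s) x y * b (u s y w))
             - set_lebesgue_integral lborel ({0..t} \<times> {0..1}) (\<lambda>(s, y). heat_kernel (t - s) x y * b (v s y w))
             + (J1 w - J2 w)"
    using elim by blast
  have J: "J1 \<in> borel_measurable M" "J2 \<in> borel_measurable M"
    using walsh unfolding has_walsh_integral_def by blast+
  let ?P = "\<lambda>a \<phi> w. \<integral>\<^sup>+s. a s * ((if below R s w then ennreal ((heat_int \<phi> t s x w)\<^sup>2) else 0) * indicator {0..t} s) \<partial>lborel"
  let ?e = "\<lambda>s. ennreal (exp (l * (t - s)))"
  let ?J = "\<lambda>w. if below R t w then ennreal ((J1 w - J2 w)\<^sup>2) else 0"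
  have P_meas: "?P a \<phi> \<in> borel_measurable M"
    if \<phi>: "jointly_measurable M \<phi>"
      and [measurable]: "a \<in> borel_measurable borel" for a \<phi>
  proof (rule lborel.borel_measurable_nn_integral)
    have s: "snd \<in> borel_measurable (M \<Otimes>\<^sub>M lborel)" by measurable
    note [measurable] = heat_int_meas[OF \<phi> s measurable_const measurable_fst, of x] below_pred[OF s measurable_fst]
    show "(\<lambda>(w, s). a s * ((if below R s w then ennreal ((heat_int \<phi> t s x w)\<^sup>2) else 0) * indicator {0..t} s))
        \<in> borel_measurable (M \<Otimes>\<^sub>M lborel)"
      unfolding case_prod_unfold by measurable
  qed
  have J_meas: "?J \<in> borel_measurable M"
  proof -
    have [measurable]: "Measurable.pred M (below R t)" by (rule below_pred) auto
    note [measurable] = J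
    show ?thesis by measurable
  qed
  have P1[measurable]: "?P ?e (fbounded N) \<in> borel_measurable M" by (rule P_meas[OF fbounded_meas]) measurable
  have P2[measurable]: "?P (\<lambda>s. 1) (frest N) \<in> borel_measurable M" by (rule P_meas[OF frest_meas]) measurable
  note J_meas[measurable]
  have "AE w in M. (if below R t w then ennreal ((diff t x w)\<^sup>2) else 0) \<le>
      3 * (ennreal (1 / l) * ?P ?e (fbounded N) w + ennreal t * ?P (\<lambda>s. 1) (frest N) w + ?J w)"
    using eq AE_space
  proof eventually_elim
    case (elim w)
    show ?case
    proof (cases "below R t w")
      case True
      obtain D1 D2 where D0: "set_lebesgue_integral lborel ({0..t} \<times> {0..1}) (\<lambda>(s, y). heat_kernel (t - s) x y * b (u s y w))
             - set_lebesgue_integral lborel ({0..t} \<times> {0..1}) (\<lambda>(s, y). heat_kernel (t - s) x y * b (v s y w)) = D1 + D2"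
        and D1: "ennreal \<bar>D1\<bar> \<le> (\<integral>\<^sup>+s. ennreal \<bar>heat_int (fbounded N) t s x w\<bar> * indicator {0..t} s \<partial>lborel)"
        and D2: "ennreal \<bar>D2\<bar> \<le> (\<integral>\<^sup>+s. ennreal \<bar>heat_int (frest N) t s x w\<bar> * indicator {0..t} s \<partial>lborel)"
        by (rule drift_decomposition[OF N elim(2) conjunct1[OF elim(1)] conjunct1[OF conjunct2[OF elim(1)]]])
      have D: "diff t x w = D1 + D2 + (J1 w - J2 w)"
        using conjunct2[OF conjunct2[OF elim(1)]] unfolding D0 diff_def .
      have sec: "(\<lambda>s. heat_int \<phi> t s x w) \<in> borel_measurable borel"
        if "jointly_measurable M \<phi>" for \<phi>
        by (rule heat_int_meas[OF that measurable_ident measurable_const measurable_const[OF elim(2)], simplified id_def]) simp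
      \<comment> \<open>Because the event shrinks in time, its indicator at \<open>t\<close> may be
        replaced by indicators at each \<open>s \<le> t\<close> under the time integrals, which
        produces the cut-off moments at time \<open>s\<close>.\<close>
      have below_s: "below R s w" if "s \<in> {0..t}" for s using below_antimono[OF True] that by simp
      have drop: "?P a \<phi> w = (\<integral>\<^sup>+s. a s * ennreal ((heat_int \<phi> t s x w)\<^sup>2) * indicator {0..t} s \<partial>lborel)" for a \<phi>
        using below_s by (intro nn_integral_cong) (auto simp: indicator_def)
      have sq: "ennreal (D\<^sup>2) = (ennreal \<bar>D\<bar>)\<^sup>2" for D :: real by (simp add: ennreal_power)
      have 1: "ennreal (D1\<^sup>2) \<le> ennreal (1 / l) * ?P ?e (fbounded N) w"
        unfolding sq[of D1] drop
        by (rule order_trans[OF power_mono[OF D1] weighted_Cauchy_Schwarz[OF sec[OF fbounded_meas] l t0]]) simp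
      have 2: "ennreal (D2\<^sup>2) \<le> ennreal t * ?P (\<lambda>s. 1) (frest N) w"
        unfolding sq[of D2] drop unfolding mult_1
        by (rule order_trans[OF power_mono[OF D2] Cauchy_Schwarz_interval[OF sec[OF frest_meas] t0]]) simp
      have "ennreal ((diff t x w)\<^sup>2) \<le> 3 * (ennreal (D1\<^sup>2) + ennreal (D2\<^sup>2) + ennreal ((J1 w - J2 w)\<^sup>2))"
        unfolding D by (rule ennreal_square_sum3)
      also have "\<dots> \<le> 3 * (ennreal (1 / l) * ?P ?e (fbounded N) w + ennreal t * ?P (\<lambda>s. 1) (frest N) w + ?J w)"
        using 1 2 True by (intro mult_left_mono add_mono) auto
      finally show ?thesis using True by simp
    qed simp
  qed
  then have "(\<integral>\<^sup>+w. (if below R t w then ennreal ((diff t x w)\<^sup>2) else 0) \<partial>M) \<le>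
      (\<integral>\<^sup>+w. 3 * (ennreal (1 / l) * ?P ?e (fbounded N) w + ennreal t * ?P (\<lambda>s. 1) (frest N) w + ?J w) \<partial>M)"
    by (rule nn_integral_mono_AE)
  also have "\<dots> = 3 * (ennreal (1 / l) * (\<integral>\<^sup>+w. ?P ?e (fbounded N) w \<partial>M)
      + ennreal t * (\<integral>\<^sup>+w. ?P (\<lambda>s. 1) (frest N) w \<partial>M) + (\<integral>\<^sup>+w. ?J w \<partial>M))"
  proof -
    have lin: "(\<integral>\<^sup>+w. c * (a * f w + a' * g w + h w) \<partial>M) = c * (a * (\<integral>\<^sup>+w. f w \<partial>M) + a' * (\<integral>\<^sup>+w. g w \<partial>M) + (\<integral>\<^sup>+w. h w \<partial>M))"
      if [measurable]: "f \<in> borel_measurable M" "g \<in> borel_measurable M" "h \<in> borel_measurable M"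
      for a a' c :: ennreal and f g h
      by (simp add: nn_integral_cmult nn_integral_add)
    show ?thesis by (rule lin[OF P1 P2 J_meas])
  qed
  also have "\<dots> \<le> 3 * (ennreal (1 / l) * (\<integral>\<^sup>+w. ?P ?e (fbounded N) w \<partial>M)
      + ennreal t * (\<integral>\<^sup>+w. ?P (\<lambda>s. 1) (frest N) w \<partial>M)
      + (\<integral>\<^sup>+w. stopped_energy t (\<lambda>s. below R s w) (\<lambda>s y. heat_kernel (t - s) x y * gdiff s y w) \<partial>M))"
  proof (intro mult_left_mono add_left_mono)
    have "(\<integral>\<^sup>+w. ?J w \<partial>M) \<le> (\<integral>\<^sup>+w. stopped_energy t (\<lambda>s. below R s w) (\<lambda>s y. \<Phi>1 s y w - \<Phi>2 s y w) \<partial>M)"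
      by (rule walsh_difference_bound[OF walsh t0 stop_time_below[OF t]])
    also have "\<dots> = (\<integral>\<^sup>+w. stopped_energy t (\<lambda>s. below R s w) (\<lambda>s y. heat_kernel (t - s) x y * gdiff s y w) \<partial>M)"
      by (intro nn_integral_cong stopped_energy_cong) (simp add: \<Phi> gdiff_def right_diff_distrib)
    finally show "(\<integral>\<^sup>+w. ?J w \<partial>M) \<le> (\<integral>\<^sup>+w. stopped_energy t (\<lambda>s. below R s w) (\<lambda>s y. heat_kernel (t - s) x y * gdiff s y w) \<partial>M)" .
  qed simp
  finally show ?case .
qed

end

section \<open>Integration over space and the inequality for the second moment\<close>

lemma borel_measurable_double_nn_integral:
  assumes L: "sigma_finite_measure L" and Q: "sigma_finite_measure Q"
    and X: "(\<lambda>z. X (fst z) (fst (snd z)) (snd (snd z))) \<in> borel_measurable (P \<Otimes>\<^sub>M (Q \<Otimes>\<^sub>M L))"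
  shows "(\<lambda>x. \<integral>\<^sup>+w. \<integral>\<^sup>+s. X x w s \<partial>L \<partial>Q) \<in> borel_measurable P"
proof -
  interpret L: sigma_finite_measure L by fact
  interpret Q: sigma_finite_measure Q by fact
  have "(\<lambda>z. X (fst (fst z)) (snd (fst z)) (snd z)) \<in> borel_measurable ((P \<Otimes>\<^sub>M Q) \<Otimes>\<^sub>M L)"
    using measurable_compose[OF measurable_Pair[OF measurable_compose[OF measurable_fst measurable_fst]
        measurable_Pair[OF measurable_compose[OF measurable_fst measurable_snd] measurable_snd]] X]
    unfolding fst_conv snd_conv .
  then have "(\<lambda>z. \<integral>\<^sup>+s. X (fst z) (snd z) s \<partial>L) \<in> borel_measurable (P \<Otimes>\<^sub>M Q)"
    by (intro L.borel_measurable_nn_integral) (simp only: case_prod_unfold)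
  then show ?thesis
    by (intro Q.borel_measurable_nn_integral) (simp only: case_prod_unfold)
qed

context two_solutions
begin

lemma sq_diff_meas:
  assumes "f \<in> borel_measurable N" "h \<in> measurable N M"
  shows "(\<lambda>z. sq_norm (\<lambda>y. diff (f z) y (h z))) \<in> borel_measurable N"
  by (rule borel_measurable_sq_norm[OF diff_meas assms])

lemma second_moment_meas: "second_moment R \<in> borel_measurable borel"
proof -
  note [measurable] = sq_diff_meas[OF measurable_fst measurable_snd] below_pred[OF measurable_fst measurable_snd]
  have "(\<lambda>s. \<integral>\<^sup>+w. (if below R s w then sq_norm (\<lambda>y. diff s y w) else 0) \<partial>M) \<in> borel_measurable borel"
    by (rule borel_measurable_nn_integral) (unfold case_prod_unfold, measurable)
  then show ?thesis unfolding second_moment_def[abs_def] .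
qed

lemma heat_part_joint:
  assumes \<phi>: "jointly_measurable M \<phi>"
    and a[measurable]: "a \<in> borel_measurable borel"
  shows "(\<lambda>z. a (snd (snd z)) * ((if below R (snd (snd z)) (fst (snd z)) then
      ennreal ((heat_int \<phi> t (snd (snd z)) (fst z) (fst (snd z)))\<^sup>2) else 0) * indicator {0..t} (snd (snd z))))
    \<in> borel_measurable (unit_lborel \<Otimes>\<^sub>M (M \<Otimes>\<^sub>M (lborel :: real measure)))"
proof -
  let ?N = "unit_lborel \<Otimes>\<^sub>M (M \<Otimes>\<^sub>M (lborel :: real measure))"
  have x: "fst \<in> borel_measurable ?N"
    by (rule measurable_compose[OF measurable_fst measurable_ident_restrict_borel(2)])
  have w: "(\<lambda>z. fst (snd z)) \<in> measurable ?N M" by measurable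
  have s: "(\<lambda>z. snd (snd z)) \<in> borel_measurable ?N" by measurable
  note [measurable] = heat_int_meas[OF \<phi> s x w] below_pred[OF s w]
  show ?thesis by measurable
qed

text \<open>With space moved innermost, \<open>bound\<close> can be any semigroup estimate at fixed
  time and path. The time \<open>s = t\<close>, at which the kernel series degenerates, is removed
  as a null set.\<close>

lemma heat_part_integral:
  assumes \<phi>: "jointly_measurable M \<phi>"
    and a[measurable]: "a \<in> borel_measurable borel"
    and bound: "\<And>s w. w \<in> space M \<Longrightarrow> 0 \<le> s \<Longrightarrow> s < t \<Longrightarrow>
       (\<integral>\<^sup>+x. ennreal ((heat_int \<phi> t s x w)\<^sup>2) \<partial>unit_lborel) \<le> B s w"
  shows "(\<integral>\<^sup>+x. \<integral>\<^sup>+w. \<integral>\<^sup>+s. a s * ((if below R s w then ennreal ((heat_int \<phi> t s x w)\<^sup>2) else 0) * indicator {0..t} s)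
      \<partial>lborel \<partial>M \<partial>unit_lborel)
    \<le> (\<integral>\<^sup>+s. a s * (\<integral>\<^sup>+w. (if below R s w then B s w else 0) \<partial>M) * indicator {0..t} s \<partial>lborel)"
proof -
  interpret U: sigma_finite_measure unit_lborel by (rule sigma_finite_unit_lborel)
  let ?X = "\<lambda>x w s. a s * ((if below R s w then ennreal ((heat_int \<phi> t s x w)\<^sup>2) else 0) * indicator {0..t} s)"
  note X = heat_part_joint[OF \<phi> a]
  have "(\<integral>\<^sup>+x. \<integral>\<^sup>+w. \<integral>\<^sup>+s. ?X x w s \<partial>lborel \<partial>M \<partial>unit_lborel) = (\<integral>\<^sup>+s. \<integral>\<^sup>+w. \<integral>\<^sup>+x. ?X x w s \<partial>unit_lborel \<partial>M \<partial>lborel)"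
    by (rule nn_integral_triple_swap[OF lborel.sigma_finite_measure_axioms sigma_finite_unit_lborel sigma_finite_measure_axioms X])
  also have "\<dots> \<le> (\<integral>\<^sup>+s. a s * (\<integral>\<^sup>+w. (if below R s w then B s w else 0) \<partial>M) * indicator {0..t} s \<partial>lborel)"
  proof (rule nn_integral_mono_AE)
    show "AE s in lborel. (\<integral>\<^sup>+w. \<integral>\<^sup>+x. ?X x w s \<partial>unit_lborel \<partial>M)
        \<le> a s * (\<integral>\<^sup>+w. (if below R s w then B s w else 0) \<partial>M) * indicator {0..t} s"
      using AE_lborel_singleton[of t]
    proof eventually_elim
      case (elim s)
      show ?case
      proof (cases "s \<in> {0..t}")
        case True
        then have st: "0 \<le> s" "s < t" using elim by auto
        let ?I = "\<lambda>w. \<integral>\<^sup>+x. ennreal ((heat_int \<phi> t s x w)\<^sup>2) \<partial>unit_lborel"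
        have I_meas: "(\<lambda>w. if below R s w then ?I w else 0) \<in> borel_measurable M"
        proof -
          have p: "Measurable.pred M (\<lambda>w. below R s w)" by (rule below_pred) auto
          have "(\<lambda>z. ennreal ((heat_int \<phi> t s (snd z) (fst z))\<^sup>2)) \<in> borel_measurable (M \<Otimes>\<^sub>M unit_lborel)"
            using heat_int_meas[OF \<phi> measurable_const measurable_compose[OF measurable_snd measurable_ident_restrict_borel(2)] measurable_fst, of s]
            by measurable
          then have "?I \<in> borel_measurable M"
            by (intro U.borel_measurable_nn_integral) (simp add: case_prod_unfold)
          with p show ?thesis by measurable
        qed
        have "(\<integral>\<^sup>+w. \<integral>\<^sup>+x. ?X x w s \<partial>unit_lborel \<partial>M) = (\<integral>\<^sup>+w. a s * (if below R s w then ?I w else 0) \<partial>M)"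
        proof (intro nn_integral_cong)
          fix w assume w: "w \<in> space M"
          have [measurable]: "(\<lambda>x. heat_int \<phi> t s x w) \<in> borel_measurable unit_lborel"
            by (rule heat_int_meas[OF \<phi> measurable_const measurable_ident_restrict_borel(2) measurable_const[OF w]]) simp
          show "(\<integral>\<^sup>+x. ?X x w s \<partial>unit_lborel) = a s * (if below R s w then ?I w else 0)"
            using True by (cases "below R s w") (simp_all add: nn_integral_cmult)
        qed
        also have "\<dots> = a s * (\<integral>\<^sup>+w. (if below R s w then ?I w else 0) \<partial>M)"
          by (rule nn_integral_cmult[OF I_meas])
        also have "\<dots> \<le> a s * (\<integral>\<^sup>+w. (if below R s w then B s w else 0) \<partial>M)"
          using bound st by (intro mult_left_mono nn_integral_mono) auto
        finally show ?thesis using True by simp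
      qed simp
    qed
  qed
  finally show ?thesis .
qed

text \<open>The pathwise case distinction survives the expectation: if the second moment is zero
  then almost every path retained by the cut-off has zero difference, and otherwise the constant
  integrates to at most itself under a probability measure.\<close>

lemma bounded_part_moment:
  assumes N: "1 \<le> N"
  shows "(\<integral>\<^sup>+w. (if below R s w then \<integral>\<^sup>+y. ennreal ((fbounded N s y w)\<^sup>2) \<partial>unit_lborel else 0) \<partial>M)
     \<le> ennreal (2 * (c3 + c5)\<^sup>2) * (if second_moment R s = 0 then 0
         else ennreal (N\<^sup>2) * second_moment R s + ennreal (exp (- 2 * N)))"
proof -
  let ?H = "second_moment R s"
  let ?K = "ennreal (2 * (c3 + c5)\<^sup>2)"
  let ?X = "\<lambda>w. sq_norm (\<lambda>y. diff s y w)"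
  let ?G = "\<lambda>w. if below R s w then (if ?X w = 0 then 0 else ennreal (N\<^sup>2) * ?X w + ennreal (exp (- 2 * N))) else 0"
  have X_meas[measurable]: "?X \<in> borel_measurable M" by (rule sq_diff_meas) auto
  have p[measurable]: "Measurable.pred M (\<lambda>w. below R s w)" by (rule below_pred) auto
  have "(\<integral>\<^sup>+w. (if below R s w then \<integral>\<^sup>+y. ennreal ((fbounded N s y w)\<^sup>2) \<partial>unit_lborel else 0) \<partial>M)
      \<le> (\<integral>\<^sup>+w. ?K * ?G w \<partial>M)"
  proof (rule nn_integral_mono)
    fix w assume w: "w \<in> space M"
    show "(if below R s w then \<integral>\<^sup>+y. ennreal ((fbounded N s y w)\<^sup>2) \<partial>unit_lborel else 0) \<le> ?K * ?G w"
      using clamped_part_square_integral[OF measurable_section_unit[OF diff_meas w, where s = s]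
          measurable_section_unit[OF fbounded_meas w, where s = s] N nonneg(1,3) fbounded_bounds(1)[OF N] fbounded_bounds(3)[OF N]]
      unfolding sq_norm_def by (cases "below R s w") (simp_all only: if_True if_False zero_le)
  qed
  also have "\<dots> = ?K * (\<integral>\<^sup>+w. ?G w \<partial>M)" by (rule nn_integral_cmult) measurable
  also have "\<dots> \<le> ?K * (if ?H = 0 then 0 else ennreal (N\<^sup>2) * ?H + ennreal (exp (- 2 * N)))"
  proof (rule mult_left_mono)
    show "(\<integral>\<^sup>+w. ?G w \<partial>M) \<le> (if ?H = 0 then 0 else ennreal (N\<^sup>2) * ?H + ennreal (exp (- 2 * N)))"
    proof (cases "?H = 0")
      case True
      then have "AE w in M. (if below R s w then ?X w else 0) = 0"
        unfolding second_moment_def by (subst (asm) nn_integral_0_iff_AE) measurable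
      then have "AE w in M. ?G w = 0" by eventually_elim (auto split: if_splits)
      then have "(\<integral>\<^sup>+w. ?G w \<partial>M) = 0" by (subst nn_integral_0_iff_AE) measurable
      then show ?thesis by simp
    next
      case False
      have "(\<integral>\<^sup>+w. ?G w \<partial>M) \<le> (\<integral>\<^sup>+w. ennreal (N\<^sup>2) * (if below R s w then ?X w else 0) + ennreal (exp (- 2 * N)) \<partial>M)"
        by (intro nn_integral_mono) auto
      also have "\<dots> = ennreal (N\<^sup>2) * ?H + ennreal (exp (- 2 * N))"
        unfolding second_moment_def
        by (subst nn_integral_add, measurable) (simp add: nn_integral_cmult emeasure_space_1)
      finally show ?thesis using False by simp
    qed
  qed simp
  finally show ?thesis .
qed

text \<open>The cut-off is what bounds the norms of \<open>u\<close> and \<open>v\<close> by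
  \<open>R\<close> here, which makes the quadratic remainder linear in the difference. The factor
  \<open>k\<close> stands for the heat trace at a fixed time.\<close>

lemma rest_part_moment:
  assumes N: "1 \<le> N" and s: "s \<in> {0..T}" and R: "0 \<le> R"
  shows "(\<integral>\<^sup>+w. (if below R s w then k * (\<integral>\<^sup>+y. ennreal \<bar>frest N s y w\<bar> \<partial>unit_lborel)\<^sup>2 else 0) \<partial>M)
     \<le> ennreal (4 * c4\<^sup>2 * R) * (k * second_moment R s)"
proof -
  let ?X = "\<lambda>w. sq_norm (\<lambda>y. diff s y w)"
  have X_meas[measurable]: "?X \<in> borel_measurable M" by (rule sq_diff_meas) auto
  have p[measurable]: "Measurable.pred M (\<lambda>w. below R s w)" by (rule below_pred) auto
  have "(\<integral>\<^sup>+w. (if below R s w then k * (\<integral>\<^sup>+y. ennreal \<bar>frest N s y w\<bar> \<partial>unit_lborel)\<^sup>2 else 0) \<partial>M)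
      \<le> (\<integral>\<^sup>+w. (ennreal (4 * c4\<^sup>2 * R) * k) * (if below R s w then ?X w else 0) \<partial>M)"
  proof (rule nn_integral_mono_AE)
    show "AE w in M. (if below R s w then k * (\<integral>\<^sup>+y. ennreal \<bar>frest N s y w\<bar> \<partial>unit_lborel)\<^sup>2 else 0)
        \<le> (ennreal (4 * c4\<^sup>2 * R) * k) * (if below R s w then ?X w else 0)"
      using below_bound[of R] AE_space
    proof eventually_elim
      case (elim w)
      show ?case
      proof (cases "below R s w")
        case True
        then have "sq_norm (\<lambda>y. u s y w) \<le> ennreal R" "sq_norm (\<lambda>y. v s y w) \<le> ennreal R" using elim(1) s by auto
        then have "(\<integral>\<^sup>+y. ennreal \<bar>frest N s y w\<bar> \<partial>unit_lborel)\<^sup>2 \<le> ennreal (4 * c4\<^sup>2 * R) * ?X w"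
          unfolding sq_norm_def
          by (intro quadratic_part_integral[OF measurable_section_unit[OF u_meas elim(2)] measurable_section_unit[OF v_meas elim(2)]
              measurable_section_unit[OF diff_meas elim(2)] nonneg(2) fbounded_bounds(5)[OF N]] R)
        then have "k * (\<integral>\<^sup>+y. ennreal \<bar>frest N s y w\<bar> \<partial>unit_lborel)\<^sup>2 \<le> k * (ennreal (4 * c4\<^sup>2 * R) * ?X w)"
          by (rule mult_left_mono) simp
        then show ?thesis using True by (simp add: mult_ac)
      qed simp
    qed
  qed
  also have "\<dots> = (ennreal (4 * c4\<^sup>2 * R) * k) * second_moment R s"
    unfolding second_moment_def by (rule nn_integral_cmult) measurable
  finally show ?thesis by (simp add: mult_ac)
qed

lemma noise_part_joint:
  "(\<lambda>z. (if below R (snd (snd z)) (fst (snd z)) then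
      \<integral>\<^sup>+y. ennreal ((heat_kernel (t - snd (snd z)) (fst z) y * gdiff (snd (snd z)) y (fst (snd z)))\<^sup>2) \<partial>unit_lborel else 0)
      * indicator {0..t} (snd (snd z))) \<in> borel_measurable (unit_lborel \<Otimes>\<^sub>M (M \<Otimes>\<^sub>M (lborel :: real measure)))"
proof -
  interpret U: sigma_finite_measure unit_lborel by (rule sigma_finite_unit_lborel)
  let ?N = "unit_lborel \<Otimes>\<^sub>M (M \<Otimes>\<^sub>M (lborel :: real measure))"
  have x: "fst \<in> borel_measurable ?N"
    by (rule measurable_compose[OF measurable_fst measurable_ident_restrict_borel(2)])
  have w: "(\<lambda>z. fst (snd z)) \<in> measurable ?N M" by measurable
  have s: "(\<lambda>z. snd (snd z)) \<in> borel_measurable ?N" by measurable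
  note x1 = measurable_compose[OF measurable_fst x] and s1 = measurable_compose[OF measurable_fst s]
    and w1 = measurable_compose[OF measurable_fst w]
    and y1 = measurable_compose[OF measurable_snd measurable_ident_restrict_borel(2)]
  have 1: "(\<lambda>z. heat_kernel (t - snd (snd (fst z))) (fst (fst z)) (snd z)) \<in> borel_measurable (?N \<Otimes>\<^sub>M unit_lborel)"
    by (rule measurable_heat_kernel[OF borel_measurable_diff[OF borel_measurable_const s1] x1 y1])
  have 2: "(\<lambda>z. gdiff (snd (snd (fst z))) (snd z) (fst (snd (fst z)))) \<in> borel_measurable (?N \<Otimes>\<^sub>M unit_lborel)"
    by (rule measurable_triple_compose[OF gdiff_meas s1 y1 w1])
  have "(\<lambda>z. ennreal ((heat_kernel (t - snd (snd (fst z))) (fst (fst z)) (snd z) *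
      gdiff (snd (snd (fst z))) (snd z) (fst (snd (fst z))))\<^sup>2)) \<in> borel_measurable (?N \<Otimes>\<^sub>M unit_lborel)"
    by (rule measurable_compose[OF borel_measurable_power[OF borel_measurable_times[OF 1 2]] measurable_ennreal])
  then have [measurable]: "(\<lambda>z. \<integral>\<^sup>+y. ennreal ((heat_kernel (t - snd (snd z)) (fst z) y *
      gdiff (snd (snd z)) y (fst (snd z)))\<^sup>2) \<partial>unit_lborel) \<in> borel_measurable ?N"
    by (intro U.borel_measurable_nn_integral) (simp only: case_prod_unfold)
  note [measurable] = below_pred[OF s w]
  show ?thesis by measurable
qed

text \<open>Integrating over \<open>x\<close> first leaves the squared kernel norm, bounded by the
  trace uniformly in \<open>y\<close>; the Lipschitz bound then acts under the remaining
  integral.\<close>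

lemma noise_part_integral:
  "(\<integral>\<^sup>+x. \<integral>\<^sup>+w. stopped_energy t (\<lambda>s. below R s w) (\<lambda>s y. heat_kernel (t - s) x y * gdiff s y w) \<partial>M \<partial>unit_lborel)
    \<le> ennreal (d3\<^sup>2) * (\<integral>\<^sup>+s. heat_trace (t - s) * second_moment R s * indicator {0..t} s \<partial>lborel)"
proof -
  interpret U: sigma_finite_measure unit_lborel by (rule sigma_finite_unit_lborel)
  interpret UU: pair_sigma_finite unit_lborel unit_lborel
    by (rule pair_sigma_finite.intro[OF sigma_finite_unit_lborel sigma_finite_unit_lborel])
  let ?I = "\<lambda>x w s. \<integral>\<^sup>+y. ennreal ((heat_kernel (t - s) x y * gdiff s y w)\<^sup>2) \<partial>unit_lborel"
  let ?X = "\<lambda>x w s. (if below R s w then ?I x w s else 0) * indicator {0..t} s"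
  note X = noise_part_joint
  have kernel: "(\<integral>\<^sup>+x. ?I x w s \<partial>unit_lborel) \<le> ennreal (d3\<^sup>2) * heat_trace (t - s) * sq_norm (\<lambda>y. diff s y w)"
    if w: "w \<in> space M" and st: "s < t" for w s
  proof -
    let ?f = "\<lambda>x y. ennreal ((heat_kernel (t - s) x y * gdiff s y w)\<^sup>2)"
    have g_sec: "(\<lambda>y. gdiff s y w) \<in> borel_measurable unit_lborel" by (rule measurable_section_unit[OF gdiff_meas w])
    have d_sec[measurable]: "(\<lambda>y. diff s y w) \<in> borel_measurable unit_lborel" by (rule measurable_section_unit[OF diff_meas w])
    note y2 = measurable_compose[OF measurable_snd measurable_ident_restrict_borel(2)]
      and x2 = measurable_compose[OF measurable_fst measurable_ident_restrict_borel(2)]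
    have f_meas: "(\<lambda>z. ?f (fst z) (snd z)) \<in> borel_measurable (unit_lborel \<Otimes>\<^sub>M unit_lborel)"
      by (rule measurable_compose[OF borel_measurable_power[OF borel_measurable_times[OF
            measurable_heat_kernel[OF borel_measurable_const x2 y2] measurable_compose[OF measurable_snd g_sec]]] measurable_ennreal])
    have "(\<integral>\<^sup>+x. ?I x w s \<partial>unit_lborel) = (\<integral>\<^sup>+y. \<integral>\<^sup>+x. ?f x y \<partial>unit_lborel \<partial>unit_lborel)"
      by (rule UU.Fubini'[symmetric]) (use f_meas in \<open>simp only: case_prod_unfold\<close>)
    also have "\<dots> \<le> (\<integral>\<^sup>+y. (ennreal (d3\<^sup>2) * heat_trace (t - s)) * ennreal ((diff s y w)\<^sup>2) \<partial>unit_lborel)"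
    proof (intro nn_integral_mono)
      fix y
      have [measurable]: "(\<lambda>x. heat_kernel (t - s) x y) \<in> borel_measurable unit_lborel"
        by (rule measurable_heat_kernel[OF borel_measurable_const measurable_ident_restrict_borel(2) borel_measurable_const])
      have "(\<integral>\<^sup>+x. ?f x y \<partial>unit_lborel) = (\<integral>\<^sup>+x. ennreal ((gdiff s y w)\<^sup>2) * ennreal ((heat_kernel (t - s) x y)\<^sup>2) \<partial>unit_lborel)"
        by (intro nn_integral_cong) (simp add: power_mult_distrib ennreal_mult' mult.commute)
      also have "\<dots> = ennreal ((gdiff s y w)\<^sup>2) * (\<integral>\<^sup>+x. ennreal ((heat_kernel (t - s) x y)\<^sup>2) \<partial>unit_lborel)"
        by (rule nn_integral_cmult) measurable
      also have "\<dots> \<le> ennreal (d3\<^sup>2 * (diff s y w)\<^sup>2) * heat_trace (t - s)"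
        using st by (intro mult_mono ennreal_leI gdiff_bound heat_kernel_square_integral) auto
      also have "\<dots> = (ennreal (d3\<^sup>2) * heat_trace (t - s)) * ennreal ((diff s y w)\<^sup>2)"
        by (simp add: ennreal_mult' mult_ac)
      finally show "(\<integral>\<^sup>+x. ?f x y \<partial>unit_lborel) \<le> (ennreal (d3\<^sup>2) * heat_trace (t - s)) * ennreal ((diff s y w)\<^sup>2)" .
    qed
    also have "\<dots> = (ennreal (d3\<^sup>2) * heat_trace (t - s)) * sq_norm (\<lambda>y. diff s y w)"
      unfolding sq_norm_def by (rule nn_integral_cmult) measurable
    finally show ?thesis .
  qed
  have "(\<integral>\<^sup>+x. \<integral>\<^sup>+w. stopped_energy t (\<lambda>s. below R s w) (\<lambda>s y. heat_kernel (t - s) x y * gdiff s y w) \<partial>M \<partial>unit_lborel)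
      = (\<integral>\<^sup>+s. \<integral>\<^sup>+w. \<integral>\<^sup>+x. ?X x w s \<partial>unit_lborel \<partial>M \<partial>lborel)"
    unfolding stopped_energy_def
    by (rule nn_integral_triple_swap[OF lborel.sigma_finite_measure_axioms sigma_finite_unit_lborel sigma_finite_measure_axioms X])
  also have "\<dots> \<le> (\<integral>\<^sup>+s. ennreal (d3\<^sup>2) * (heat_trace (t - s) * second_moment R s * indicator {0..t} s) \<partial>lborel)"
  proof (rule nn_integral_mono_AE)
    show "AE s in lborel. (\<integral>\<^sup>+w. \<integral>\<^sup>+x. ?X x w s \<partial>unit_lborel \<partial>M)
        \<le> ennreal (d3\<^sup>2) * (heat_trace (t - s) * second_moment R s * indicator {0..t} s)"
      using AE_lborel_singleton[of t]
    proof eventually_elim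
      case (elim s)
      show ?case
      proof (cases "s \<in> {0..t}")
        case True
        then have st: "s < t" using elim by auto
        have X_meas[measurable]: "(\<lambda>w. sq_norm (\<lambda>y. diff s y w)) \<in> borel_measurable M" by (rule sq_diff_meas) auto
        have p[measurable]: "Measurable.pred M (\<lambda>w. below R s w)" by (rule below_pred) auto
        have "(\<integral>\<^sup>+w. \<integral>\<^sup>+x. ?X x w s \<partial>unit_lborel \<partial>M)
            \<le> (\<integral>\<^sup>+w. (ennreal (d3\<^sup>2) * heat_trace (t - s)) * (if below R s w then sq_norm (\<lambda>y. diff s y w) else 0) \<partial>M)"
        proof (rule nn_integral_mono)
          fix w assume w: "w \<in> space M"
          show "(\<integral>\<^sup>+x. ?X x w s \<partial>unit_lborel)
              \<le> (ennreal (d3\<^sup>2) * heat_trace (t - s)) * (if below R s w then sq_norm (\<lambda>y. diff s y w) else 0)"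
            using kernel[OF w st] True by (cases "below R s w") simp_all
        qed
        also have "\<dots> = (ennreal (d3\<^sup>2) * heat_trace (t - s)) * second_moment R s"
          unfolding second_moment_def by (rule nn_integral_cmult) measurable
        finally show ?thesis using True by (simp add: mult_ac)
      qed simp
    qed
  qed
  also have "\<dots> = ennreal (d3\<^sup>2) * (\<integral>\<^sup>+s. heat_trace (t - s) * second_moment R s * indicator {0..t} s \<partial>lborel)"
  proof (rule nn_integral_cmult)
    note [measurable] = second_moment_meas
    show "(\<lambda>s. heat_trace (t - s) * second_moment R s * indicator {0..t} s) \<in> borel_measurable lborel" by measurable
  qed
  finally show ?thesis .
qed

text \<open>The mild equation holds for almost every \<open>x\<close>, with exceptional paths that
  depend on \<open>x\<close>. The expectation has to be taken inside the space integral before the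
  equation can be inserted.\<close>

lemma second_moment_eq:
  "second_moment R t = (\<integral>\<^sup>+x. \<integral>\<^sup>+w. (if below R t w then ennreal ((diff t x w)\<^sup>2) else 0) \<partial>M \<partial>unit_lborel)"
proof -
  interpret UM: pair_sigma_finite unit_lborel M
    by (rule pair_sigma_finite.intro[OF sigma_finite_unit_lborel sigma_finite_measure_axioms])
  have "Measurable.pred (unit_lborel \<Otimes>\<^sub>M M) (\<lambda>z. below R t (snd z))"
    by (rule below_pred[OF measurable_const measurable_snd]) simp
  moreover have "(\<lambda>z. diff t (fst z) (snd z)) \<in> borel_measurable (unit_lborel \<Otimes>\<^sub>M M)"
    by (rule measurable_triple_compose[OF diff_meas measurable_const
        measurable_compose[OF measurable_fst measurable_ident_restrict_borel(2)] measurable_snd]) simp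
  ultimately have joint: "(\<lambda>z. if below R t (snd z) then ennreal ((diff t (fst z) (snd z))\<^sup>2) else 0)
      \<in> borel_measurable (unit_lborel \<Otimes>\<^sub>M M)" by measurable
  have "second_moment R t = (\<integral>\<^sup>+w. \<integral>\<^sup>+x. (if below R t w then ennreal ((diff t x w)\<^sup>2) else 0) \<partial>unit_lborel \<partial>M)"
    unfolding second_moment_def sq_norm_def by (intro nn_integral_cong) simp
  also have "\<dots> = (\<integral>\<^sup>+x. \<integral>\<^sup>+w. (if below R t w then ennreal ((diff t x w)\<^sup>2) else 0) \<partial>M \<partial>unit_lborel)"
    by (rule UM.Fubini') (use joint in \<open>simp only: case_prod_unfold\<close>)
  finally show ?thesis .
qed

text \<open>Origin of the constants: \<open>3\<close> from squaring three terms,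
  \<open>2 * (c3 + c5)\<^sup>2\<close> from the clamped drift, \<open>4 * c4\<^sup>2 * R\<close>
  from the remainder, \<open>T\<close> from its unweighted Cauchy-Schwarz inequality, and
  \<open>d3\<^sup>2\<close> from the noise.\<close>

lemma second_moment_inequality:
  assumes t: "t \<in> {0..T}" and N: "1 \<le> N" and l: "0 < l" and R: "0 \<le> R"
  shows "second_moment R t \<le> ennreal (6 * (c3 + c5)\<^sup>2 / l) *
      (\<integral>\<^sup>+s. ennreal (exp (l * (t - s))) * (if second_moment R s = 0 then 0
         else ennreal (N\<^sup>2) * second_moment R s + ennreal (exp (- 2 * N))) * indicator {0..t} s \<partial>lborel)
    + ennreal (3 * (T * (4 * c4\<^sup>2 * R) + d3\<^sup>2)) *
      (\<integral>\<^sup>+s. heat_trace (t - s) * second_moment R s * indicator {0..t} s \<partial>lborel)"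
proof -
  let ?e = "\<lambda>s. ennreal (exp (l * (t - s)))"
  let ?X = "\<lambda>a \<phi> x w s. a s * ((if below R s w then ennreal ((heat_int \<phi> t s x w)\<^sup>2) else 0) * indicator {0..t} s)"
  let ?A = "\<lambda>x. \<integral>\<^sup>+w. \<integral>\<^sup>+s. ?X ?e (fbounded N) x w s \<partial>lborel \<partial>M"
  let ?B = "\<lambda>x. \<integral>\<^sup>+w. \<integral>\<^sup>+s. ?X (\<lambda>s. 1) (frest N) x w s \<partial>lborel \<partial>M"
  let ?D = "\<lambda>x. \<integral>\<^sup>+w. stopped_energy t (\<lambda>s. below R s w) (\<lambda>s y. heat_kernel (t - s) x y * gdiff s y w) \<partial>M"
  let ?G = "\<lambda>s. if second_moment R s = 0 then 0 else ennreal (N\<^sup>2) * second_moment R s + ennreal (exp (- 2 * N))"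
  let ?I1 = "\<integral>\<^sup>+s. ?e s * ?G s * indicator {0..t} s \<partial>lborel"
  let ?I2 = "\<integral>\<^sup>+s. heat_trace (t - s) * second_moment R s * indicator {0..t} s \<partial>lborel"
  have em: "?e \<in> borel_measurable borel" and om: "(\<lambda>s::real. 1::ennreal) \<in> borel_measurable borel" by measurable
  have A_meas: "?A \<in> borel_measurable unit_lborel"
    by (rule borel_measurable_double_nn_integral[OF lborel.sigma_finite_measure_axioms sigma_finite_measure_axioms
        heat_part_joint[OF fbounded_meas em]])
  have B_meas: "?B \<in> borel_measurable unit_lborel"
    by (rule borel_measurable_double_nn_integral[OF lborel.sigma_finite_measure_axioms sigma_finite_measure_axioms
        heat_part_joint[OF frest_meas om]])
  have D_meas: "?D \<in> borel_measurable unit_lborel"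
    unfolding stopped_energy_def
    by (rule borel_measurable_double_nn_integral[OF lborel.sigma_finite_measure_axioms sigma_finite_measure_axioms
        noise_part_joint])
  note [measurable] = second_moment_meas
  have A: "(\<integral>\<^sup>+x. ?A x \<partial>unit_lborel) \<le> ennreal (2 * (c3 + c5)\<^sup>2) * ?I1"
  proof -
    have "(\<integral>\<^sup>+x. ?A x \<partial>unit_lborel) \<le> (\<integral>\<^sup>+s. ?e s *
        (\<integral>\<^sup>+w. (if below R s w then \<integral>\<^sup>+y. ennreal ((fbounded N s y w)\<^sup>2) \<partial>unit_lborel else 0) \<partial>M) * indicator {0..t} s \<partial>lborel)"
      unfolding heat_int_def
      by (rule heat_part_integral[OF fbounded_meas em, unfolded heat_int_def])
         (rule heat_semigroup_L2_contraction[OF _ measurable_section_unit[OF fbounded_meas]], simp_all)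
    also have "\<dots> \<le> (\<integral>\<^sup>+s. ennreal (2 * (c3 + c5)\<^sup>2) * (?e s * ?G s * indicator {0..t} s) \<partial>lborel)"
    proof (rule nn_integral_mono)
      fix s :: real
      have "?e s * (\<integral>\<^sup>+w. (if below R s w then \<integral>\<^sup>+y. ennreal ((fbounded N s y w)\<^sup>2) \<partial>unit_lborel else 0) \<partial>M) * indicator {0..t} s
          \<le> ?e s * (ennreal (2 * (c3 + c5)\<^sup>2) * ?G s) * indicator {0..t} s"
        by (intro mult_right_mono mult_left_mono bounded_part_moment[OF N]) simp_all
      then show "?e s * (\<integral>\<^sup>+w. (if below R s w then \<integral>\<^sup>+y. ennreal ((fbounded N s y w)\<^sup>2) \<partial>unit_lborel else 0) \<partial>M) * indicator {0..t} s
          \<le> ennreal (2 * (c3 + c5)\<^sup>2) * (?e s * ?G s * indicator {0..t} s)"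
        by (simp only: mult_ac)
    qed
    also have "\<dots> = ennreal (2 * (c3 + c5)\<^sup>2) * ?I1" by (rule nn_integral_cmult) measurable
    finally show ?thesis .
  qed
  have B: "(\<integral>\<^sup>+x. ?B x \<partial>unit_lborel) \<le> ennreal (4 * c4\<^sup>2 * R) * ?I2"
  proof -
    have "(\<integral>\<^sup>+x. ?B x \<partial>unit_lborel) \<le> (\<integral>\<^sup>+s. 1 *
        (\<integral>\<^sup>+w. (if below R s w then heat_trace (t - s) * (\<integral>\<^sup>+y. ennreal \<bar>frest N s y w\<bar> \<partial>unit_lborel)\<^sup>2 else 0) \<partial>M) * indicator {0..t} s \<partial>lborel)"
      unfolding heat_int_def
      by (rule heat_part_integral[OF frest_meas om, unfolded heat_int_def])
         (rule heat_semigroup_L1_L2[OF _ measurable_section_unit[OF frest_meas]], simp_all)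
    also have "\<dots> \<le> (\<integral>\<^sup>+s. ennreal (4 * c4\<^sup>2 * R) * (heat_trace (t - s) * second_moment R s * indicator {0..t} s) \<partial>lborel)"
    proof (rule nn_integral_mono)
      fix s :: real
      show "1 * (\<integral>\<^sup>+w. (if below R s w then heat_trace (t - s) * (\<integral>\<^sup>+y. ennreal \<bar>frest N s y w\<bar> \<partial>unit_lborel)\<^sup>2 else 0) \<partial>M) * indicator {0..t} s
          \<le> ennreal (4 * c4\<^sup>2 * R) * (heat_trace (t - s) * second_moment R s * indicator {0..t} s)"
      proof (cases "s \<in> {0..t}")
        case True
        then have "s \<in> {0..T}" using t by auto
        from rest_part_moment[OF N this R] True show ?thesis by simp
      qed simp
    qed
    also have "\<dots> = ennreal (4 * c4\<^sup>2 * R) * ?I2" by (rule nn_integral_cmult) measurable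
    finally show ?thesis .
  qed
  have "second_moment R t \<le> (\<integral>\<^sup>+x. 3 * (ennreal (1 / l) * ?A x + ennreal t * ?B x + ?D x) \<partial>unit_lborel)"
    unfolding second_moment_eq by (rule nn_integral_mono_AE[OF pointwise_estimate[OF t N l]])
  also have "\<dots> = 3 * (ennreal (1 / l) * (\<integral>\<^sup>+x. ?A x \<partial>unit_lborel) + ennreal t * (\<integral>\<^sup>+x. ?B x \<partial>unit_lborel)
      + (\<integral>\<^sup>+x. ?D x \<partial>unit_lborel))"
  proof -
    have lin: "(\<integral>\<^sup>+w. c * (a * f w + a' * g w + h w) \<partial>unit_lborel)
        = c * (a * (\<integral>\<^sup>+w. f w \<partial>unit_lborel) + a' * (\<integral>\<^sup>+w. g w \<partial>unit_lborel) + (\<integral>\<^sup>+w. h w \<partial>unit_lborel))"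
      if [measurable]: "f \<in> borel_measurable unit_lborel" "g \<in> borel_measurable unit_lborel" "h \<in> borel_measurable unit_lborel"
      for a a' c :: ennreal and f g h
      by (simp add: nn_integral_cmult nn_integral_add)
    show ?thesis by (rule lin[OF A_meas B_meas D_meas])
  qed
  also have "\<dots> \<le> 3 * (ennreal (1 / l) * (ennreal (2 * (c3 + c5)\<^sup>2) * ?I1) + ennreal T * (ennreal (4 * c4\<^sup>2 * R) * ?I2)
      + ennreal (d3\<^sup>2) * ?I2)"
    using t by (intro mult_left_mono add_mono mult_mono A B noise_part_integral ennreal_leI) auto
  also have "\<dots> = ennreal (6 * (c3 + c5)\<^sup>2 / l) * ?I1 + ennreal (3 * (T * (4 * c4\<^sup>2 * R) + d3\<^sup>2)) * ?I2"
  proof -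
    have 1: "ennreal (6 * (c3 + c5)\<^sup>2 / l) = 3 * (ennreal (1 / l) * ennreal (2 * (c3 + c5)\<^sup>2))"
    proof -
      have "6 * (c3 + c5)\<^sup>2 / l = 3 * (1 / l * (2 * (c3 + c5)\<^sup>2))" by simp
      then have "ennreal (6 * (c3 + c5)\<^sup>2 / l) = ennreal (3 * (1 / l * (2 * (c3 + c5)\<^sup>2)))" by (simp only:)
      also have "\<dots> = ennreal 3 * ennreal (1 / l * (2 * (c3 + c5)\<^sup>2))" by (rule ennreal_mult') simp
      also have "ennreal (1 / l * (2 * (c3 + c5)\<^sup>2)) = ennreal (1 / l) * ennreal (2 * (c3 + c5)\<^sup>2)"
        using l by (intro ennreal_mult') simp
      finally show ?thesis by (simp only: ennreal_numeral)
    qed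
    have 2: "ennreal (3 * (T * (4 * c4\<^sup>2 * R) + d3\<^sup>2)) = 3 * (ennreal T * ennreal (4 * c4\<^sup>2 * R) + ennreal (d3\<^sup>2))"
    proof -
      have "ennreal (3 * (T * (4 * c4\<^sup>2 * R) + d3\<^sup>2)) = ennreal 3 * ennreal (T * (4 * c4\<^sup>2 * R) + d3\<^sup>2)"
        by (rule ennreal_mult') simp
      also have "ennreal (T * (4 * c4\<^sup>2 * R) + d3\<^sup>2) = ennreal (T * (4 * c4\<^sup>2 * R)) + ennreal (d3\<^sup>2)"
        using T R by (intro ennreal_plus) auto
      also have "ennreal (T * (4 * c4\<^sup>2 * R)) = ennreal T * ennreal (4 * c4\<^sup>2 * R)" using T by (intro ennreal_mult') simp
      finally show ?thesis by (simp only: ennreal_numeral)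
    qed
    show ?thesis unfolding 1 2 by (simp only: distrib_left distrib_right mult_ac add_ac)
  qed
  finally show ?thesis .
qed

text \<open>The cut-off supplies the finite a priori bound \<open>4 * R\<close> from which the
  Gronwall iteration starts; solutions without moments would not provide one.\<close>

lemma second_moment_zero:
  assumes R: "0 \<le> R" and t: "t \<in> {0..T}"
  shows "second_moment R t = 0"
proof (rule gronwall_osgood[OF second_moment_meas measurable_heat_trace nn_integral_heat_trace_finite _ _ _ _
      second_moment_inequality[OF _ _ _ R] t])
  show "second_moment R t \<le> ennreal (4 * R)" if t: "t \<in> {0..T}" for t
  proof -
    have "AE w in M. (if below R t w then sq_norm (\<lambda>y. diff t y w) else 0) \<le> ennreal (4 * R)"
      using below_bound[of R] AE_space
    proof eventually_elim
      case (elim w)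
      show ?case
      proof (cases "below R t w")
        case True
        then have n: "sq_norm (\<lambda>y. u t y w) \<le> ennreal R" "sq_norm (\<lambda>y. v t y w) \<le> ennreal R" using elim(1) t by auto
        have "sq_norm (\<lambda>y. diff t y w) \<le> 2 * sq_norm (\<lambda>y. u t y w) + 2 * sq_norm (\<lambda>y. diff t y w - u t y w)"
          by (rule sq_norm_split2[OF measurable_section_unit[OF diff_meas elim(2)] measurable_section_unit[OF u_meas elim(2)]])
        also have "sq_norm (\<lambda>y. diff t y w - u t y w) = sq_norm (\<lambda>y. v t y w)"
          by (simp add: sq_norm_def diff_def)
        also have "2 * sq_norm (\<lambda>y. u t y w) + 2 * sq_norm (\<lambda>y. v t y w) \<le> 2 * ennreal R + 2 * ennreal R"
          by (intro add_mono mult_left_mono n) simp_all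
        also have "\<dots> = ennreal (2 * R) + ennreal (2 * R)" by (simp add: ennreal_mult')
        also have "\<dots> = ennreal (4 * R)" using R by (subst ennreal_plus[symmetric]) simp_all
        finally show ?thesis using True by simp
      qed simp
    qed
    then have "second_moment R t \<le> (\<integral>\<^sup>+w. ennreal (4 * R) \<partial>M)"
      unfolding second_moment_def by (rule nn_integral_mono_AE)
    then show ?thesis by (simp add: emeasure_space_1)
  qed
  show "0 \<le> 4 * R" using R by simp
  show "0 \<le> 3 * (T * (4 * c4\<^sup>2 * R) + d3\<^sup>2)" using T R by simp
  show "0 \<le> 6 * (c3 + c5)\<^sup>2" by simp
qed

text \<open>Natural levels and rational times are countable, so one exceptional set suffices.
  Outside it, a continuous path stays below some level throughout, and continuity extends the
  equality from rational times to all times.\<close>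

lemma solutions_coincide: "AE w in M. \<forall>t\<in>{0..T}. sq_norm (\<lambda>y. u t y w - v t y w) = 0"
proof -
  have "AE w in M. of_rat q \<in> {0..T} \<longrightarrow> below (real n) (of_rat q) w \<longrightarrow> sq_norm (\<lambda>y. diff (of_rat q) y w) = 0"
    for n :: nat and q :: rat
  proof (cases "of_rat q \<in> {0..T}")
    case True
    have [measurable]: "(\<lambda>w. sq_norm (\<lambda>y. diff (of_rat q) y w)) \<in> borel_measurable M" by (rule sq_diff_meas) auto
    have [measurable]: "Measurable.pred M (\<lambda>w. below (real n) (of_rat q) w)" by (rule below_pred) auto
    have "second_moment (real n) (of_rat q) = 0" by (rule second_moment_zero[OF _ True]) simp
    then have "AE w in M. (if below (real n) (of_rat q) w then sq_norm (\<lambda>y. diff (of_rat q) y w) else 0) = 0"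
      unfolding second_moment_def by (subst (asm) nn_integral_0_iff_AE) measurable
    then show ?thesis by eventually_elim (auto split: if_splits)
  next
    case False
    show ?thesis by (rule AE_I2) (use False in blast)
  qed
  then have "AE w in M. \<forall>n::nat. \<forall>q::rat. of_rat q \<in> {0..T} \<longrightarrow> below (real n) (of_rat q) w \<longrightarrow>
      sq_norm (\<lambda>y. diff (of_rat q) y w) = 0"
    unfolding AE_all_countable by blast
  then show ?thesis using u_path v_path
  proof eventually_elim
    case (elim w)
    obtain n1 :: nat where n1: "\<And>t. t \<in> {0..T} \<Longrightarrow> sq_norm (\<lambda>y. u t y w) \<le> ennreal (real n1)"
      using L2_path_bounded[OF elim(2)] by blast
    obtain n2 :: nat where n2: "\<And>t. t \<in> {0..T} \<Longrightarrow> sq_norm (\<lambda>y. v t y w) \<le> ennreal (real n2)"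
      using L2_path_bounded[OF elim(3)] by blast
    have below: "below (real (max n1 n2)) s w" for s
      unfolding below_def
    proof (intro allI impI)
      fix q :: rat assume "0 \<le> q" "of_rat q \<le> T"
      then have q: "of_rat q \<in> {0..T}" by simp
      have "ennreal (real n1) \<le> ennreal (real (max n1 n2))" "ennreal (real n2) \<le> ennreal (real (max n1 n2))"
        by (intro ennreal_leI; simp)+
      then show "sq_norm (\<lambda>y. u (of_rat q) y w) \<le> ennreal (real (max n1 n2)) \<and>
          sq_norm (\<lambda>y. v (of_rat q) y w) \<le> ennreal (real (max n1 n2))"
        using n1[OF q] n2[OF q] by (blast intro: order_trans)
    qed
    show ?case
    proof
      fix t assume t: "t \<in> {0..T}"
      show "sq_norm (\<lambda>y. u t y w - v t y w) = 0"
        by (rule L2_path_eq_of_rat[OF elim(2,3) T _ t]) (use elim(1) below in \<open>unfold diff_def, blast\<close>)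
    qed
  qed
qed

end

section \<open>Transfer between the Borel and the Lebesgue formulation\<close>

lemma nn_integral_lebesgue_on_unit:
  "(\<integral>\<^sup>+x. f x \<partial>lebesgue_on {0..1}) = (\<integral>\<^sup>+x. f x \<partial>unit_lborel)"
  by (simp add: nn_integral_restrict_space nn_integral_completion)

lemma L2_sq_norm:
  assumes "L2 f"
  shows "sq_norm f = ennreal ((L2_norm f)\<^sup>2)"
proof -
  have i: "integrable (lebesgue_on {0..1}) (\<lambda>x. (f x)\<^sup>2)" using assms by (simp add: L2_def)
  have "sq_norm f = (\<integral>\<^sup>+x. ennreal ((f x)\<^sup>2) \<partial>lebesgue_on {0..1})"
    by (simp only: sq_norm_def nn_integral_lebesgue_on_unit)
  also have "\<dots> = ennreal (LINT x|lebesgue_on {0..1}. (f x)\<^sup>2)"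
    by (rule nn_integral_eq_integral[OF i]) simp
  also have "(LINT x|lebesgue_on {0..1}. (f x)\<^sup>2) = (L2_norm f)\<^sup>2"
    unfolding L2_norm_def by (rule real_sqrt_pow2[symmetric]) simp
  finally show ?thesis .
qed

lemma L2_diff:
  assumes "L2 f" "L2 g"
  shows "L2 (\<lambda>x. f x - g x)"
  unfolding L2_def
proof
  have [measurable]: "f \<in> borel_measurable (lebesgue_on {0..1})" "g \<in> borel_measurable (lebesgue_on {0..1})"
    using assms by (auto simp: L2_def)
  show "(\<lambda>x. f x - g x) \<in> borel_measurable (lebesgue_on {0..1})" by measurable
  show "integrable (lebesgue_on {0..1}) (\<lambda>x. (f x - g x)\<^sup>2)"
  proof (rule Bochner_Integration.integrable_bound)
    show "integrable (lebesgue_on {0..1}) (\<lambda>x. 2 * (f x)\<^sup>2 + 2 * (g x)\<^sup>2)"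
      using assms by (auto simp: L2_def)
    show "AE x in lebesgue_on {0..1}. norm ((f x - g x)\<^sup>2) \<le> norm (2 * (f x)\<^sup>2 + 2 * (g x)\<^sup>2)"
    proof (rule AE_I2)
      fix x
      have "0 \<le> (f x + g x)\<^sup>2" by simp
      then have "(f x - g x)\<^sup>2 \<le> 2 * (f x)\<^sup>2 + 2 * (g x)\<^sup>2" by (simp add: power2_sum power2_diff)
      then show "norm ((f x - g x)\<^sup>2) \<le> norm (2 * (f x)\<^sup>2 + 2 * (g x)\<^sup>2)" by simp
    qed
  qed measurable
qed

lemma sq_norm_cong: "(\<And>y. y \<in> {0..1} \<Longrightarrow> f y = g y) \<Longrightarrow> sq_norm f = sq_norm g"
  unfolding sq_norm_def by (intro nn_integral_unit_cong) simp

lemma path_in_C_L2_imp_L2_path: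
  assumes f: "path_in_C_L2 T f" and eq: "\<And>t y. t \<in> {0..T} \<Longrightarrow> y \<in> {0..1} \<Longrightarrow> g t y = f t y"
    and meas: "\<And>t. t \<in> {0..T} \<Longrightarrow> g t \<in> borel_measurable unit_lborel"
  shows "L2_path T g"
  unfolding L2_path_def
proof (intro conjI ballI)
  fix t assume t: "t \<in> {0..T}"
  show "g t \<in> borel_measurable unit_lborel" by (rule meas[OF t])
  have "sq_norm (g t) = sq_norm (f t)" by (rule sq_norm_cong[OF eq[OF t]])
  also have "\<dots> = ennreal ((L2_norm (f t))\<^sup>2)" using f t by (intro L2_sq_norm) (simp add: path_in_C_L2_def)
  finally show "sq_norm (g t) < \<infinity>" by simp
next
  fix s assume s: "s \<in> {0..T}"
  have "((\<lambda>t. L2_norm (\<lambda>x. f t x - f s x)) \<longlongrightarrow> 0) (at s within {0..T})"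
    using f s by (simp add: path_in_C_L2_def)
  then have "((\<lambda>t. ennreal ((L2_norm (\<lambda>x. f t x - f s x))\<^sup>2)) \<longlongrightarrow> ennreal (0\<^sup>2)) (at s within {0..T})"
    by (intro tendsto_ennrealI tendsto_power)
  then have lim: "((\<lambda>t. ennreal ((L2_norm (\<lambda>x. f t x - f s x))\<^sup>2)) \<longlongrightarrow> 0) (at s within {0..T})" by simp
  show "((\<lambda>t. sq_norm (\<lambda>x. g t x - g s x)) \<longlongrightarrow> 0) (at s within {0..T})"
  proof (rule Lim_transform_eventually[OF lim])
    show "\<forall>\<^sub>F t in at s within {0..T}. ennreal ((L2_norm (\<lambda>x. f t x - f s x))\<^sup>2) = sq_norm (\<lambda>x. g t x - g s x)"
      unfolding eventually_at_filter
    proof (rule always_eventually, intro allI impI)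
      fix t assume t: "t \<in> {0..T}"
      have "L2 (f t)" "L2 (f s)" using f s t by (auto simp: path_in_C_L2_def)
      then have "sq_norm (\<lambda>x. f t x - f s x) = ennreal ((L2_norm (\<lambda>x. f t x - f s x))\<^sup>2)"
        by (intro L2_sq_norm L2_diff)
      moreover have "sq_norm (\<lambda>x. g t x - g s x) = sq_norm (\<lambda>x. f t x - f s x)"
        by (rule sq_norm_cong) (simp only: eq[OF s] eq[OF t])
      ultimately show "ennreal ((L2_norm (\<lambda>x. f t x - f s x))\<^sup>2) = sq_norm (\<lambda>x. g t x - g s x)" by simp
    qed
  qed
qed

lemma AE_lebesgue_on_unit:
  assumes "AE x in lebesgue_on {0..1}. P x"
  shows "AE x in unit_lborel. P x"
  using assms by (simp add: AE_restrict_space_iff AE_completion_iff)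

text \<open>A mild solution is unconstrained outside \<open>[0,T] \<times> [0,1]\<close>, so joint
  measurability on the whole line has to be produced by an extension.\<close>

definition zero_extension :: "real \<Rightarrow> (real \<Rightarrow> real \<Rightarrow> 'w \<Rightarrow> real) \<Rightarrow> real \<Rightarrow> real \<Rightarrow> 'w \<Rightarrow> real" where
  "zero_extension T u s y w = (if s \<in> {0..T} \<and> y \<in> {0..1} then u s y w else 0)"

lemma zero_extension_eq: "s \<in> {0..T} \<Longrightarrow> y \<in> {0..1} \<Longrightarrow> zero_extension T u s y w = u s y w"
  by (simp add: zero_extension_def)

lemma mild_solution_zero_extension:
  assumes sol: "mild_solution M F W b \<sigma> u0 T u" and path: "AE w in M. path_in_C_L2 T (\<lambda>t x. u t x w)"
  shows "jointly_measurable M (\<lambda>s y w. zero_extension T u s y w)"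
    "\<And>t x. t \<in> {0..T} \<Longrightarrow> x \<in> {0..1} \<Longrightarrow> zero_extension T u t x \<in> borel_measurable (F t)"
    "AE w in M. L2_path T (\<lambda>t x. zero_extension T u t x w)"
    "\<And>t. t \<in> {0..T} \<Longrightarrow> AE x in unit_lborel. \<exists>J \<Phi>. has_walsh_integral M F W t \<Phi> J \<and>
        (\<forall>s\<in>{0..t}. \<forall>y\<in>{0..1}. \<forall>w. \<Phi> s y w = heat_kernel (t - s) x y * \<sigma> (zero_extension T u s y w)) \<and>
        (AE w in M. set_integrable lborel ({0..t} \<times> {0..1}) (\<lambda>(s, y). heat_kernel (t - s) x y * b (zero_extension T u s y w)) \<and>
           zero_extension T u t x w = heat_semigroup t u0 x
             + set_lebesgue_integral lborel ({0..t} \<times> {0..1}) (\<lambda>(s, y). heat_kernel (t - s) x y * b (zero_extension T u s y w))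
             + J w)"
proof -
  have m: "(\<lambda>(t, x, \<omega>). u t x \<omega>) \<in> borel_measurable
        (restrict_space borel {0..T} \<Otimes>\<^sub>M (restrict_space borel {0..1} \<Otimes>\<^sub>M M))"
    using sol unfolding mild_solution_def by blast
  show meas: "jointly_measurable M (\<lambda>s y w. zero_extension T u s y w)"
    unfolding zero_extension_def by (rule measurable_extend_triple[OF m]) simp_all
  show "zero_extension T u t x \<in> borel_measurable (F t)" if "t \<in> {0..T}" "x \<in> {0..1}" for t x
  proof -
    have "zero_extension T u t x = u t x" using that by (auto simp: zero_extension_eq)
    then show ?thesis using sol that unfolding mild_solution_def by simp
  qed
  show "AE w in M. L2_path T (\<lambda>t x. zero_extension T u t x w)"
    using path AE_space
  proof eventually_elim
    case (elim w)
    show ?case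
      by (rule path_in_C_L2_imp_L2_path[OF elim(1)])
         (simp_all add: zero_extension_eq measurable_section_unit[OF meas elim(2)])
  qed
  fix t assume t: "t \<in> {0..T}"
  have ext: "zero_extension T u s y w = u s y w" if "s \<in> {0..t}" "y \<in> {0..1}" for s y w
    using that t by (auto simp: zero_extension_def)
  have int: "set_integrable lborel ({0..t} \<times> {0..1}) (\<lambda>(s, y). heat_kernel (t - s) x y * b (zero_extension T u s y w))
      = set_integrable lborel ({0..t} \<times> {0..1}) (\<lambda>(s, y). heat_kernel (t - s) x y * b (u s y w))" for x w
    by (rule set_integrable_cong) (auto simp: ext)
  have val: "set_lebesgue_integral lborel ({0..t} \<times> {0..1}) (\<lambda>(s, y). heat_kernel (t - s) x y * b (zero_extension T u s y w))
      = set_lebesgue_integral lborel ({0..t} \<times> {0..1}) (\<lambda>(s, y). heat_kernel (t - s) x y * b (u s y w))" for x w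
    by (rule set_lebesgue_integral_cong) (auto simp: ext borel_Times)
  have "AE x in lebesgue_on {0..1}. \<exists>J.
        has_walsh_integral M F W t (\<lambda>s y \<omega>. heat_kernel (t - s) x y * \<sigma> (u s y \<omega>)) J \<and>
        (AE \<omega> in M.
           set_integrable lborel ({0..t} \<times> {0..1}) (\<lambda>(s, y). heat_kernel (t - s) x y * b (u s y \<omega>)) \<and>
           u t x \<omega> = heat_semigroup t u0 x
             + set_lebesgue_integral lborel ({0..t} \<times> {0..1}) (\<lambda>(s, y). heat_kernel (t - s) x y * b (u s y \<omega>))
             + J \<omega>)"
    using sol t unfolding mild_solution_def by blast
  from AE_lebesgue_on_unit[OF this] AE_space
  show "AE x in unit_lborel. \<exists>J \<Phi>. has_walsh_integral M F W t \<Phi> J \<and>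
        (\<forall>s\<in>{0..t}. \<forall>y\<in>{0..1}. \<forall>w. \<Phi> s y w = heat_kernel (t - s) x y * \<sigma> (zero_extension T u s y w)) \<and>
        (AE w in M. set_integrable lborel ({0..t} \<times> {0..1}) (\<lambda>(s, y). heat_kernel (t - s) x y * b (zero_extension T u s y w)) \<and>
           zero_extension T u t x w = heat_semigroup t u0 x
             + set_lebesgue_integral lborel ({0..t} \<times> {0..1}) (\<lambda>(s, y). heat_kernel (t - s) x y * b (zero_extension T u s y w))
             + J w)"
  proof eventually_elim
    case (elim x)
    then obtain J where J: "has_walsh_integral M F W t (\<lambda>s y \<omega>. heat_kernel (t - s) x y * \<sigma> (u s y \<omega>)) J"
      "AE \<omega> in M. set_integrable lborel ({0..t} \<times> {0..1}) (\<lambda>(s, y). heat_kernel (t - s) x y * b (u s y \<omega>)) \<and>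
           u t x \<omega> = heat_semigroup t u0 x
             + set_lebesgue_integral lborel ({0..t} \<times> {0..1}) (\<lambda>(s, y). heat_kernel (t - s) x y * b (u s y \<omega>))
             + J \<omega>" by blast
    have x: "x \<in> {0..1}" using elim(2) by (simp add: space_restrict_space)
    have tt: "t \<in> {0..t}" using t by simp
    \<comment> \<open>The witness keeps the original integrand, for which the Walsh integral was
      given; it agrees with the extended one on the rectangle.\<close>
    show ?case
      unfolding int val ext[OF tt x]
      by (rule exI[of _ J], rule exI[of _ "\<lambda>s y \<omega>. heat_kernel (t - s) x y * \<sigma> (u s y \<omega>)"])
         (use J ext in auto)
  qed
qed

theorem theorem2p5:
  fixes M :: "'w measure" and F :: "real \<Rightarrow> 'w measure"
    and W :: "(real \<times> real) set \<Rightarrow> 'w \<Rightarrow> real"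
    and u0 b \<sigma> :: "real \<Rightarrow> real" and c3 c4 c5 d3 T :: real
  assumes "space_time_white_noise M F W"
    and "L2 u0"
    and "c3 \<ge> 0" "c4 \<ge> 0" "c5 \<ge> 0" "d3 \<ge> 0"
    and "\<And>u v. \<bar>b u - b v\<bar> \<le> c3 * \<bar>u - v\<bar> * log_plus (1 / \<bar>u - v\<bar>)
           + c4 * log_plus (max \<bar>u\<bar> \<bar>v\<bar>) * \<bar>u - v\<bar> + c5 * \<bar>u - v\<bar>"
    and "\<And>u v. \<bar>\<sigma> u - \<sigma> v\<bar> \<le> d3 * \<bar>u - v\<bar>"
    and "T > 0"
  shows "pathwise_uniqueness_C_L2 M F W b \<sigma> u0 T"
  unfolding pathwise_uniqueness_C_L2_def
proof (intro allI impI)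
  fix u v assume sol: "mild_solution M F W b \<sigma> u0 T u" "mild_solution M F W b \<sigma> u0 T v"
    and path: "AE \<omega> in M. path_in_C_L2 T (\<lambda>t x. u t x \<omega>)" "AE \<omega> in M. path_in_C_L2 T (\<lambda>t x. v t x \<omega>)"
  interpret space_time_white_noise M F W by fact
  note eu = mild_solution_zero_extension[OF sol(1) path(1)] and ev = mild_solution_zero_extension[OF sol(2) path(2)]
  interpret two_solutions M F W b \<sigma> c3 c4 c5 d3 T "zero_extension T u" "zero_extension T v"
  proof (unfold_locales, fact+)
    fix t assume t: "t \<in> {0..T}"
    let ?D = "\<lambda>u x w. set_lebesgue_integral lborel ({0..t} \<times> {0..1}) (\<lambda>(s, y). heat_kernel (t - s) x y * b (zero_extension T u s y w))"
    let ?I = "\<lambda>u x w. set_integrable lborel ({0..t} \<times> {0..1}) (\<lambda>(s, y). heat_kernel (t - s) x y * b (zero_extension T u s y w))"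
    show "AE x in unit_lborel. \<exists>J1 J2 \<Phi>1 \<Phi>2.
        has_walsh_integral M F W t \<Phi>1 J1 \<and> has_walsh_integral M F W t \<Phi>2 J2 \<and>
        (\<forall>s\<in>{0..t}. \<forall>y\<in>{0..1}. \<forall>w. \<Phi>1 s y w = heat_kernel (t - s) x y * \<sigma> (zero_extension T u s y w) \<and>
           \<Phi>2 s y w = heat_kernel (t - s) x y * \<sigma> (zero_extension T v s y w)) \<and>
        (AE w in M. ?I u x w \<and> ?I v x w \<and>
           zero_extension T u t x w - zero_extension T v t x w = ?D u x w - ?D v x w + (J1 w - J2 w))"
      using eu(4)[OF t] ev(4)[OF t]
    proof eventually_elim
      case (elim x)
      obtain J1 \<Phi>1 where 1: "has_walsh_integral M F W t \<Phi>1 J1"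
        "\<forall>s\<in>{0..t}. \<forall>y\<in>{0..1}. \<forall>w. \<Phi>1 s y w = heat_kernel (t - s) x y * \<sigma> (zero_extension T u s y w)"
        "AE w in M. ?I u x w \<and> zero_extension T u t x w = heat_semigroup t u0 x + ?D u x w + J1 w"
        using elim(1) by blast
      obtain J2 \<Phi>2 where 2: "has_walsh_integral M F W t \<Phi>2 J2"
        "\<forall>s\<in>{0..t}. \<forall>y\<in>{0..1}. \<forall>w. \<Phi>2 s y w = heat_kernel (t - s) x y * \<sigma> (zero_extension T v s y w)"
        "AE w in M. ?I v x w \<and> zero_extension T v t x w = heat_semigroup t u0 x + ?D v x w + J2 w"
        using elim(2) by blast
      \<comment> \<open>Both equations contain the same term \<open>heat_semigroup t u0 x\<close>,
        which cancels in the difference.\<close>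
      have "AE w in M. ?I u x w \<and> ?I v x w \<and>
           zero_extension T u t x w - zero_extension T v t x w = ?D u x w - ?D v x w + (J1 w - J2 w)"
        using 1(3) 2(3) by eventually_elim (intro conjI; linarith?; blast)
      with 1(1,2) 2(1,2) show ?case by blast
    qed
  qed
  show "AE \<omega> in M. (SUP t\<in>{0..T}. ennreal (L2_norm (\<lambda>x. u t x \<omega> - v t x \<omega>))) = 0"
    using solutions_coincide path
  proof eventually_elim
    case (elim \<omega>)
    have "ennreal (L2_norm (\<lambda>x. u t x \<omega> - v t x \<omega>)) = 0" if t: "t \<in> {0..T}" for t
    proof -
      \<comment> \<open>Without square integrability the Bochner integral in \<open>L2_norm\<close>
        could take its default value zero and would say nothing about
        \<open>sq_norm\<close>.\<close>
      have "L2 (\<lambda>x. u t x \<omega> - v t x \<omega>)"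
        using elim(2,3) t by (intro L2_diff) (auto simp: path_in_C_L2_def)
      then have "ennreal ((L2_norm (\<lambda>x. u t x \<omega> - v t x \<omega>))\<^sup>2) = sq_norm (\<lambda>x. u t x \<omega> - v t x \<omega>)"
        by (rule L2_sq_norm[symmetric])
      also have "\<dots> = sq_norm (\<lambda>x. zero_extension T u t x \<omega> - zero_extension T v t x \<omega>)"
        by (rule sq_norm_cong) (simp only: zero_extension_eq[OF t])
      also have "\<dots> = 0" using elim(1) t by blast
      finally have "(L2_norm (\<lambda>x. u t x \<omega> - v t x \<omega>))\<^sup>2 \<le> 0" by (simp only: ennreal_eq_0_iff)
      then show ?thesis by simp
    qed
    then show ?case using \<open>T > 0\<close> by simp
  qed
qed

end
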